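(* Let $C$ be a category and let $c\colon\Delta^0\to C$ be an element of $C$. Let ${}^{c/}C$ be the coslice category, i.e. the total space of the covariant family $(\mathrm{Hom}(c,x))_{x:C}$, and let $\mathrm{id}_c\colon\Delta^0\to{}^{c/}C$ be the element given by the identity arrow of $c$. Let $\rho\colon F\to{}^{c/}C$ be a covariant family, and let $d\colon\Delta^0\to F$ be an element of the fiber $F_{\mathrm{id}_c}$, i.e. $\rho\circ d=\mathrm{id}_c$. Then there exists a section $s\colon{}^{c/}C\to F$ of $\rho$, $\rho\circ s=\mathrm{id}_{{}^{c/}C}$, such that $s\circ\mathrm{id}_c=d$.
   Context: Ambient setting: the category of simplicial objects in simplicial sets (bisimplicial sets), with the Reedy (= injective) model structure built from the Kan–Quillen model structure: cofibrations are monomorphisms and weak equivalences ("equivalences") are levelwise weak homotopy equivalences. A "simplicial space" is a fibrant object; a "family of simplicial spaces" $(E_x)_{x:B}$ is a fibration $E\to B$, with $E_x$ its fiber over $x$. $\Delta^n$ and $\Lambda^2_1\subset\Delta^2$ denote the discretely embedded simplicial spaces (simplicial sets regarded as simplicial objects valued in discrete simplicial sets); so $\Delta^1$ is the "walking arrow". Exponentials $X^K$ are internal homs of bisimplicial sets. Paths use a different interval: the constant simplicial object $J$ with value the simplicial set $\Delta^1$; $(x\sim y)_{x,y:X}$ is the family $X^J\to X\times X$ (fibered over a base when $X$ is given in context). Arrows: $(\mathrm{Hom}(x,y))_{x,y:C}$ is the fibration $(\mathrm{ev}_0,\mathrm{ev}_1)\colon C^{\Delta^1}\to C\times C$; identity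 arrows are given by the map $\mathrm{id}\colon C\to C^{\Delta^1}$ induced by $\Delta^1\to\Delta^0$. Precategory: a simplicial space $C$ such that the restriction $C^{\Delta^2}\to C^{\Lambda^2_1}$ is an equivalence. Composition $g\circ f$ is obtained by applying a section of this trivial fibration and then restricting along $\delta^1\colon\Delta^1\to\Delta^2$. Category: a precategory $C$ such that the map over $C\times C$ from $C$ (viewed via the diagonal, as a model of the path family $(x\sim y)_{x,y:C}$) to the total space of the family $(x\cong y)_{x,y:C}$, defined by sending constant paths to identity isomorphisms, is an equivalence. Here $x\cong y:=\Sigma_{f:\mathrm{Hom}(x,y)}\mathrm{isIso}(f)$ with $\mathrm{isIso}(f):=\bigl(\Sigma_{g:\mathrm{Hom}(y,x)}\,g\circ f\sim\mathrm{id}_x\bigr)\times\bigl(\Sigma_{h:\mathrm{Hom}(y,x)}\,f\circ h\sim\mathrm{id}_y\bigr)$, where $\Sigma$ is the total space of a family. Covariant family: a family $E\to B$ such that for every arrow $f:\mathrm{Hom}(x,y)$ in $B$ the evaluation at source from the simplicial space of arrows in $E$ lying over $f$ to $E_x$ is an equivalence; equivalently, the map $E^{\Delta^1}\to B^{\Delta^1}\times_B E$ induced by $\mathrm{ev}_0$ is an equivalence. Coslice: ${}^{c/}C:=\Delta^0\times_C C^{\Delta^1}$, the pullback of $\mathrm{ev}_0\colon C^{\Delta^1}\to C$ along $c$, with projection $\mathrm{ev}_1\colon{}^{c/}C\to C$ being the covariant family $(\mathrm{Hom}(c,x))_{x:C}$. *)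

theory Defs
  imports "HOL-Library.FuncSet"
begin

section \<open>Presheaves on a small category\<close>

text \<open>
  Simplicial and bisimplicial sets are treated uniformly as presheaves.  Composition is in
  applicative order: \<open>cmp D v u\<close> is \<open>v \<circ> u\<close>.
\<close>

record ('o, 'm) small_cat =
  arr :: "'o \<Rightarrow> 'o \<Rightarrow> 'm set"
  idn :: "'o \<Rightarrow> 'm"
  cmp :: "'m \<Rightarrow> 'm \<Rightarrow> 'm"

text \<open>For \<open>u : p \<rightarrow> q\<close>, the restriction map along \<open>u\<close> is \<open>act X p q u\<close>, from \<open>cells X q\<close> to \<open>cells X p\<close>.\<close>

record ('o, 'm, 'a) psh =
  cells :: "'o \<Rightarrow> 'a set"
  act :: "'o \<Rightarrow> 'o \<Rightarrow> 'm \<Rightarrow> 'a \<Rightarrow> 'a"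

definition presheaf :: "('o, 'm) small_cat \<Rightarrow> ('o, 'm, 'a) psh \<Rightarrow> bool" where
  "presheaf D X \<longleftrightarrow>
     (\<forall>p q. \<forall>u\<in>arr D p q. \<forall>x\<in>cells X q. act X p q u x \<in> cells X p) \<and>
     (\<forall>p. \<forall>x\<in>cells X p. act X p p (idn D p) x = x) \<and>
     (\<forall>p q r. \<forall>u\<in>arr D p q. \<forall>v\<in>arr D q r. \<forall>x\<in>cells X r.
        act X p r (cmp D v u) x = act X p q u (act X q r v x))"

definition nat_trans ::
  "('o, 'm) small_cat \<Rightarrow> ('o, 'm, 'a) psh \<Rightarrow> ('o, 'm, 'b) psh \<Rightarrow> ('o \<Rightarrow> 'a \<Rightarrow> 'b) \<Rightarrow> bool" where
  "nat_trans D X Y f \<longleftrightarrow>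
     (\<forall>p. \<forall>x\<in>cells X p. f p x \<in> cells Y p) \<and>
     (\<forall>p q. \<forall>u\<in>arr D p q. \<forall>x\<in>cells X q. f p (act X p q u x) = act Y p q u (f q x))"

text \<open>
  Values outside the cells are irrelevant to \<open>nat_trans\<close>; fixing them to be \<open>undefined\<close> makes
  HOL equality on the hom-set agree with equality of morphisms of presheaves.
\<close>

definition Nat ::
  "('o, 'm) small_cat \<Rightarrow> ('o, 'm, 'a) psh \<Rightarrow> ('o, 'm, 'b) psh \<Rightarrow> ('o \<Rightarrow> 'a \<Rightarrow> 'b) set" where
  "Nat D X Y = {f. nat_trans D X Y f \<and> (\<forall>p. f p \<in> extensional (cells X p))}"

definition yoneda :: "('o, 'm) small_cat \<Rightarrow> 'o \<Rightarrow> ('o, 'm, 'm) psh" where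
  "yoneda D q = \<lparr>cells = (\<lambda>p. arr D p q), act = (\<lambda>p p' u v. cmp D v u)\<rparr>"

definition psh_prod :: "('o, 'm, 'a) psh \<Rightarrow> ('o, 'm, 'b) psh \<Rightarrow> ('o, 'm, 'a \<times> 'b) psh" where
  "psh_prod X Y =
     \<lparr>cells = (\<lambda>p. cells X p \<times> cells Y p),
      act = (\<lambda>p q u (x, y). (act X p q u x, act Y p q u y))\<rparr>"

definition psh_pullback ::
  "('o, 'm, 'a) psh \<Rightarrow> ('o, 'm, 'b) psh \<Rightarrow> ('o \<Rightarrow> 'a \<Rightarrow> 'c) \<Rightarrow> ('o \<Rightarrow> 'b \<Rightarrow> 'c) \<Rightarrow> ('o, 'm, 'a \<times> 'b) psh"
  where
  "psh_pullback X Y f g =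
     (psh_prod X Y)\<lparr>cells := (\<lambda>p. {(x, y). x \<in> cells X p \<and> y \<in> cells Y p \<and> f p x = g p y})\<rparr>"

text \<open>The exponential \<open>X\<^sup>K\<close>: its \<open>q\<close>-cells are the morphisms \<open>yoneda q \<times> K \<rightarrow> X\<close>.\<close>

definition psh_exp ::
  "('o, 'm) small_cat \<Rightarrow> ('o, 'm, 'a) psh \<Rightarrow> ('o, 'm, 'k) psh \<Rightarrow> ('o, 'm, 'o \<Rightarrow> 'm \<times> 'k \<Rightarrow> 'a) psh" where
  "psh_exp D X K =
     \<lparr>cells = (\<lambda>q. Nat D (psh_prod (yoneda D q) K) X),
      act = (\<lambda>p q u \<theta> r. \<lambda>(v, z)\<in>arr D r p \<times> cells K r. \<theta> r (cmp D u v, z))\<rparr>"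

text \<open>
  For \<open>i : K \<rightarrow> L\<close> and \<open>f : X \<rightarrow> Y\<close>, the induced maps \<open>X\<^sup>i : X\<^sup>L \<rightarrow> X\<^sup>K\<close> and \<open>f\<^sup>K : X\<^sup>K \<rightarrow> Y\<^sup>K\<close>, and the
  map \<open>X \<rightarrow> X\<^sup>K\<close> induced by the projection of \<open>K\<close> to the point.
\<close>

definition exp_pre ::
  "('o, 'm) small_cat \<Rightarrow> ('o, 'm, 'k) psh \<Rightarrow> ('o \<Rightarrow> 'k \<Rightarrow> 'l) \<Rightarrow>
   'o \<Rightarrow> ('o \<Rightarrow> 'm \<times> 'l \<Rightarrow> 'a) \<Rightarrow> ('o \<Rightarrow> 'm \<times> 'k \<Rightarrow> 'a)" where
  "exp_pre D K i q \<theta> = (\<lambda>r. \<lambda>(v, z)\<in>arr D r q \<times> cells K r. \<theta> r (v, i r z))"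

definition exp_post ::
  "('o, 'm) small_cat \<Rightarrow> ('o, 'm, 'k) psh \<Rightarrow> ('o \<Rightarrow> 'a \<Rightarrow> 'b) \<Rightarrow>
   'o \<Rightarrow> ('o \<Rightarrow> 'm \<times> 'k \<Rightarrow> 'a) \<Rightarrow> ('o \<Rightarrow> 'm \<times> 'k \<Rightarrow> 'b)" where
  "exp_post D K f q \<theta> = (\<lambda>r. \<lambda>(v, z)\<in>arr D r q \<times> cells K r. f r (\<theta> r (v, z)))"

definition exp_const ::
  "('o, 'm) small_cat \<Rightarrow> ('o, 'm, 'a) psh \<Rightarrow> ('o, 'm, 'k) psh \<Rightarrow>
   'o \<Rightarrow> 'a \<Rightarrow> ('o \<Rightarrow> 'm \<times> 'k \<Rightarrow> 'a)" where
  "exp_const D X K q x = (\<lambda>r. \<lambda>(v, z)\<in>arr D r q \<times> cells K r. act X r q v x)"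

text \<open>Evaluation \<open>X\<^sup>K \<rightarrow> X\<close> at a global element \<open>e\<close> of \<open>K\<close>, given by its cells \<open>e q\<close>.\<close>

definition exp_ev ::
  "('o, 'm) small_cat \<Rightarrow> ('o \<Rightarrow> 'k) \<Rightarrow> 'o \<Rightarrow> ('o \<Rightarrow> 'm \<times> 'k \<Rightarrow> 'a) \<Rightarrow> 'a" where
  "exp_ev D e q \<theta> = \<theta> q (idn D q, e q)"


section \<open>Simplicial sets\<close>

text \<open>
  A monotone map \<open>\<alpha> : [m] \<rightarrow> [n]\<close> is encoded as the list \<open>[\<alpha> 0, \<dots>, \<alpha> m]\<close> of its values.
\<close>

definition simplex_cat :: "(nat, nat list) small_cat" where
  "simplex_cat =
     \<lparr>arr = (\<lambda>m n. {xs. length xs = Suc m \<and> sorted xs \<and> set xs \<subseteq> {..n}}),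
      idn = (\<lambda>n. [0..<Suc n]),
      cmp = (\<lambda>\<beta> \<alpha>. map (\<lambda>i. \<beta> ! i) \<alpha>)\<rparr>"

type_synonym 'a sset = "(nat, nat list, 'a) psh"

abbreviation sset :: "'a sset \<Rightarrow> bool" where
  "sset \<equiv> presheaf simplex_cat"

abbreviation smap :: "'a sset \<Rightarrow> 'b sset \<Rightarrow> (nat \<Rightarrow> 'a \<Rightarrow> 'b) \<Rightarrow> bool" where
  "smap \<equiv> nat_trans simplex_cat"

definition std_simplex :: "nat \<Rightarrow> nat list sset"  ("\<Delta>[_]") where
  "\<Delta>[n] = yoneda simplex_cat n"

definition boundary :: "nat \<Rightarrow> nat list sset"  ("\<partial>\<Delta>[_]") where
  "\<partial>\<Delta>[n] = \<Delta>[n]\<lparr>cells := (\<lambda>m. {z \<in> cells \<Delta>[n] m. set z \<noteq> {..n}})\<rparr>"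

definition horn :: "nat \<Rightarrow> nat \<Rightarrow> nat list sset"  ("\<Lambda>[_,_]") where
  "\<Lambda>[n,k] = \<Delta>[n]\<lparr>cells := (\<lambda>m. {z \<in> cells \<Delta>[n] m. insert k (set z) \<noteq> {..n}})\<rparr>"

text \<open>The degenerate \<open>m\<close>-simplex on the vertex \<open>i\<close> of a standard simplex.\<close>

definition vertex :: "nat \<Rightarrow> nat \<Rightarrow> nat list" where
  "vertex i m = replicate (Suc m) i"

definition kan_fibration :: "'a sset \<Rightarrow> 'b sset \<Rightarrow> (nat \<Rightarrow> 'a \<Rightarrow> 'b) \<Rightarrow> bool" where
  "kan_fibration X Y p \<longleftrightarrow> sset X \<and> sset Y \<and> smap X Y p \<and>
     (\<forall>n k u v. 1 \<le> n \<and> k \<le> n \<and> smap \<Lambda>[n,k] X u \<and> smap \<Delta>[n] Y v \<and>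
        (\<forall>m. \<forall>z\<in>cells \<Lambda>[n,k] m. p m (u m z) = v m z) \<longrightarrow>
        (\<exists>w. smap \<Delta>[n] X w \<and>
           (\<forall>m. \<forall>z\<in>cells \<Lambda>[n,k] m. w m z = u m z) \<and>
           (\<forall>m. \<forall>z\<in>cells \<Delta>[n] m. p m (w m z) = v m z)))"

definition kan_complex :: "'a sset \<Rightarrow> bool" where
  "kan_complex X \<longleftrightarrow> kan_fibration X \<Delta>[0] (\<lambda>m x. vertex 0 m)"

definition shomotopic :: "'a sset \<Rightarrow> 'b sset \<Rightarrow> (nat \<Rightarrow> 'a \<Rightarrow> 'b) \<Rightarrow> (nat \<Rightarrow> 'a \<Rightarrow> 'b) \<Rightarrow> bool" where
  "shomotopic X Z f g \<longleftrightarrow>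
     (\<exists>H. smap (psh_prod X \<Delta>[1]) Z H \<and>
        (\<forall>m. \<forall>x\<in>cells X m. H m (x, vertex 0 m) = f m x \<and> H m (x, vertex 1 m) = g m x))"

text \<open>
  Weak homotopy equivalences: \<open>f : X \<rightarrow> Y\<close> such that, for every Kan complex \<open>Z\<close>, precomposition
  with \<open>f\<close> is a bijection on homotopy classes of maps \<open>[Y, Z] \<rightarrow> [X, Z]\<close> (for maps into a Kan
  complex, \<open>shomotopic\<close> is already an equivalence relation).  As HOL cannot quantify over types,
  the simplices of \<open>Z\<close> are drawn from the fixed type \<open>('a + 'b) list\<close>.  This is no restriction:
  the Kan replacements \<open>Ex\<^sup>\<infinity> X\<close> and \<open>Ex\<^sup>\<infinity> Y\<close> have, in each dimension, at most
  \<open>max \<aleph>\<^sub>0 |'a + 'b|\<close> simplices, hence have isomorphic copies with simplices in this type, and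
  bijectivity for these two Kan complexes already makes \<open>Ex\<^sup>\<infinity> f\<close> a homotopy equivalence.
\<close>

definition weak_homotopy_equivalence :: "'a sset \<Rightarrow> 'b sset \<Rightarrow> (nat \<Rightarrow> 'a \<Rightarrow> 'b) \<Rightarrow> bool" where
  "weak_homotopy_equivalence X Y f \<longleftrightarrow> smap X Y f \<and>
     (\<forall>Z :: ('a + 'b) list sset. kan_complex Z \<longrightarrow>
        (\<forall>g. smap X Z g \<longrightarrow>
           (\<exists>h. smap Y Z h \<and> shomotopic X Z (\<lambda>m x. h m (f m x)) g)) \<and>
        (\<forall>h h'. smap Y Z h \<and> smap Y Z h' \<and>
           shomotopic X Z (\<lambda>m x. h m (f m x)) (\<lambda>m x. h' m (f m x)) \<longrightarrow> shomotopic Y Z h h'))"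


section \<open>Bisimplicial sets and the Reedy model structure\<close>

text \<open>
  In a bidegree \<open>(n, k)\<close>, the first component is the simplicial direction of simplicial objects
  and the second that of their values, which are simplicial sets.
\<close>

definition bisimplex_cat :: "(nat \<times> nat, nat list \<times> nat list) small_cat" where
  "bisimplex_cat =
     \<lparr>arr = (\<lambda>p q. arr simplex_cat (fst p) (fst q) \<times> arr simplex_cat (snd p) (snd q)),
      idn = (\<lambda>q. (idn simplex_cat (fst q), idn simplex_cat (snd q))),
      cmp = (\<lambda>v u. (cmp simplex_cat (fst v) (fst u), cmp simplex_cat (snd v) (snd u)))\<rparr>"

type_synonym 'a bisset = "(nat \<times> nat, nat list \<times> nat list, 'a) psh"

type_synonym ('a, 'b) bitrans = "nat \<times> nat \<Rightarrow> 'a \<Rightarrow> 'b"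

text \<open>The type of cells of an exponential whose exponent has list-valued cells.\<close>

type_synonym 'a cube = "nat \<times> nat \<Rightarrow> (nat list \<times> nat list) \<times> nat list \<Rightarrow> 'a"

abbreviation bisset :: "'a bisset \<Rightarrow> bool" where
  "bisset \<equiv> presheaf bisimplex_cat"

abbreviation bimap :: "'a bisset \<Rightarrow> 'b bisset \<Rightarrow> ('a, 'b) bitrans \<Rightarrow> bool" where
  "bimap \<equiv> nat_trans bisimplex_cat"

definition level :: "'a bisset \<Rightarrow> nat \<Rightarrow> 'a sset" where
  "level X n =
     \<lparr>cells = (\<lambda>k. cells X (n, k)),
      act = (\<lambda>k l \<beta>. act X (n, k) (n, l) (idn simplex_cat n, \<beta>))\<rparr>"

definition row :: "'a bisset \<Rightarrow> nat \<Rightarrow> 'a sset" where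
  "row X k =
     \<lparr>cells = (\<lambda>n. cells X (n, k)),
      act = (\<lambda>m n \<alpha>. act X (m, k) (n, k) (\<alpha>, idn simplex_cat k))\<rparr>"

definition equivalence :: "'a bisset \<Rightarrow> 'b bisset \<Rightarrow> ('a, 'b) bitrans \<Rightarrow> bool" where
  "equivalence X Y f \<longleftrightarrow> bimap X Y f \<and>
     (\<forall>n. weak_homotopy_equivalence (level X n) (level Y n) (\<lambda>k. f (n, k)))"

text \<open>
  The matching object \<open>M\<^sub>n X\<close> is the limit of the simplicial sets \<open>X\<^sub>m\<close> over the simplices
  \<open>[m] \<rightarrow> [n]\<close> of \<open>\<partial>\<Delta>[n]\<close>; so its \<open>k\<close>-simplices are the maps of simplicial sets
  from \<open>\<partial>\<Delta>[n]\<close> to the \<open>k\<close>-th row of \<open>X\<close>.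
\<close>

definition matching :: "'a bisset \<Rightarrow> nat \<Rightarrow> (nat \<Rightarrow> nat list \<Rightarrow> 'a) sset" where
  "matching X n =
     \<lparr>cells = (\<lambda>k. Nat simplex_cat \<partial>\<Delta>[n] (row X k)),
      act = (\<lambda>k l \<beta> \<theta> m. \<lambda>z\<in>cells \<partial>\<Delta>[n] m. act X (m, k) (m, l) (idn simplex_cat m, \<beta>) (\<theta> m z))\<rparr>"

definition to_matching :: "'a bisset \<Rightarrow> nat \<Rightarrow> nat \<Rightarrow> 'a \<Rightarrow> (nat \<Rightarrow> nat list \<Rightarrow> 'a)" where
  "to_matching X n k x =
     (\<lambda>m. \<lambda>z\<in>cells \<partial>\<Delta>[n] m. act X (m, k) (n, k) (z, idn simplex_cat k) x)"

definition matching_map ::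
  "('a, 'b) bitrans \<Rightarrow> nat \<Rightarrow> nat \<Rightarrow> (nat \<Rightarrow> nat list \<Rightarrow> 'a) \<Rightarrow> (nat \<Rightarrow> nat list \<Rightarrow> 'b)" where
  "matching_map p n k \<theta> = (\<lambda>m. \<lambda>z\<in>cells \<partial>\<Delta>[n] m. p (m, k) (\<theta> m z))"

text \<open>Reedy fibrations: each relative matching map
  \<open>E\<^sub>n \<rightarrow> B\<^sub>n \<times>\<^bsub>M\<^sub>n B\<^esub> M\<^sub>n E\<close> is a Kan fibration.\<close>

definition reedy_fibration :: "'a bisset \<Rightarrow> 'b bisset \<Rightarrow> ('a, 'b) bitrans \<Rightarrow> bool" where
  "reedy_fibration E B p \<longleftrightarrow> bisset E \<and> bisset B \<and> bimap E B p \<and>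
     (\<forall>n. kan_fibration (level E n)
        (psh_pullback (level B n) (matching E n) (to_matching B n) (matching_map p n))
        (\<lambda>k x. (p (n, k) x, to_matching E n k x)))"

text \<open>Simplicial sets as discrete simplicial spaces, and as constant simplicial objects.\<close>

definition discrete :: "'a sset \<Rightarrow> 'a bisset" where
  "discrete K =
     \<lparr>cells = (\<lambda>q. cells K (fst q)), act = (\<lambda>p q u. act K (fst p) (fst q) (fst u))\<rparr>"

definition constant_obj :: "'a sset \<Rightarrow> 'a bisset" where
  "constant_obj K =
     \<lparr>cells = (\<lambda>q. cells K (snd q)), act = (\<lambda>p q u. act K (snd p) (snd q) (snd u))\<rparr>"

definition point :: "nat list bisset" where
  "point = discrete \<Delta>[0]"

definition simplicial_space :: "'a bisset \<Rightarrow> bool" where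
  "simplicial_space X \<longleftrightarrow> reedy_fibration X point (\<lambda>q x. vertex 0 (fst q))"


section \<open>Arrows and paths\<close>

definition Arrows :: "'a bisset \<Rightarrow> 'a cube bisset" where
  "Arrows C = psh_exp bisimplex_cat C (discrete \<Delta>[1])"

definition src :: "('a cube, 'a) bitrans" where
  "src = exp_ev bisimplex_cat (\<lambda>q. vertex 0 (fst q))"

definition tgt :: "('a cube, 'a) bitrans" where
  "tgt = exp_ev bisimplex_cat (\<lambda>q. vertex 1 (fst q))"

definition id_arrow :: "'a bisset \<Rightarrow> ('a, 'a cube) bitrans" where
  "id_arrow C = exp_const bisimplex_cat C (discrete \<Delta>[1])"

definition arrow_map :: "('a, 'b) bitrans \<Rightarrow> ('a cube, 'b cube) bitrans" where
  "arrow_map p = exp_post bisimplex_cat (discrete \<Delta>[1]) p"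

abbreviation path_interval :: "nat list bisset"  ("\<J>") where
  "\<J> \<equiv> constant_obj \<Delta>[1]"

text \<open>
  The paths in \<open>E\<close> fibred over the base \<open>B\<close> of \<open>p : E \<rightarrow> B\<close>, that is \<open>B \<times>\<^bsub>B\<^sup>J\<^esub> E\<^sup>J\<close>,
  presented as the subobject of \<open>E\<^sup>J\<close> of paths lying over a constant path
  (\<open>B \<rightarrow> B\<^sup>J\<close> being a monomorphism).
\<close>

definition fibred_paths :: "'a bisset \<Rightarrow> 'b bisset \<Rightarrow> ('a, 'b) bitrans \<Rightarrow> 'a cube bisset" where
  "fibred_paths E B p = (psh_exp bisimplex_cat E \<J>)
     \<lparr>cells := (\<lambda>q. {\<theta> \<in> cells (psh_exp bisimplex_cat E \<J>) q.
        \<exists>b\<in>cells B q. exp_post bisimplex_cat \<J> p q \<theta> = exp_const bisimplex_cat B \<J> q b})\<rparr>"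

definition path_start :: "('a cube, 'a) bitrans" where
  "path_start = exp_ev bisimplex_cat (\<lambda>q. vertex 0 (snd q))"

definition path_end :: "('a cube, 'a) bitrans" where
  "path_end = exp_ev bisimplex_cat (\<lambda>q. vertex 1 (snd q))"


section \<open>Precategories and categories\<close>

definition Triangles :: "'a bisset \<Rightarrow> 'a cube bisset" where
  "Triangles C = psh_exp bisimplex_cat C (discrete \<Delta>[2])"

definition Composable :: "'a bisset \<Rightarrow> 'a cube bisset" where
  "Composable C = psh_exp bisimplex_cat C (discrete \<Lambda>[2,1])"

definition segal_map :: "('a cube, 'a cube) bitrans" where
  "segal_map = exp_pre bisimplex_cat (discrete \<Lambda>[2,1]) (\<lambda>q z. z)"

definition precategory :: "'a bisset \<Rightarrow> bool" where
  "precategory C \<longleftrightarrow> simplicial_space C \<and> equivalence (Triangles C) (Composable C) segal_map"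

definition segal_section :: "'a bisset \<Rightarrow> ('a cube, 'a cube) bitrans \<Rightarrow> bool" where
  "segal_section C \<sigma> \<longleftrightarrow> bimap (Composable C) (Triangles C) \<sigma> \<and>
     (\<forall>q. \<forall>\<theta>\<in>cells (Composable C) q. segal_map q (\<sigma> q \<theta>) = \<theta>)"

text \<open>
  For arrows with \<open>tgt f = src g\<close>, the map out of \<open>\<Lambda>[2,1]\<close> that is \<open>f\<close> on the edge \<open>01\<close> and \<open>g\<close>
  on the edge \<open>12\<close>.
\<close>

definition composable_pair :: "('a cube \<times> 'a cube, 'a cube) bitrans" where
  "composable_pair q = (\<lambda>(g, f) r. \<lambda>(v, z)\<in>arr bisimplex_cat r q \<times> cells (discrete \<Lambda>[2,1]) r.
     if 2 \<in> set z then g r (v, map (\<lambda>i. i - 1) z) else f r (v, z))"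

text \<open>The composite \<open>g \<circ> f\<close>; the operator \<open>[0, 2]\<close> is \<open>\<delta>\<^sup>1 : [1] \<rightarrow> [2]\<close>.\<close>

definition compose_arrows ::
  "('a cube, 'a cube) bitrans \<Rightarrow> nat \<times> nat \<Rightarrow> 'a cube \<Rightarrow> 'a cube \<Rightarrow> 'a cube" where
  "compose_arrows \<sigma> q g f =
     exp_pre bisimplex_cat (discrete \<Delta>[1]) (\<lambda>r z. cmp simplex_cat [0, 2] z) q
       (\<sigma> q (composable_pair q (g, f)))"

text \<open>
  \<open>Isos C \<sigma>\<close> is the total space of \<open>(x \<cong> y)\<^bsub>x,y:C\<^esub>\<close>.  Its cells are tuples
  \<open>(f, (g, P), (h, Q))\<close> of \<open>f : Hom(x,y)\<close>, \<open>g, h : Hom(y,x)\<close>, \<open>P : g \<circ> f \<sim> id\<^sub>x\<close> and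
  \<open>Q : f \<circ> h \<sim> id\<^sub>y\<close>, where the paths are in the family \<open>Hom\<close>, fibred over \<open>C \<times> C\<close>.
\<close>

definition Hom_paths :: "'a bisset \<Rightarrow> 'a cube cube bisset" where
  "Hom_paths C = fibred_paths (Arrows C) (psh_prod C C) (\<lambda>q f. (src q f, tgt q f))"

definition Isos ::
  "'a bisset \<Rightarrow> ('a cube, 'a cube) bitrans \<Rightarrow>
   ('a cube \<times> ('a cube \<times> 'a cube cube) \<times> ('a cube \<times> 'a cube cube)) bisset" where
  "Isos C \<sigma> =
     (psh_prod (Arrows C)
        (psh_prod (psh_prod (Arrows C) (Hom_paths C)) (psh_prod (Arrows C) (Hom_paths C))))
     \<lparr>cells := (\<lambda>q. {(f, (g, P), (h, Q)).
        f \<in> cells (Arrows C) q \<and>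
        g \<in> cells (Arrows C) q \<and> src q g = tgt q f \<and> tgt q g = src q f \<and>
        P \<in> cells (Hom_paths C) q \<and>
        path_start q P = compose_arrows \<sigma> q g f \<and> path_end q P = id_arrow C q (src q f) \<and>
        h \<in> cells (Arrows C) q \<and> src q h = tgt q f \<and> tgt q h = src q f \<and>
        Q \<in> cells (Hom_paths C) q \<and>
        path_start q Q = compose_arrows \<sigma> q f h \<and> path_end q Q = id_arrow C q (tgt q f)})\<rparr>"

text \<open>
  A map sending each \<open>x\<close> to an identity isomorphism \<open>(id\<^sub>x, (id\<^sub>x, P), (id\<^sub>x, Q))\<close>.  As composition is
  unital only up to homotopy, the unit paths \<open>P\<close> and \<open>Q\<close> are not determined strictly; but
  \<open>isIso(f)\<close> is a proposition, so any two such maps are homotopic over \<open>C \<times> C\<close>.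
\<close>

definition id_iso_map ::
  "'a bisset \<Rightarrow> ('a cube, 'a cube) bitrans \<Rightarrow>
   ('a, 'a cube \<times> ('a cube \<times> 'a cube cube) \<times> ('a cube \<times> 'a cube cube)) bitrans \<Rightarrow> bool" where
  "id_iso_map C \<sigma> \<phi> \<longleftrightarrow> bimap C (Isos C \<sigma>) \<phi> \<and>
     (\<forall>q. \<forall>x\<in>cells C q. \<exists>P Q.
        \<phi> q x = (id_arrow C q x, (id_arrow C q x, P), (id_arrow C q x, Q)))"

text \<open>
  The condition does not depend on the choice of \<open>\<sigma>\<close> and \<open>\<phi>\<close>; both exist for any precategory.
\<close>

definition category :: "'a bisset \<Rightarrow> bool" where
  "category C \<longleftrightarrow> precategory C \<and>
     (\<exists>\<sigma> \<phi>. segal_section C \<sigma> \<and> id_iso_map C \<sigma> \<phi> \<and> equivalence C (Isos C \<sigma>) \<phi>)"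


section \<open>Covariant families and coslices\<close>

definition covariant :: "'a bisset \<Rightarrow> 'b bisset \<Rightarrow> ('a, 'b) bitrans \<Rightarrow> bool" where
  "covariant E B p \<longleftrightarrow> reedy_fibration E B p \<and>
     equivalence (Arrows E) (psh_pullback (Arrows B) E src p) (\<lambda>q \<theta>. (arrow_map p q \<theta>, src q \<theta>))"

definition coslice :: "'a bisset \<Rightarrow> (nat list, 'a) bitrans \<Rightarrow> (nat list \<times> 'a cube) bisset" where
  "coslice C c = psh_pullback point (Arrows C) c src"

definition coslice_id ::
  "'a bisset \<Rightarrow> (nat list, 'a) bitrans \<Rightarrow> (nat list, nat list \<times> 'a cube) bitrans" where
  "coslice_id C c q t = (t, id_arrow C q (c q t))"

end

theory Submission
  imports Defs
begin

text \<open>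
  Write \<open>X\<close> for the coslice.  The map \<open>(f, \<tau>) \<mapsto> (\<sigma> \<mapsto> f (min \<sigma> \<tau>))\<close> is a homotopy \<open>X \<times> \<Delta>\<^sup>1 \<rightarrow> X\<close> from
  the constant map at \<open>id\<^sub>c\<close> to the identity, and it fixes \<open>id\<^sub>c\<close>.  Lift it along \<open>\<rho>\<close>, starting at the
  constant map \<open>d\<close> and staying constant at \<open>d\<close> over \<open>id\<^sub>c\<close>; the end of the lifted homotopy is the
  section.  Such a lift exists because \<open>F\<^bsup>\<Delta>\<^sup>1\<^esup> \<rightarrow> X\<^bsup>\<Delta>\<^sup>1\<^esup> \<times>\<^bsub>X\<^esub> F\<close> is a Reedy fibration and a levelwise weak
  equivalence, hence lifts against all monomorphisms: its levels are Kan fibrations between Kan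
  complexes that are homotopy equivalences, so they are trivial fibrations; an induction over the
  matching objects yields the lifting property against boundaries of bisimplices; and any other
  monomorphism is built by attaching cells.
\<close>

section \<open>Presheaves and lifting\<close>

text \<open>\<open>weak_homotopy_equivalence\<close> is tested on Kan complexes in a fixed list
  type. It yields an honest homotopy inverse only if source and target are Kan complexes themselves.
  Hence both sides of the arrow map must first be shown to be levelwise Kan, and here the fibrancy
  of \<open>C\<close> enters. The levelwise condition gives lifts against \<Delta>[n] \<times>
  \<partial>\<Delta>[k] only, while attaching a bisimplex prescribes the boundary in both
  directions. The fibration condition, which is the one that controls \<partial>\<Delta>[n], closes
  this gap. Lifting problems for the arrow map are always transposed to problems for \<rho> on
  products with the interval, so no matching object of a space of arrows is ever computed. The
  minimum contracts \<Delta>[1] while fixing the vertex 0: min 0 \<tau> = 0 keeps the source of an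
  arrow at \<open>c\<close>, while min \<sigma> 0 = 0 and min \<sigma> 1 = \<sigma> give the two
  ends of the homotopy.\<close>

definition small_category :: "('o, 'm) small_cat \<Rightarrow> bool" where
  "small_category D \<longleftrightarrow>
     (\<forall>p. idn D p \<in> arr D p p) \<and>
     (\<forall>p q r. \<forall>u\<in>arr D p q. \<forall>v\<in>arr D q r. cmp D v u \<in> arr D p r) \<and>
     (\<forall>p q. \<forall>u\<in>arr D p q. cmp D u (idn D p) = u \<and> cmp D (idn D q) u = u) \<and>
     (\<forall>p q r t. \<forall>u\<in>arr D p q. \<forall>v\<in>arr D q r. \<forall>w\<in>arr D r t.
        cmp D w (cmp D v u) = cmp D (cmp D w v) u)"

lemma catD:
  assumes "small_category D"
  shows "idn D p \<in> arr D p p"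
    and "u \<in> arr D p q \<Longrightarrow> v \<in> arr D q r \<Longrightarrow> cmp D v u \<in> arr D p r"
    and "u \<in> arr D p q \<Longrightarrow> cmp D u (idn D p) = u"
    and "u \<in> arr D p q \<Longrightarrow> cmp D (idn D q) u = u"
    and "u \<in> arr D p q \<Longrightarrow> v \<in> arr D q r \<Longrightarrow> w \<in> arr D r t \<Longrightarrow>
           cmp D w (cmp D v u) = cmp D (cmp D w v) u"
  using assms unfolding small_category_def by blast+

lemma pshD:
  assumes "presheaf D X"
  shows "u \<in> arr D p q \<Longrightarrow> x \<in> cells X q \<Longrightarrow> act X p q u x \<in> cells X p"
    and "x \<in> cells X p \<Longrightarrow> act X p p (idn D p) x = x"
    and "u \<in> arr D p q \<Longrightarrow> v \<in> arr D q r \<Longrightarrow> x \<in> cells X r \<Longrightarrow>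
           act X p r (cmp D v u) x = act X p q u (act X q r v x)"
  using assms unfolding presheaf_def by blast+

lemma pshI:
  assumes "\<And>p q u x. u \<in> arr D p q \<Longrightarrow> x \<in> cells X q \<Longrightarrow> act X p q u x \<in> cells X p"
    and "\<And>p x. x \<in> cells X p \<Longrightarrow> act X p p (idn D p) x = x"
    and "\<And>p q r u v x. u \<in> arr D p q \<Longrightarrow> v \<in> arr D q r \<Longrightarrow> x \<in> cells X r \<Longrightarrow>
           act X p r (cmp D v u) x = act X p q u (act X q r v x)"
  shows "presheaf D X"
  using assms unfolding presheaf_def by blast

lemma natD:
  assumes "nat_trans D X Y f"
  shows "x \<in> cells X p \<Longrightarrow> f p x \<in> cells Y p"
    and "u \<in> arr D p q \<Longrightarrow> x \<in> cells X q \<Longrightarrow> f p (act X p q u x) = act Y p q u (f q x)"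
  using assms unfolding nat_trans_def by blast+

lemma natI:
  assumes "\<And>p x. x \<in> cells X p \<Longrightarrow> f p x \<in> cells Y p"
    and "\<And>p q u x. u \<in> arr D p q \<Longrightarrow> x \<in> cells X q \<Longrightarrow> f p (act X p q u x) = act Y p q u (f q x)"
  shows "nat_trans D X Y f"
  using assms unfolding nat_trans_def by blast

lemma nat_trans_comp:
  "nat_trans D X Y f \<Longrightarrow> nat_trans D Y Z g \<Longrightarrow> nat_trans D X Z (\<lambda>p x. g p (f p x))"
  unfolding nat_trans_def by simp

lemma cells_psh_prod [simp]: "cells (psh_prod X Y) p = cells X p \<times> cells Y p"
  and act_psh_prod [simp]: "act (psh_prod X Y) p q u (x, y) = (act X p q u x, act Y p q u y)"
  by (simp_all add: psh_prod_def)

lemma cells_yoneda [simp]: "cells (yoneda D q) p = arr D p q"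
  and act_yoneda [simp]: "act (yoneda D q) p p' u v = cmp D v u"
  by (simp_all add: yoneda_def)

lemma presheaf_prod: "presheaf D X \<Longrightarrow> presheaf D Y \<Longrightarrow> presheaf D (psh_prod X Y)"
  unfolding presheaf_def by auto

lemma presheaf_yoneda: "small_category D \<Longrightarrow> presheaf D (yoneda D q)"
  by (rule pshI) (simp_all add: catD)

definition subpresheaf :: "('o, 'm) small_cat \<Rightarrow> ('o, 'm, 'a) psh \<Rightarrow> ('o \<Rightarrow> 'a set) \<Rightarrow> bool" where
  "subpresheaf D Z S \<longleftrightarrow>
     (\<forall>p. S p \<subseteq> cells Z p) \<and> (\<forall>p q. \<forall>u\<in>arr D p q. \<forall>x\<in>S q. act Z p q u x \<in> S p)"

lemma subpresheafD:
  assumes "subpresheaf D Z S"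
  shows "x \<in> S p \<Longrightarrow> x \<in> cells Z p"
    and "u \<in> arr D p q \<Longrightarrow> x \<in> S q \<Longrightarrow> act Z p q u x \<in> S p"
  using assms unfolding subpresheaf_def by blast+

text \<open>Every monomorphism is isomorphic to an inclusion, so the left-hand maps are encoded as
  families of cell sets \<open>S\<close>. Unions, filtrations and pushout-products then become
  operations on sets.\<close>

definition lifts ::
  "('o, 'm) small_cat \<Rightarrow> ('o, 'm, 'a) psh \<Rightarrow> ('o, 'm, 'b) psh \<Rightarrow> ('o \<Rightarrow> 'a \<Rightarrow> 'b) \<Rightarrow>
   ('o, 'm, 'z) psh \<Rightarrow> ('o \<Rightarrow> 'z set) \<Rightarrow> bool" where
  "lifts D F X \<rho> Z S \<longleftrightarrow>
     (\<forall>u v. nat_trans D (Z\<lparr>cells := S\<rparr>) F u \<and> nat_trans D Z X v \<and>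
        (\<forall>p. \<forall>z\<in>S p. \<rho> p (u p z) = v p z) \<longrightarrow>
        (\<exists>w. nat_trans D Z F w \<and> (\<forall>p. \<forall>z\<in>S p. w p z = u p z) \<and>
           (\<forall>p. \<forall>z\<in>cells Z p. \<rho> p (w p z) = v p z)))"

lemma liftsI:
  assumes "\<And>u v. nat_trans D (Z\<lparr>cells := S\<rparr>) F u \<Longrightarrow> nat_trans D Z X v \<Longrightarrow>
        (\<And>p z. z \<in> S p \<Longrightarrow> \<rho> p (u p z) = v p z) \<Longrightarrow>
        \<exists>w. nat_trans D Z F w \<and> (\<forall>p. \<forall>z\<in>S p. w p z = u p z) \<and>
           (\<forall>p. \<forall>z\<in>cells Z p. \<rho> p (w p z) = v p z)"
  shows "lifts D F X \<rho> Z S"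
  using assms unfolding lifts_def by simp

lemma liftsE:
  assumes "lifts D F X \<rho> Z S"
    and "nat_trans D (Z\<lparr>cells := S\<rparr>) F u" "nat_trans D Z X v"
    and "\<forall>p. \<forall>z\<in>S p. \<rho> p (u p z) = v p z"
  obtains w where "nat_trans D Z F w" "\<And>p z. z \<in> S p \<Longrightarrow> w p z = u p z"
    "\<And>p z. z \<in> cells Z p \<Longrightarrow> \<rho> p (w p z) = v p z"
proof -
  have "\<exists>w. nat_trans D Z F w \<and> (\<forall>p. \<forall>z\<in>S p. w p z = u p z) \<and> (\<forall>p. \<forall>z\<in>cells Z p. \<rho> p (w p z) = v p z)"
    using assms(1)[unfolded lifts_def, THEN spec[of _ u], THEN spec[of _ v], THEN mp] assms(2-4) by blast
  then show thesis using that by blast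
qed

text \<open>Lifting properties pass to retracts of the left-hand map: only \<open>g\<close> after
  \<open>f\<close> has to be the identity. Extend \<open>u\<close> after \<open>g\<close>, then
  restrict along \<open>f\<close>. The applications merely rearrange products or drop a factor that
  is a point.\<close>

lemma lifts_iso:
  assumes L: "lifts D F X \<rho> Z S" and Z: "subpresheaf D Z S"
    and f: "nat_trans D Z' Z f" and g: "nat_trans D Z Z' g"
    and gf: "\<And>p z. z \<in> cells Z' p \<Longrightarrow> g p (f p z) = z"
    and fS: "\<And>p z. z \<in> S' p \<Longrightarrow> z \<in> cells Z' p \<and> f p z \<in> S p"
    and gS: "\<And>p z. z \<in> S p \<Longrightarrow> g p z \<in> S' p"
  shows "lifts D F X \<rho> Z' S'"
proof (rule liftsI)
  fix u v assume u: "nat_trans D (Z'\<lparr>cells := S'\<rparr>) F u" and v: "nat_trans D Z' X v"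
    and uv: "\<And>p z. z \<in> S' p \<Longrightarrow> \<rho> p (u p z) = v p z"
  have u': "nat_trans D (Z\<lparr>cells := S\<rparr>) F (\<lambda>p z. u p (g p z))"
    using natD[OF u] natD[OF g] gS subpresheafD(1)[OF Z]
    subpresheafD(2)[OF Z] by (intro natI) auto
  have uv': "\<forall>p. \<forall>z\<in>S p. \<rho> p (u p (g p z)) = v p (g p z)" using uv gS by blast
  obtain w where w: "nat_trans D Z F w" "\<And>p z. z \<in> S p \<Longrightarrow> w p z = u p (g p z)"
    "\<And>p z. z \<in> cells Z p \<Longrightarrow> \<rho> p (w p z) = v p (g p z)"
    by (rule liftsE[OF L u' nat_trans_comp[OF g v] uv']) (rule that)
  show "\<exists>w. nat_trans D Z' F w \<and> (\<forall>p. \<forall>z\<in>S' p. w p z = u p z) \<and>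
           (\<forall>p. \<forall>z\<in>cells Z' p. \<rho> p (w p z) = v p z)"
    using nat_trans_comp[OF f w(1)]
    by (intro exI[of _ "\<lambda>p z. w p (f p z)"]) (simp add: w fS gf natD(1)[OF f])
qed

lemma lifts_comp:
  assumes "lifts D F X \<rho> Z S" "lifts D X Y \<sigma> Z S" "nat_trans D F X \<rho>"
  shows "lifts D F Y (\<lambda>p x. \<sigma> p (\<rho> p x)) Z S"
proof (rule liftsI)
  fix u v assume u: "nat_trans D (Z\<lparr>cells := S\<rparr>) F u" and v: "nat_trans D Z Y v"
    and uv: "\<And>p z. z \<in> S p \<Longrightarrow> \<sigma> p (\<rho> p (u p z)) = v p z"
  have uv': "\<forall>p. \<forall>z\<in>S p. \<sigma> p (\<rho> p (u p z)) = v p z" using uv by blast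
  obtain w where w: "nat_trans D Z X w" "\<And>p z. z \<in> S p \<Longrightarrow> w p z = \<rho> p (u p z)"
    "\<And>p z. z \<in> cells Z p \<Longrightarrow> \<sigma> p (w p z) = v p z"
    by (rule liftsE[OF assms(2) nat_trans_comp[OF u assms(3)] v uv']) (rule that)
  obtain w' where w': "nat_trans D Z F w'" "\<And>p z. z \<in> S p \<Longrightarrow> w' p z = u p z"
    "\<And>p z. z \<in> cells Z p \<Longrightarrow> \<rho> p (w' p z) = w p z"
    by (rule liftsE[OF assms(1) u w(1)]) (simp add: w(2), rule that)
  show "\<exists>w. nat_trans D Z F w \<and> (\<forall>p. \<forall>z\<in>S p. w p z = u p z) \<and>
           (\<forall>p. \<forall>z\<in>cells Z p. \<sigma> p (\<rho> p (w p z)) = v p z)"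
    using w w' by (intro exI[of _ w']) auto
qed

text \<open>Cells of the domain of the pushout-product of \<open>S \<subseteq> Z\<close> with \<open>T \<subseteq> N\<close>.\<close>

definition pp :: "('o, 'm, 'a) psh \<Rightarrow> ('o \<Rightarrow> 'a set) \<Rightarrow> ('o, 'm, 'b) psh \<Rightarrow> ('o \<Rightarrow> 'b set) \<Rightarrow>
    'o \<Rightarrow> ('a \<times> 'b) set" where
  "pp Z S N T p = {(z, n). z \<in> cells Z p \<and> n \<in> cells N p \<and> (z \<in> S p \<or> n \<in> T p)}"

lemma mem_pp [simp]:
  "(z, n) \<in> pp Z S N T p \<longleftrightarrow> z \<in> cells Z p \<and> n \<in> cells N p \<and> (z \<in> S p \<or> n \<in> T p)"
  by (simp add: pp_def)

lemma subpresheaf_pp: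
  assumes "presheaf D Z" "presheaf D N" "subpresheaf D Z S" "subpresheaf D N T"
  shows "subpresheaf D (psh_prod Z N) (pp Z S N T)"
  unfolding subpresheaf_def
  using pshD(1)[OF assms(1)] pshD(1)[OF assms(2)]
    subpresheafD(2)[OF assms(3)] subpresheafD(2)[OF assms(4)]
  by (auto simp: pp_def)

section \<open>Cell-by-cell extension of lifts\<close>

text \<open>
  An Eilenberg--Zilber style category: \<open>bd p q\<close> consists of the arrows \<open>p \<rightarrow> q\<close> that are not split
  epimorphisms, so that \<open>\<lambda>p. bd p q\<close> is the boundary of \<open>yoneda D q\<close>.  The axiom \<open>separate\<close> makes
  a cell whose boundary lies in \<open>S\<close> generate new cells freely up to \<open>S\<close>.
\<close>

locale ez_category =
  fixes D :: "('o, 'm) small_cat" and deg :: "'o \<Rightarrow> nat" and bd :: "'o \<Rightarrow> 'o \<Rightarrow> 'm set"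
  assumes small_category: "small_category D"
    and bd_factor: "v \<in> bd p q \<Longrightarrow>
      \<exists>r. \<exists>m\<in>arr D r q. \<exists>e\<in>arr D p r. deg r < deg q \<and> v = cmp D m e"
    and split: "v \<in> arr D p q \<Longrightarrow> v \<notin> bd p q \<Longrightarrow> \<exists>s\<in>arr D q p. cmp D v s = idn D q"
    and separate: "v \<in> arr D p q \<Longrightarrow> v \<notin> bd p q \<Longrightarrow> v' \<in> arr D p q \<Longrightarrow> v' \<notin> bd p q \<Longrightarrow> v \<noteq> v' \<Longrightarrow>
      \<exists>s\<in>arr D q p. cmp D v s = idn D q \<and> cmp D v' s \<in> bd q q"
begin

text \<open>Adjoining \<open>x\<close> is a pushout of the boundary inclusion of
  \<open>yoneda D d\<close>: the characteristic map of \<open>x\<close> meets \<open>S\<close>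
  exactly in the boundary (\<open>inS\<close>) and is injective outside it (\<open>inj\<close>). A
  lift on the representable can therefore be glued to \<open>w\<close>.\<close>

lemma attach_cell:
  assumes Z: "presheaf D Z" and N: "presheaf D N" and F: "presheaf D F"
    and S: "subpresheaf D Z S" and T: "subpresheaf D N T"
    and L: "lifts D F X \<rho> (psh_prod (yoneda D d) N) (pp (yoneda D d) (\<lambda>p. bd p d) N T)"
    and x: "x \<in> cells Z d" "x \<notin> S d"
    and bdx: "\<And>p a. a \<in> bd p d \<Longrightarrow> act Z p d a x \<in> S p"
    and w: "nat_trans D ((psh_prod Z N)\<lparr>cells := pp Z S N T\<rparr>) F w"
    and v: "nat_trans D (psh_prod Z N) X v"
    and wv: "\<And>p z. z \<in> pp Z S N T p \<Longrightarrow> \<rho> p (w p z) = v p z"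
  defines "S' \<equiv> \<lambda>p. S p \<union> {act Z p d a x | a. a \<in> arr D p d}"
  shows "subpresheaf D Z S' \<and> x \<in> S' d \<and>
    (\<exists>w'. nat_trans D ((psh_prod Z N)\<lparr>cells := pp Z S' N T\<rparr>) F w' \<and>
      (\<forall>p. \<forall>z\<in>pp Z S N T p. w' p z = w p z) \<and> (\<forall>p. \<forall>z\<in>pp Z S' N T p. \<rho> p (w' p z) = v p z))"
proof -
  note cat = catD[OF small_category]
  note Z1 = pshD[OF Z] note N1 = pshD[OF N]
  have S': "subpresheaf D Z S'"
    unfolding subpresheaf_def S'_def
    using subpresheafD[OF S] by (auto simp: Z1(1)[OF _ x(1)] simp flip: Z1(3)[OF _ _ x(1)])
       (blast intro: cat)
  have xS': "x \<in> S' d"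
    unfolding S'_def using Z1(2)[OF x(1)] cat(1)[of d] by (metis (mono_tags, lifting) UnI2 mem_Collect_eq)
  \<comment> \<open>If \<open>a\<close> is not in the boundary, restricting along a section of
    \<open>a\<close> recovers \<open>x\<close>, which is not in \<open>S\<close>.\<close>
  have inS: "act Z p d a x \<in> S p \<longleftrightarrow> a \<in> bd p d" if a: "a \<in> arr D p d" for p a
  proof
    assume 1: "act Z p d a x \<in> S p"
    show "a \<in> bd p d"
    proof (rule ccontr)
      assume "a \<notin> bd p d"
      then obtain s where s: "s \<in> arr D d p" "cmp D a s = idn D d" using split a by blast
      then have "act Z d p s (act Z p d a x) = x"
        using Z1(3)[OF s(1) a x(1)] Z1(2)[OF x(1)] by simp
      then show False using subpresheafD(2)[OF S s(1) 1] x(2) by simp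
    qed
  qed (rule bdx)
  \<comment> \<open>The section given by \<open>separate\<close> would exhibit \<open>x\<close>
    itself as one of its boundary cells.\<close>
  have inj: "a = a'" if a: "a \<in> arr D p d" "a' \<in> arr D p d" "a \<notin> bd p d" "act Z p d a x = act Z p d a' x"
    for p a a'
  proof (rule ccontr)
    assume "a \<noteq> a'"
    moreover have "a' \<notin> bd p d" using inS a by metis
    ultimately obtain s where s: "s \<in> arr D d p" "cmp D a s = idn D d" "cmp D a' s \<in> bd d d"
      using separate a by blast
    have "x = act Z d p s (act Z p d a x)"
      using Z1(3)[OF s(1) a(1) x(1)] Z1(2)[OF x(1)] s(2) by simp
    also have "\<dots> = act Z d d (cmp D a' s) x"
      using Z1(3)[OF s(1) a(2) x(1)] a(4) by simp
    finally show False using bdx[OF s(3)] x(2) by simp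
  qed
  define u0 where "u0 = (\<lambda>p (a, n). w p (act Z p d a x, n))"
  define v0 where "v0 = (\<lambda>p (a, n). v p (act Z p d a x, n))"
  have u0: "nat_trans D ((psh_prod (yoneda D d) N)\<lparr>cells := pp (yoneda D d) (\<lambda>p. bd p d) N T\<rparr>) F u0"
    unfolding u0_def using natD[OF w] N1(1) subpresheafD(2)[OF T]
    by (intro natI) (auto simp: Z1(1)[OF _ x(1)] inS Z1(3)[OF _ _ x(1)])
  have v0: "nat_trans D (psh_prod (yoneda D d) N) X v0"
    unfolding v0_def using natD[OF v]
    by (intro natI) (auto simp: Z1(1)[OF _ x(1)] Z1(3)[OF _ _ x(1)])
  have uv0: "\<forall>p. \<forall>z\<in>pp (yoneda D d) (\<lambda>p. bd p d) N T p. \<rho> p (u0 p z) = v0 p z"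
    by (auto simp: u0_def v0_def Z1(1)[OF _ x(1)] inS intro!: wv)
  obtain W where W: "nat_trans D (psh_prod (yoneda D d) N) F W"
    "\<And>p z. z \<in> pp (yoneda D d) (\<lambda>p. bd p d) N T p \<Longrightarrow> W p z = u0 p z"
    "\<And>p z. z \<in> cells (psh_prod (yoneda D d) N) p \<Longrightarrow> \<rho> p (W p z) = v0 p z"
    by (rule liftsE[OF L u0 v0 uv0]) (rule that)
  \<comment> \<open>By \<open>inj\<close>, the description \<open>THE a\<close> is unambiguous
    wherever the second branch is reached.\<close>
  define w' where "w' = (\<lambda>p (z, n). if z \<in> S p \<or> n \<in> T p then w p (z, n)
     else W p (THE a. a \<in> arr D p d \<and> act Z p d a x = z, n))"
  have w'W: "w' p (act Z p d a x, n) = W p (a, n)" if "a \<in> arr D p d" "n \<in> cells N p" for p a n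
  proof (cases "a \<in> bd p d \<or> n \<in> T p")
    case True
    then show ?thesis using that W(2)[of "(a, n)" p] by (auto simp: w'_def inS u0_def)
  next
    case False
    have "(THE a'. a' \<in> arr D p d \<and> act Z p d a' x = act Z p d a x) = a"
      using that False inj[of a p] by (intro the_equality) (simp, metis)
    then show ?thesis using False that by (simp add: w'_def inS)
  qed
  have w'w: "w' p (z, n) = w p (z, n)" if "z \<in> S p \<or> n \<in> T p" for p z n
    using that by (simp add: w'_def)
  have pp': "z \<in> S p \<or> n \<in> T p \<or> (\<exists>a\<in>arr D p d. z = act Z p d a x)"
    if "(z, n) \<in> pp Z S' N T p" for p z n
    using that by (auto simp: S'_def)
  have "nat_trans D ((psh_prod Z N)\<lparr>cells := pp Z S' N T\<rparr>) F w'"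
  proof (rule natI)
    fix p zn assume "zn \<in> cells ((psh_prod Z N)\<lparr>cells := pp Z S' N T\<rparr>) p"
    then obtain z n where zn: "zn = (z, n)" "(z, n) \<in> pp Z S' N T p" by (cases zn) auto
    consider "z \<in> S p \<or> n \<in> T p" | a where "a \<in> arr D p d" "z = act Z p d a x" using pp'[OF zn(2)] by blast
    then show "w' p zn \<in> cells F p"
    proof cases
      case 1 then show ?thesis using zn natD(1)[OF w, of "(z, n)" p] by (simp add: w'w)
    next
      case 2 then show ?thesis using zn natD(1)[OF W(1), of "(a, n)" p] by (simp add: w'W)
    qed
  next
    fix p q u zn assume u: "u \<in> arr D p q" and "zn \<in> cells ((psh_prod Z N)\<lparr>cells := pp Z S' N T\<rparr>) q"
    then obtain z n where zn: "zn = (z, n)" "(z, n) \<in> pp Z S' N T q" by (cases zn) auto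
    consider "z \<in> S q \<or> n \<in> T q" | a where "a \<in> arr D q d" "z = act Z q d a x" using pp'[OF zn(2)] by blast
    then show "w' p (act ((psh_prod Z N)\<lparr>cells := pp Z S' N T\<rparr>) p q u zn) = act F p q u (w' q zn)"
    proof cases
      case 1
      then have "act Z p q u z \<in> S p \<or> act N p q u n \<in> T p"
        using u subpresheafD(2)[OF S] subpresheafD(2)[OF T] by blast
      then show ?thesis using 1 zn u natD(2)[OF w u, of "(z, n)"] by (simp add: w'w)
    next
      case 2
      then show ?thesis using zn u natD(2)[OF W(1) u, of "(a, n)"]
        Z1(3)[OF u _ x(1), of a] N1(1)[OF u] by (simp add: w'W cat(2)[OF u] flip: Z1(3)[OF u _ x(1), of a])
    qed
  qed
  moreover have "\<forall>p. \<forall>z\<in>pp Z S N T p. w' p z = w p z" by (auto simp: w'w)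
  moreover have "\<rho> p (w' p zn) = v p zn" if "zn \<in> pp Z S' N T p" for p zn
  proof -
    obtain z n where zn: "zn = (z, n)" "(z, n) \<in> pp Z S' N T p" using \<open>zn \<in> _\<close> by (cases zn) auto
    consider "z \<in> S p \<or> n \<in> T p" | a where "a \<in> arr D p d" "z = act Z p d a x" using pp'[OF zn(2)] by blast
    then show "\<rho> p (w' p zn) = v p zn"
    proof cases
      case 1 then show ?thesis using zn wv[of "(z, n)" p] by (simp add: w'w)
    next
      case 2 then show ?thesis using zn W(3)[of "(a, n)" p] by (simp add: w'W v0_def)
    qed
  qed
  ultimately show ?thesis using S' xS' by blast
qed

text \<open>Zorn's lemma for partial lifts. A missing cell of least degree can be attached, so no
  normal form by nondegenerate cells is needed. The first alternative in \<open>L\<close> lets an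
  application discard cells that come from lower degree and demand lifts only for the remaining
  \<open>d\<close>.\<close>

lemma lifts_cellwise:
  assumes Z: "presheaf D Z" and N: "presheaf D N" and F: "presheaf D F"
    and S: "subpresheaf D Z S" and T: "subpresheaf D N T"
    and L: "\<And>d x. x \<in> cells Z d \<Longrightarrow> x \<notin> S d \<Longrightarrow>
      (\<exists>r. \<exists>y\<in>cells Z r. \<exists>u\<in>arr D d r. deg r < deg d \<and> x = act Z d r u y) \<or>
      lifts D F X \<rho> (psh_prod (yoneda D d) N) (pp (yoneda D d) (\<lambda>p. bd p d) N T)"
  shows "lifts D F X \<rho> (psh_prod Z N) (pp Z S N T)"
proof (rule liftsI)
  fix u v
  assume u: "nat_trans D ((psh_prod Z N)\<lparr>cells := pp Z S N T\<rparr>) F u"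
    and v: "nat_trans D (psh_prod Z N) X v"
    and uv: "\<And>p z. z \<in> pp Z S N T p \<Longrightarrow> \<rho> p (u p z) = v p z"
  define A where "A = {(R, w). subpresheaf D Z R \<and> (\<forall>p. S p \<subseteq> R p) \<and>
     nat_trans D ((psh_prod Z N)\<lparr>cells := pp Z R N T\<rparr>) F w \<and>
     (\<forall>p. \<forall>z\<in>pp Z S N T p. w p z = u p z) \<and> (\<forall>p. \<forall>z\<in>pp Z R N T p. \<rho> p (w p z) = v p z)}"
  define le :: "(('o \<Rightarrow> 'a set) \<times> ('o \<Rightarrow> 'a \<times> 'b \<Rightarrow> 'c)) \<Rightarrow> (('o \<Rightarrow> 'a set) \<times> ('o \<Rightarrow> 'a \<times> 'b \<Rightarrow> 'c)) \<Rightarrow> bool"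
    where "le = (\<lambda>(R, w) (R', w'). (\<forall>p. R p \<subseteq> R' p) \<and> (\<forall>p. \<forall>z\<in>pp Z R N T p. w' p z = w p z))"
  have le_trans: "le x z" if "le x y" "le y z" for x y z
    using that unfolding le_def by (auto simp: subset_iff)
  have le_refl: "le x x" for x unfolding le_def by auto
  define le' where "le' = (\<lambda>x y. le x y \<and> x \<noteq> y)"
  have SA: "(S, u) \<in> A" using S u uv by (auto simp: A_def)
  obtain C where C: "pred_on.maxchain A le' C"
    using pred_on.Hausdorff[of A le'] by blast
  have CA: "C \<subseteq> A" and Cle: "\<And>x y. x \<in> C \<Longrightarrow> y \<in> C \<Longrightarrow> le x y \<or> le y x"
    using pred_on.maxchain_imp_chain[OF C] le_refl unfolding pred_on.chain_def le'_def by blast+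
  \<comment> \<open>An upper bound of a maximal chain already belongs to it.\<close>
  have Cmax: "x \<in> C" if x: "x \<in> A" "\<And>y. y \<in> C \<Longrightarrow> le y x" for x
  proof (rule ccontr)
    assume "x \<notin> C"
    then have "pred_on.chain A le' (insert x C)"
      using pred_on.maxchain_imp_chain[OF C] x unfolding pred_on.chain_def le'_def by blast
    then show False using C \<open>x \<notin> C\<close> unfolding pred_on.maxchain_def by blast
  qed
  define R where "R = (\<lambda>p. S p \<union> (\<Union>(R, w)\<in>C. R p))"
  \<comment> \<open>Members of the chain agree wherever both are defined, so the choice made by
    \<open>SOME\<close> is forced (\<open>w_eq\<close>).\<close>
  define w where "w = (\<lambda>p (z, n). if \<exists>R w. (R, w) \<in> C \<and> (z \<in> R p \<or> n \<in> T p)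
      then (SOME e. \<exists>R w. (R, w) \<in> C \<and> (z \<in> R p \<or> n \<in> T p) \<and> e = w p (z, n)) else u p (z, n))"
  have C_nonempty: "C \<noteq> {}" using Cmax[OF SA] by blast
  have AD: "subpresheaf D Z R0" "S p \<subseteq> R0 p"
      "nat_trans D ((psh_prod Z N)\<lparr>cells := pp Z R0 N T\<rparr>) F w0"
      "zn \<in> pp Z S N T p \<Longrightarrow> w0 p zn = u p zn" "zn \<in> pp Z R0 N T p \<Longrightarrow> \<rho> p (w0 p zn) = v p zn"
    if "(R0, w0) \<in> C" for R0 w0 p zn
  proof -
    have "(R0, w0) \<in> A" using that CA by blast
    then show "subpresheaf D Z R0" "S p \<subseteq> R0 p"
      "nat_trans D ((psh_prod Z N)\<lparr>cells := pp Z R0 N T\<rparr>) F w0"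
      "zn \<in> pp Z S N T p \<Longrightarrow> w0 p zn = u p zn" "zn \<in> pp Z R0 N T p \<Longrightarrow> \<rho> p (w0 p zn) = v p zn"
      by (auto simp: A_def)
  qed
  have w_eq: "w p (z, n) = w0 p (z, n)" if 0: "(R0, w0) \<in> C" "(z, n) \<in> pp Z R0 N T p" for R0 w0 p z n
  proof -
    have "w1 p (z, n) = w0 p (z, n)" if "(R1, w1) \<in> C" "z \<in> R1 p \<or> n \<in> T p" for R1 w1
      using Cle[OF that(1) 0(1)] that(2) 0(2) by (auto simp: le_def)
    moreover have "z \<in> R0 p \<or> n \<in> T p" using 0(2) by simp
    ultimately have "(SOME e. \<exists>R w. (R, w) \<in> C \<and> (z \<in> R p \<or> n \<in> T p) \<and> e = w p (z, n)) = w0 p (z, n)"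
      using 0(1) by (intro some_equality) blast+
    then show ?thesis using 0 by (auto simp: w_def)
  qed
  have ppR: "\<exists>R0 w0. (R0, w0) \<in> C \<and> zn \<in> pp Z R0 N T p" if "zn \<in> pp Z R N T p" for p zn
  proof -
    obtain z n where zn: "zn = (z, n)" by (cases zn)
    show ?thesis
    proof (cases "\<exists>R0 w0. (R0, w0) \<in> C \<and> z \<in> R0 p")
      case True
      then show ?thesis using that zn by auto
    next
      case False
      obtain R0 w0 where 0: "(R0, w0) \<in> C" using C_nonempty by auto
      then have "zn \<in> pp Z R0 N T p" using that False AD(2)[OF 0, of p] zn by (auto simp: R_def)
      then show ?thesis using 0 by blast
    qed
  qed
  have R_mono: "R0 p \<subseteq> R p" if "(R0, w0) \<in> C" for R0 w0 p using that by (auto simp: R_def)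
  have w_eq': "w p zn = w0 p zn" if "(R0, w0) \<in> C" "zn \<in> pp Z R0 N T p" for R0 w0 p zn
    using w_eq that by (cases zn) simp
  have R_sub: "subpresheaf D Z R"
    unfolding subpresheaf_def
  proof (intro conjI allI ballI subsetI)
    fix p z assume "z \<in> R p"
    then show "z \<in> cells Z p"
      using subpresheafD(1)[OF S] subpresheafD(1)[OF AD(1)] by (auto simp: R_def)
  next
    fix p q a z assume a: "a \<in> arr D p q" and "z \<in> R q"
    then consider "z \<in> S q" | R0 w0 where "(R0, w0) \<in> C" "z \<in> R0 q" by (auto simp: R_def)
    then show "act Z p q a z \<in> R p"
    proof cases
      case 1
      then show ?thesis using subpresheafD(2)[OF S a] by (simp add: R_def)
    next
      case 2
      then show ?thesis using subpresheafD(2)[OF AD(1)[OF 2(1)] a] by (auto simp: R_def)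
    qed
  qed
  have w_nat: "nat_trans D ((psh_prod Z N)\<lparr>cells := pp Z R N T\<rparr>) F w"
  proof (rule natI)
    fix p zn assume "zn \<in> cells ((psh_prod Z N)\<lparr>cells := pp Z R N T\<rparr>) p"
    then have "zn \<in> pp Z R N T p" by simp
    then obtain R0 w0 where 0: "(R0, w0) \<in> C" "zn \<in> pp Z R0 N T p" using ppR by blast
    show "w p zn \<in> cells F p" using natD(1)[OF AD(3)[OF 0(1)], of zn p] w_eq'[OF 0] 0(2) by simp
  next
    fix p q a zn assume a: "a \<in> arr D p q" and "zn \<in> cells ((psh_prod Z N)\<lparr>cells := pp Z R N T\<rparr>) q"
    then have "zn \<in> pp Z R N T q" by simp
    then obtain R0 w0 where 0: "(R0, w0) \<in> C" "zn \<in> pp Z R0 N T q" using ppR by blast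
    have "act (psh_prod Z N) p q a zn \<in> pp Z R0 N T p"
      using subpresheafD(2)[OF subpresheaf_pp[OF Z N AD(1)[OF 0(1)] T] a 0(2)] .
    then show "w p (act ((psh_prod Z N)\<lparr>cells := pp Z R N T\<rparr>) p q a zn) = act F p q a (w q zn)"
      using natD(2)[OF AD(3)[OF 0(1)] a, of zn] w_eq'[OF 0(1)] 0(2) by simp
  qed
  have w_u: "w p zn = u p zn" if zn: "zn \<in> pp Z S N T p" for p zn
  proof -
    obtain R0 w0 where 0: "(R0, w0) \<in> C" using C_nonempty by auto
    have "zn \<in> pp Z R0 N T p" using zn AD(2)[OF 0, of p] by (cases zn) auto
    then show ?thesis using w_eq'[OF 0] AD(4)[OF 0 zn] by simp
  qed
  have w_v: "\<rho> p (w p zn) = v p zn" if zn: "zn \<in> pp Z R N T p" for p zn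
  proof -
    obtain R0 w0 where 0: "(R0, w0) \<in> C" "zn \<in> pp Z R0 N T p" using ppR[OF zn] by blast
    then show ?thesis using w_eq'[OF 0] AD(5)[OF 0] by simp
  qed
  have S_R: "S p \<subseteq> R p" for p by (auto simp: R_def)
  have C_le: "le y (R, w)" if "y \<in> C" for y
    using that R_mono w_eq' by (cases y) (auto simp: le_def)
  have R_all: "x \<in> R p" if "x \<in> cells Z p" for p x
  proof (rule ccontr)
    assume "x \<notin> R p"
    \<comment> \<open>For a missing cell of least degree, all boundary cells lie in
      \<open>R\<close>, because boundary arrows factor through lower degree. For the same reason the
      first alternative of \<open>L\<close> is excluded.\<close>
    then have "\<exists>x. \<exists>d. deg d = deg p \<and> x \<in> cells Z d \<and> x \<notin> R d" using that by blast
    then obtain k where k: "\<exists>x d. deg d = k \<and> x \<in> cells Z d \<and> x \<notin> R d"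
      and k_min: "\<And>j. j < k \<Longrightarrow> \<not> (\<exists>x d. deg d = j \<and> x \<in> cells Z d \<and> x \<notin> R d)"
      using exists_least_iff[of "\<lambda>k. \<exists>x d. deg d = k \<and> x \<in> cells Z d \<and> x \<notin> R d"] by blast
    then obtain x d where x: "deg d = k" "x \<in> cells Z d" "x \<notin> R d" by blast
    have min: "y \<in> R r" if "y \<in> cells Z r" "deg r < deg d" for y r using k_min that x(1) by blast
    have nd: "\<not> (\<exists>r. \<exists>y\<in>cells Z r. \<exists>u\<in>arr D d r. deg r < deg d \<and> x = act Z d r u y)"
      using min subpresheafD(2)[OF R_sub] x(3) by blast
    have bdx: "act Z p d a x \<in> R p" if a: "a \<in> bd p d" for p a
    proof -
      obtain r m e where f: "m \<in> arr D r d" "e \<in> arr D p r" "deg r < deg d" "a = cmp D m e"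
        using bd_factor[OF a] by blast
      have "act Z r d m x \<in> R r" using min[OF pshD(1)[OF Z f(1) x(2)] f(3)] .
      then show ?thesis using subpresheafD(2)[OF R_sub f(2)] pshD(3)[OF Z f(2,1) x(2)] f(4) by simp
    qed
    have Lx: "lifts D F X \<rho> (psh_prod (yoneda D d) N) (pp (yoneda D d) (\<lambda>p. bd p d) N T)"
      using L[OF x(2)] nd x(3) S_R by blast
    obtain R' w' where e: "subpresheaf D Z R'" "x \<in> R' d" "\<And>p. R p \<subseteq> R' p"
      "nat_trans D ((psh_prod Z N)\<lparr>cells := pp Z R' N T\<rparr>) F w'"
      "\<And>p zn. zn \<in> pp Z R N T p \<Longrightarrow> w' p zn = w p zn"
      "\<And>p zn. zn \<in> pp Z R' N T p \<Longrightarrow> \<rho> p (w' p zn) = v p zn"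
      using attach_cell[OF Z N F R_sub T Lx x(2,3) bdx w_nat v w_v] by blast
    have "zn \<in> pp Z R N T p" if "zn \<in> pp Z S N T p" for zn p
      using that S_R by (cases zn) auto
    then have "w' p zn = u p zn" if "zn \<in> pp Z S N T p" for zn p
      using that e(5) w_u by simp
    moreover have "S p \<subseteq> R' p" for p using S_R e(3) by blast
    ultimately have "(R', w') \<in> A"
      unfolding A_def using e(1,4,6) by blast
    moreover have "le (R, w) (R', w')" using e(3,5) by (auto simp: le_def)
    \<comment> \<open>The enlarged pair bounds the chain, hence belongs to it, and so
      \<open>R'\<close> lies inside \<open>R\<close> although it contains \<open>x\<close>.\<close>
    ultimately have "(R', w') \<in> C" using Cmax C_le le_trans by blast
    then show False using R_mono e(2) x(3) by blast
  qed
  have "pp Z R N T = cells (psh_prod Z N)" using R_all by (auto simp: fun_eq_iff)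
  moreover have "nat_trans D (psh_prod Z N) F w"
    using w_nat unfolding calculation nat_trans_def by simp
  ultimately show "\<exists>w. nat_trans D (psh_prod Z N) F w \<and> (\<forall>p. \<forall>z\<in>pp Z S N T p. w p z = u p z) \<and>
           (\<forall>p. \<forall>z\<in>cells (psh_prod Z N) p. \<rho> p (w p z) = v p z)"
    using w_u w_v by (intro exI[of _ w]) auto
qed

end

section \<open>The simplex category and its square\<close>

abbreviation "smor \<equiv> arr simplex_cat"
abbreviation "scmp \<equiv> cmp simplex_cat"
abbreviation "sidn \<equiv> idn simplex_cat"
abbreviation "bimor \<equiv> arr bisimplex_cat"
abbreviation "subsset \<equiv> subpresheaf simplex_cat"
abbreviation "subbisset \<equiv> subpresheaf bisimplex_cat"
abbreviation "slifts \<equiv> lifts simplex_cat"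
abbreviation "bilifts \<equiv> lifts bisimplex_cat"

section \<open>Monotone maps encoded as lists\<close>

lemma smor_iff:
  "xs \<in> smor m n \<longleftrightarrow> length xs = Suc m \<and> sorted xs \<and> set xs \<subseteq> {..n}"
  by (simp add: simplex_cat_def)

lemma scmp_eq: "scmp \<beta> \<alpha> = map ((!) \<beta>) \<alpha>"
  by (simp add: simplex_cat_def)

lemma sidn_eq: "sidn n = [0..<Suc n]"
  by (simp add: simplex_cat_def)

lemma smor_nth:
  assumes "a \<in> smor m n"
  shows "i \<le> m \<Longrightarrow> a ! i \<le> n" and "i \<le> j \<Longrightarrow> j \<le> m \<Longrightarrow> a ! i \<le> a ! j"
proof -
  have a: "length a = Suc m" "sorted a" "set a \<subseteq> {..n}" using assms by (auto simp: smor_iff)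
  show "a ! i \<le> n" if "i \<le> m" using a that by (metis atMost_iff le_imp_less_Suc nth_mem subsetD)
  show "a ! i \<le> a ! j" if "i \<le> j" "j \<le> m" using a that by (simp add: sorted_iff_nth_mono)
qed

lemma smorI:
  assumes "length a = Suc m" "\<And>i. i \<le> m \<Longrightarrow> a ! i \<le> n"
    "\<And>i j. i \<le> j \<Longrightarrow> j \<le> m \<Longrightarrow> a ! i \<le> a ! j"
  shows "a \<in> smor m n"
  using assms unfolding smor_iff sorted_iff_nth_mono
  by (auto simp: in_set_conv_nth less_Suc_eq_le)

lemma scmp_smor:
  assumes "u \<in> smor p q" "v \<in> smor q r"
  shows "scmp v u \<in> smor p r"
  using smor_nth[OF assms(1)] smor_nth[OF assms(2)] assms(1)
  by (intro smorI) (auto simp: scmp_eq smor_iff)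

lemma simplex_category: "small_category simplex_cat"
  unfolding small_category_def
proof (intro conjI allI ballI)
  fix p q u assume u: "u \<in> smor p q"
  show "scmp u (sidn p) = u"
    using u map_nth[of u] by (simp add: smor_iff scmp_eq sidn_eq del: upt_Suc)
  show "scmp (sidn q) u = u"
    using smor_nth(1)[OF u] u
    by (intro nth_equalityI) (auto simp: scmp_eq sidn_eq smor_iff less_Suc_eq_le simp del: upt_Suc)
next
  fix p q r t u v w
  assume u: "u \<in> smor p q" and "v \<in> smor q r" "w \<in> smor r t"
  then show "scmp w (scmp v u) = scmp (scmp w v) u"
    using smor_nth(1)[OF u]
    by (intro nth_equalityI) (auto simp: scmp_eq smor_iff less_Suc_eq_le)
qed (auto simp: scmp_smor, auto intro!: smorI simp: sidn_eq simp del: upt_Suc)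

section \<open>Boundary arrows and split epimorphisms of the simplex category\<close>

definition nonsurj :: "nat \<Rightarrow> nat \<Rightarrow> nat list set" where
  "nonsurj m n = {v \<in> smor m n. set v \<noteq> {..n}}"

lemma nonsurj_cmp:
  assumes "u \<in> smor p q" "v \<in> nonsurj q r"
  shows "scmp v u \<in> nonsurj p r"
proof -
  have v: "v \<in> smor q r" "set v \<noteq> {..r}" using assms by (auto simp: nonsurj_def)
  have "set (scmp v u) \<subseteq> set v"
    using assms(1) v by (auto simp: scmp_eq smor_iff)
  then have "set (scmp v u) \<noteq> {..r}" using v by (auto simp: smor_iff)
  then show ?thesis using scmp_smor[OF assms(1) v(1)] by (simp add: nonsurj_def)
qed

lemma nonsurj_factor:
  assumes "v \<in> nonsurj p q"
  shows "\<exists>r. \<exists>m\<in>smor r q. \<exists>e\<in>smor p r. r < q \<and> v = scmp m e"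
proof -
  have v: "v \<in> smor p q" "set v \<noteq> {..q}" using assms by (auto simp: nonsurj_def)
  then obtain i where i: "i \<le> q" "i \<notin> set v" by (auto simp: smor_iff)
  have "v ! 0 \<in> set v" using v by (auto simp: smor_iff)
  then have q: "0 < q" using i v smor_nth(1)[OF v(1), of 0] by (cases q) auto
  \<comment> \<open>\<open>m\<close> is the coface that skips the missed value \<open>i\<close>, and
    \<open>e\<close> is \<open>v\<close> with the gap at \<open>i\<close> closed.\<close>
  define m where "m = map (\<lambda>j. if j < i then j else Suc j) [0..<q]"
  define e where "e = map (\<lambda>j. if j < i then j else j - 1) v"
  have nth_ne: "v ! j \<noteq> i" if "j \<le> p" for j using i(2) v(1) that by (auto simp: smor_iff in_set_conv_nth)
  have m: "m \<in> smor (q - 1) q"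
    using q by (intro smorI) (auto simp: m_def)
  have e: "e \<in> smor p (q - 1)"
  proof (rule smorI)
    have e_nth: "e ! j = (if v ! j < i then v ! j else v ! j - 1)" if "j \<le> p" for j
      using that v(1) by (simp add: e_def smor_iff)
    show "length e = Suc p" using v(1) by (simp add: e_def smor_iff)
    show "e ! j \<le> q - 1" if "j \<le> p" for j
      using that smor_nth(1)[OF v(1) that] i(1) e_nth by auto
    show "e ! j \<le> e ! k" if "j \<le> k" "k \<le> p" for j k
      using that smor_nth(2)[OF v(1) that] e_nth nth_ne[of j] nth_ne[of k] by auto
  qed
  have "v = scmp m e"
  proof (rule nth_equalityI)
    show "length v = length (scmp m e)" by (simp add: scmp_eq e_def)
    fix j assume "j < length v"
    then have j: "j \<le> p" "j < length v" using v(1) by (auto simp: smor_iff)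
    show "v ! j = scmp m e ! j"
      using j nth_ne[OF j(1)] smor_nth(1)[OF v(1) j(1)] i(1) q
      by (auto simp: scmp_eq e_def m_def)
  qed
  then show ?thesis using m e q by (intro exI[of _ "q - 1"]) auto
qed

text \<open>Any choice of preimages under a monotone surjection is monotone. Prescribing
  \<open>i\<close> as the preimage of its own value is what \<open>surj_separate\<close> relies
  on.\<close>

lemma surj_section:
  assumes v: "v \<in> smor p q" "v \<notin> nonsurj p q" and i: "i \<le> p"
  shows "\<exists>s\<in>smor q p. scmp v s = sidn q \<and> s ! (v ! i) = i"
proof -
  have surj: "\<exists>k\<le>p. v ! k = j" if "j \<le> q" for j
  proof -
    have "j \<in> set v" using v that by (auto simp: nonsurj_def)
    then show ?thesis using v(1) by (auto simp: in_set_conv_nth smor_iff less_Suc_eq_le)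
  qed
  define f where "f = (\<lambda>j. if j = v ! i then i else SOME k. k \<le> p \<and> v ! k = j)"
  have f: "f j \<le> p" "v ! f j = j" if "j \<le> q" for j
    using someI_ex[OF surj[OF that]] i unfolding f_def by auto
  define s where "s = map f [0..<Suc q]"
  have s_nth: "s ! j = f j" if "j \<le> q" for j using that unfolding s_def by (simp del: upt_Suc add: less_Suc_eq_le)
  have len: "length s = Suc q" by (simp add: s_def)
  have "f j \<le> f k" if "j \<le> k" "k \<le> q" for j k
  proof (rule ccontr)
    assume "\<not> f j \<le> f k"
    then have "v ! f k \<le> v ! f j" using smor_nth(2)[OF v(1), of "f k" "f j"] f[of j] that by simp
    then have "j = k" using f that by simp
    then show False using \<open>\<not> f j \<le> f k\<close> by simp
  qed
  then have "s \<in> smor q p" using f s_nth len by (intro smorI) auto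
  moreover have "scmp v s = sidn q"
    using f s_nth len by (intro nth_equalityI) (auto simp: scmp_eq sidn_eq less_Suc_eq_le simp del: upt_Suc)
  moreover have "s ! (v ! i) = i" using s_nth smor_nth(1)[OF v(1) i] by (simp add: f_def)
  ultimately show ?thesis by blast
qed

lemma endo_nonsurj:
  assumes "v \<in> smor q q" "v \<noteq> sidn q"
  shows "v \<in> nonsurj q q"
proof (rule ccontr)
  assume "v \<notin> nonsurj q q"
  then have v: "set v = {..q}" "length v = Suc q" "sorted v" using assms(1) by (auto simp: nonsurj_def smor_iff)
  have "card (set v) = length v" unfolding v(1,2) by simp
  then have "distinct v" by (rule card_distinct)
  moreover have "set v = set [0..<Suc q]"
    unfolding v(1) set_upt by auto
  ultimately have "v = [0..<Suc q]"
    using v(3) by (intro sorted_distinct_set_unique) (assumption | rule sorted_upt distinct_upt)+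
  then show False using assms(2) by (simp add: sidn_eq)
qed

text \<open>Let \<open>v\<close> and \<open>v'\<close> differ at \<open>i\<close>, and take a
  section of \<open>v\<close> through \<open>i\<close>. Then \<open>v'\<close> after this section
  moves the point \<open>v ! i\<close>; an endomorphism other than the identity is not
  surjective.\<close>

lemma surj_separate:
  assumes v: "v \<in> smor p q" "v \<notin> nonsurj p q" and v': "v' \<in> smor p q" and ne: "v \<noteq> v'"
  shows "\<exists>s\<in>smor q p. scmp v s = sidn q \<and> scmp v' s \<in> nonsurj q q"
proof -
  obtain i where i: "i \<le> p" "v ! i \<noteq> v' ! i"
    using ne v(1) v' by (auto simp: list_eq_iff_nth_eq smor_iff less_Suc_eq_le)
  obtain s where s: "s \<in> smor q p" "scmp v s = sidn q" "s ! (v ! i) = i"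
    using surj_section[OF v i(1)] by blast
  have vi: "v ! i \<le> q" using smor_nth(1)[OF v(1) i(1)] .
  have "scmp v' s ! (v ! i) = v' ! i"
    using s vi by (simp add: scmp_eq smor_iff less_Suc_eq_le)
  moreover have "sidn q ! (v ! i) = v ! i"
    using vi by (simp add: sidn_eq less_Suc_eq_le del: upt_Suc)
  ultimately have "scmp v' s \<noteq> sidn q" using i(2) by auto
  then show ?thesis using s endo_nonsurj[OF scmp_smor[OF s(1) v']] by blast
qed

interpretation simplex: ez_category simplex_cat "\<lambda>n. n" nonsurj
proof
  show "small_category simplex_cat" by (rule simplex_category)
  show "\<exists>s\<in>smor q p. scmp v s = sidn q"
    if "v \<in> smor p q" "v \<notin> nonsurj p q" for v p q
    using surj_section[OF that, of 0] by blast
  show "\<exists>r. \<exists>m\<in>smor r q. \<exists>e\<in>smor p r. r < q \<and> v = scmp m e"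
    if "v \<in> nonsurj p q" for v p q
    using nonsurj_factor[OF that] .
qed (rule surj_separate; assumption)

section \<open>The product of two simplex categories\<close>

definition bd2 :: "nat \<times> nat \<Rightarrow> nat \<times> nat \<Rightarrow> (nat list \<times> nat list) set" where
  "bd2 p q = {v \<in> bimor p q. fst v \<in> nonsurj (fst p) (fst q) \<or> snd v \<in> nonsurj (snd p) (snd q)}"

lemma bimor_iff:
  "v \<in> bimor p q \<longleftrightarrow>
     fst v \<in> smor (fst p) (fst q) \<and> snd v \<in> smor (snd p) (snd q)"
  by (simp add: bisimplex_cat_def mem_Times_iff)

lemma cmp_bisimplex_cat:
  "cmp bisimplex_cat v u = (scmp (fst v) (fst u), scmp (snd v) (snd u))"
  by (simp add: bisimplex_cat_def)

lemma idn_bisimplex_cat: "idn bisimplex_cat q = (sidn (fst q), sidn (snd q))"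
  by (simp add: bisimplex_cat_def)

lemmas bisimplex_simps = bimor_iff cmp_bisimplex_cat idn_bisimplex_cat

lemma bisimplex_category: "small_category bisimplex_cat"
  unfolding small_category_def
  using catD[OF simplex_category]
  by (auto simp: bisimplex_simps)

text \<open>Everything is inherited coordinatewise, with an identity or an arbitrary section in the
  idle coordinate. For \<open>separate\<close>, one coordinate in which the arrows differ already
  forces the composite into the boundary.\<close>

interpretation bisimplex: ez_category bisimplex_cat "\<lambda>q. fst q + snd q" bd2
proof
  show "small_category bisimplex_cat" by (rule bisimplex_category)
next
  fix v p q assume v: "v \<in> bd2 p q"
  note cat = catD[OF simplex_category]
  obtain a b where ab: "v = (a, b)" by (cases v)
  then have arr: "a \<in> smor (fst p) (fst q)" "b \<in> smor (snd p) (snd q)"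
    using v by (auto simp: bd2_def bimor_iff)
  consider "a \<in> nonsurj (fst p) (fst q)" | "b \<in> nonsurj (snd p) (snd q)"
    using v ab by (auto simp: bd2_def)
  then show "\<exists>r. \<exists>m\<in>bimor r q. \<exists>e\<in>bimor p r.
      fst r + snd r < fst q + snd q \<and> v = cmp bisimplex_cat m e"
  proof cases
    case 1
    then obtain r m e where "m \<in> smor r (fst q)" "e \<in> smor (fst p) r"
      "r < fst q" "a = scmp m e" using nonsurj_factor by blast
    then show ?thesis using arr cat(1,4) ab
      by (intro exI[of _ "(r, snd q)"] bexI[of _ "(m, sidn (snd q))"] bexI[of _ "(e, b)"])
         (auto simp: bisimplex_simps)
  next
    case 2
    then obtain r m e where "m \<in> smor r (snd q)" "e \<in> smor (snd p) r"
      "r < snd q" "b = scmp m e" using nonsurj_factor by blast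
    then show ?thesis using arr cat(1,4) ab
      by (intro exI[of _ "(fst q, r)"] bexI[of _ "(sidn (fst q), m)"] bexI[of _ "(a, e)"])
         (auto simp: bisimplex_simps)
  qed
next
  fix v p q assume v: "v \<in> bimor p q" "v \<notin> bd2 p q"
  then have "fst v \<in> smor (fst p) (fst q)" "fst v \<notin> nonsurj (fst p) (fst q)"
    "snd v \<in> smor (snd p) (snd q)" "snd v \<notin> nonsurj (snd p) (snd q)"
    by (auto simp: bd2_def bisimplex_simps)
  then obtain s t where "s \<in> smor (fst q) (fst p)" "scmp (fst v) s = sidn (fst q)"
    "t \<in> smor (snd q) (snd p)" "scmp (snd v) t = sidn (snd q)"
    using simplex.split by meson
  then show "\<exists>s\<in>bimor q p. cmp bisimplex_cat v s = idn bisimplex_cat q"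
    by (intro bexI[of _ "(s, t)"]) (auto simp: bisimplex_simps)
next
  fix v v' p q assume v: "v \<in> bimor p q" "v \<notin> bd2 p q" "v' \<in> bimor p q"
    "v' \<notin> bd2 p q" and ne: "v \<noteq> v'"
  then have 1: "fst v \<in> smor (fst p) (fst q)" "fst v \<notin> nonsurj (fst p) (fst q)"
    and 2: "snd v \<in> smor (snd p) (snd q)" "snd v \<notin> nonsurj (snd p) (snd q)"
    and e1: "fst v' \<in> smor (fst p) (fst q)" "fst v' \<notin> nonsurj (fst p) (fst q)"
    and e2: "snd v' \<in> smor (snd p) (snd q)" "snd v' \<notin> nonsurj (snd p) (snd q)"
    by (auto simp: bd2_def bisimplex_simps)
  have "\<exists>s t. s \<in> smor (fst q) (fst p) \<and> scmp (fst v) s = sidn (fst q) \<and>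
    t \<in> smor (snd q) (snd p) \<and> scmp (snd v) t = sidn (snd q) \<and>
    (scmp (fst v') s \<in> nonsurj (fst q) (fst q) \<or> scmp (snd v') t \<in> nonsurj (snd q) (snd q))"
  proof (cases "fst v = fst v'")
    case True
    then have "snd v \<noteq> snd v'" using ne by (auto simp: prod_eq_iff)
    then show ?thesis using simplex.split[OF 1] simplex.separate[OF 2 e2] by blast
  next
    case False
    then show ?thesis using simplex.split[OF 2] simplex.separate[OF 1 e1] by blast
  qed
  then obtain s t where "s \<in> smor (fst q) (fst p)" "scmp (fst v) s = sidn (fst q)"
    "t \<in> smor (snd q) (snd p)" "scmp (snd v) t = sidn (snd q)"
    "scmp (fst v') s \<in> nonsurj (fst q) (fst q) \<or> scmp (snd v') t \<in> nonsurj (snd q) (snd q)"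
    by blast
  then show "\<exists>s\<in>bimor q p. cmp bisimplex_cat v s = idn bisimplex_cat q \<and> cmp bisimplex_cat v' s \<in> bd2 q q"
    using e1 e2 scmp_smor
    by (intro bexI[of _ "(s, t)"]) (auto simp: bisimplex_simps bd2_def)
qed

section \<open>Simplices, boundaries, horns and vertices\<close>

lemma cells_std_simplex [simp]: "cells \<Delta>[n] m = smor m n"
  and act_std_simplex [simp]: "act \<Delta>[n] p q u z = scmp z u"
  by (simp_all add: std_simplex_def)

lemma sset_simplex: "sset \<Delta>[n]"
  unfolding std_simplex_def by (rule presheaf_yoneda[OF simplex_category])

lemma cells_boundary [simp]: "cells \<partial>\<Delta>[n] m = nonsurj m n"
  and act_boundary [simp]: "act \<partial>\<Delta>[n] p q u z = scmp z u"
  by (auto simp: boundary_def nonsurj_def)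

lemma cells_horn: "cells \<Lambda>[n,k] m = {z \<in> smor m n. insert k (set z) \<noteq> {..n}}"
  by (auto simp: horn_def)

lemma simplex_restrict:
  "\<Delta>[n]\<lparr>cells := cells \<Lambda>[n,k]\<rparr> = \<Lambda>[n,k]" "\<Delta>[n]\<lparr>cells := cells \<partial>\<Delta>[n]\<rparr> = \<partial>\<Delta>[n]"
  by (simp_all add: horn_def boundary_def)

lemma sub_boundary: "subsset \<Delta>[n] (\<lambda>m. nonsurj m n)"
  unfolding subpresheaf_def using nonsurj_cmp by (auto simp: nonsurj_def)

lemma sub_horn: "subsset \<Delta>[n] (cells \<Lambda>[n,k])"
  unfolding subpresheaf_def
proof (intro conjI allI ballI)
  fix p q u x assume u: "u \<in> smor p q" and x: "x \<in> cells \<Lambda>[n,k] q"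
  have "set (scmp x u) \<subseteq> set x"
    using u x by (auto simp: scmp_eq smor_iff cells_horn)
  then have "insert k (set (scmp x u)) \<subseteq> insert k (set x)" by blast
  moreover have "insert k (set x) \<noteq> {..n}" "set x \<subseteq> {..n}" using x by (auto simp: cells_horn smor_iff)
  ultimately show "act \<Delta>[n] p q u x \<in> cells \<Lambda>[n,k] p"
    using scmp_smor[OF u, of x n] x by (auto simp: cells_horn)
qed (auto simp: cells_horn)

lemma kan_fibration_iff:
  "kan_fibration X Y p \<longleftrightarrow> sset X \<and> sset Y \<and> smap X Y p \<and>
     (\<forall>n k. 1 \<le> n \<and> k \<le> n \<longrightarrow> slifts X Y p \<Delta>[n] (cells \<Lambda>[n,k]))"
  unfolding kan_fibration_def lifts_def simplex_restrict by blast

lemma vertex_smor: "i \<le> n \<Longrightarrow> vertex i m \<in> smor m n"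
  by (auto simp: vertex_def smor_iff)

lemma scmp_vertex: "u \<in> smor p q \<Longrightarrow> scmp (vertex i q) u = vertex i p"
  using smor_nth(1)[of u p q]
  by (intro nth_equalityI) (auto simp: scmp_eq vertex_def smor_iff less_Suc_eq_le simp del: replicate_Suc)

lemma vertex_inj: "vertex i m = vertex j m \<longleftrightarrow> i = j"
  by (auto simp: vertex_def)

lemma sub_vertex: "i \<le> n \<Longrightarrow> subsset \<Delta>[n] (\<lambda>m. {vertex i m})"
  unfolding subpresheaf_def by (auto simp: vertex_smor scmp_vertex)

text \<open>Restriction of a simplicial set along a functor into the simplex category. With the
  identity and with the second projection, it lets one prism argument serve simplicial sets and the
  value direction of bisimplicial sets.\<close>

definition pull ::
  "('o \<Rightarrow> nat) \<Rightarrow> ('m \<Rightarrow> nat list) \<Rightarrow> 'k sset \<Rightarrow> ('o, 'm, 'k) psh" where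
  "pull ob mo M = \<lparr>cells = (\<lambda>q. cells M (ob q)), act = (\<lambda>p q u. act M (ob p) (ob q) (mo u))\<rparr>"

lemma cells_pull [simp]: "cells (pull ob mo M) q = cells M (ob q)"
  and act_pull [simp]: "act (pull ob mo M) p q u x = act M (ob p) (ob q) (mo u) x"
  by (simp_all add: pull_def)

section \<open>The prism\<close>

text \<open>
  Filtration of \<open>\<Delta>[k] \<times> \<Delta>[1]\<close> from \<open>\<partial>\<Delta>[k] \<times> \<Delta>[1] \<union> \<Delta>[k] \<times> {0}\<close> (at \<open>i = k + 1\<close>) to everything
  (at \<open>i = 0\<close>).  Stage \<open>i\<close> arises from stage \<open>i + 1\<close> by filling the horn \<open>\<Lambda>[k+1,i]\<close> of the
  \<open>(k+1)\<close>-simplex \<open>c \<mapsto> (prism_fst i c, prism_snd i c)\<close>; on the new cells its inverse is addition.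
\<close>

definition prism_stage :: "nat \<Rightarrow> nat \<Rightarrow> nat list \<Rightarrow> nat list \<Rightarrow> bool" where
  "prism_stage k i y s \<longleftrightarrow> set y \<noteq> {..k} \<or> (\<forall>j<length s. s ! j = 1 \<longrightarrow> i \<le> y ! j)"

definition prism_fst :: "nat \<Rightarrow> nat list \<Rightarrow> nat list" where
  "prism_fst i c = map (\<lambda>j. if j \<le> i then j else j - 1) c"

definition prism_snd :: "nat \<Rightarrow> nat list \<Rightarrow> nat list" where
  "prism_snd i c = map (\<lambda>j. if j \<le> i then 0 else 1) c"

lemma prism_cmp:
  assumes "c \<in> smor q n" "u \<in> smor p q"
  shows "prism_fst i (scmp c u) = scmp (prism_fst i c) u"
    and "prism_snd i (scmp c u) = scmp (prism_snd i c) u"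
  using assms smor_nth(1)[OF assms(2)]
  by (auto simp: prism_fst_def prism_snd_def scmp_eq smor_iff)

lemma prism_arr:
  assumes "c \<in> smor p (Suc k)" "i \<le> k"
  shows "prism_fst i c \<in> smor p k" "prism_snd i c \<in> smor p 1"
proof -
  have len: "length c = Suc p" using assms by (simp add: smor_iff)
  show "prism_fst i c \<in> smor p k"
  proof (rule smorI)
    show "prism_fst i c ! j \<le> k" if "j \<le> p" for j
      using smor_nth(1)[OF assms(1) that] that len assms(2) by (auto simp: prism_fst_def)
    show "prism_fst i c ! j \<le> prism_fst i c ! l" if "j \<le> l" "l \<le> p" for j l
      using smor_nth(2)[OF assms(1) that] that len by (auto simp: prism_fst_def)
  qed (simp add: len prism_fst_def)
  show "prism_snd i c \<in> smor p 1"
  proof (rule smorI)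
    show "prism_snd i c ! j \<le> prism_snd i c ! l" if "j \<le> l" "l \<le> p" for j l
      using smor_nth(2)[OF assms(1) that] that len by (simp add: prism_snd_def)
  qed (simp_all add: len prism_snd_def)
qed

lemma prism_add: "map2 (+) (prism_fst i c) (prism_snd i c) = c"
  by (rule nth_equalityI) (auto simp: prism_fst_def prism_snd_def)

text \<open>A face missing e < i or e > i + 1 projects into \<partial>\<Delta>[k], as
  \<open>prism_fst\<close> then misses e or e - 1. On the face missing i + 1, the second coordinate
  is 1 only over values at least i + 1. Conversely, if at most i is missed, the projection is onto
  and the entry i + 1 sits at height 1 over i, which stage i + 1 forbids. So only the face opposite
  to i is new.\<close>

lemma prism_horn:
  assumes c: "c \<in> smor p (Suc k)" and i: "i \<le> k"
  shows "prism_stage k (Suc i) (prism_fst i c) (prism_snd i c) \<longleftrightarrow> c \<in> cells \<Lambda>[Suc k, i] p"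
proof
  assume st: "prism_stage k (Suc i) (prism_fst i c) (prism_snd i c)"
  show "c \<in> cells \<Lambda>[Suc k, i] p"
  proof (rule ccontr)
    assume "\<not> ?thesis"
    then have eq: "insert i (set c) = {..Suc k}" using c by (auto simp: cells_horn)
    have Suc_i: "Suc i \<in> set c"
    proof -
      have "Suc i \<in> insert i (set c)" unfolding eq using i by simp
      then show ?thesis by simp
    qed
    have "set (prism_fst i c) = {..k}"
    proof
      show "set (prism_fst i c) \<subseteq> {..k}" using prism_arr(1)[OF c i] by (simp add: smor_iff)
      show "{..k} \<subseteq> set (prism_fst i c)"
      proof
        fix j assume "j \<in> {..k}"
        then have j: "j \<in> insert i (set c)" "Suc j \<in> insert i (set c)" unfolding eq by auto
        show "j \<in> set (prism_fst i c)"
        proof (cases "j < i")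
          case True
          then have "j \<in> set c" using j by auto
          then show ?thesis using True by (force simp: prism_fst_def)
        next
          case False
          then have "Suc j \<in> set c" using j by auto
          then show ?thesis using False by (force simp: prism_fst_def)
        qed
      qed
    qed
    moreover obtain j where "j < length c" "c ! j = Suc i" using Suc_i by (auto simp: in_set_conv_nth)
    ultimately show False using st by (force simp: prism_stage_def prism_fst_def prism_snd_def)
  qed
next
  assume "c \<in> cells \<Lambda>[Suc k, i] p"
  then have ne: "insert i (set c) \<noteq> {..Suc k}" by (simp add: cells_horn)
  moreover have "insert i (set c) \<subseteq> {..Suc k}" using c i by (auto simp: smor_iff)
  ultimately obtain e where e: "e \<le> Suc k" "e \<noteq> i" "e \<notin> set c" by auto
  consider "e < i" | "e = Suc i" | "e > Suc i" using e(2) by linarith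
  then show "prism_stage k (Suc i) (prism_fst i c) (prism_snd i c)"
  proof cases
    case 1
    then have "e \<notin> set (prism_fst i c)" using e by (auto simp: prism_fst_def)
    moreover have "e \<in> {..k}" using 1 i by simp
    ultimately show ?thesis unfolding prism_stage_def by blast
  next
    case 2
    have "Suc i \<le> c ! j - 1" if "j < length c" "c ! j > i" for j
      using that e(3) 2 nth_mem[OF that(1)] by (cases "c ! j = Suc i") auto
    then show ?thesis by (auto simp: prism_stage_def prism_fst_def prism_snd_def)
  next
    case 3
    have "e - 1 \<noteq> (if x \<le> i then x else x - 1)" if "x \<in> set c" for x
    proof -
      have "x \<noteq> e" using that e(3) by blast
      then show ?thesis using 3 by auto
    qed
    then have "e - 1 \<notin> set (prism_fst i c)" unfolding prism_fst_def set_map by blast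
    moreover have "e - 1 \<in> {..k}" using 3 e by simp
    ultimately show ?thesis unfolding prism_stage_def by blast
  qed
qed

text \<open>A cell that is new at stage i has an entry (i, 1). By monotonicity, entries at height 0
  lie over values at most i and those at height 1 over values at least i. So y + s is at most i
  exactly where s = 0, and both coordinates can be read off from it.\<close>

lemma prism_decompose:
  assumes y: "y \<in> smor p k" and s: "s \<in> smor p 1"
    and st: "prism_stage k i y s" "\<not> prism_stage k (Suc i) y s"
  shows "map2 (+) y s \<in> smor p (Suc k)"
    and "prism_fst i (map2 (+) y s) = y" and "prism_snd i (map2 (+) y s) = s"
proof -
  have len: "length y = Suc p" "length s = Suc p" using y s by (simp_all add: smor_iff)
  obtain j0 where j0: "j0 \<le> p" "s ! j0 = 1" "y ! j0 < Suc i" and surj: "set y = {..k}"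
    using st(2) len by (auto simp: prism_stage_def less_Suc_eq_le not_le)
  have j0': "y ! j0 = i" using st(1) surj j0 len by (fastforce simp: prism_stage_def less_Suc_eq_le)
  have s01: "s ! j = 0 \<and> y ! j \<le> i \<or> s ! j = 1 \<and> i \<le> y ! j" if "j \<le> p" for j
  proof (cases "s ! j = 1")
    case True
    then show ?thesis using st(1) surj that len by (auto simp: prism_stage_def)
  next
    case False
    then have "s ! j = 0" using smor_nth(1)[OF s that] by simp
    moreover have "j \<le> j0"
      using smor_nth(2)[OF s, of j0 j] that j0 \<open>s ! j = 0\<close> by (cases "j \<le> j0") auto
    ultimately show ?thesis using smor_nth(2)[OF y _ j0(1), of j] j0' by simp
  qed
  have nth: "map2 (+) y s ! j = y ! j + s ! j" if "j \<le> p" for j using that len by simp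
  show "map2 (+) y s \<in> smor p (Suc k)"
  proof (rule smorI)
    show "map2 (+) y s ! j \<le> Suc k" if "j \<le> p" for j
      using nth[OF that] smor_nth(1)[OF y that] s01[OF that] by auto
    show "map2 (+) y s ! j \<le> map2 (+) y s ! l" if "j \<le> l" "l \<le> p" for j l
      using nth[of j] nth[of l] that smor_nth(2)[OF y that] smor_nth(2)[OF s that] by simp
  qed (simp add: len)
  show "prism_fst i (map2 (+) y s) = y"
  proof (rule nth_equalityI)
    fix j assume "j < length (prism_fst i (map2 (+) y s))"
    then have "j \<le> p" by (simp add: prism_fst_def len)
    then show "prism_fst i (map2 (+) y s) ! j = y ! j"
      using s01[of j] nth[of j] len by (auto simp: prism_fst_def)
  qed (simp add: prism_fst_def len)
  show "prism_snd i (map2 (+) y s) = s"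
  proof (rule nth_equalityI)
    fix j assume "j < length (prism_snd i (map2 (+) y s))"
    then have "j \<le> p" by (simp add: prism_snd_def len)
    then show "prism_snd i (map2 (+) y s) ! j = s ! j"
      using s01[of j] nth[of j] len by (auto simp: prism_snd_def)
  qed (simp add: prism_snd_def len)
qed

lemma prism_stage_cmp:
  assumes y: "y \<in> smor q k" and s: "s \<in> smor q 1" and u: "u \<in> smor p q"
    and st: "prism_stage k i y s"
  shows "prism_stage k i (scmp y u) (scmp s u)"
proof (cases "set y = {..k}")
  case True
  then have "i \<le> y ! j" if "j \<le> q" "s ! j = 1" for j using st that s by (auto simp: prism_stage_def smor_iff)
  then show ?thesis using u smor_nth(1)[OF u]
    by (auto simp: prism_stage_def scmp_eq smor_iff)
next
  case False
  then have "y \<in> nonsurj q k" using y by (simp add: nonsurj_def)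
  then show ?thesis using nonsurj_cmp[OF u] by (simp add: nonsurj_def prism_stage_def)
qed

text \<open>The horn filtration of the prism, multiplied throughout by the inclusion of
  \<open>S\<close> into \<open>Z\<close>. The induction descends from stage k + 1 to stage 0, one
  horn at a time.\<close>

lemma lifts_prism:
  assumes Z: "presheaf D Z" and S: "subpresheaf D Z S"
    and mo: "\<And>p q u. u \<in> arr D p q \<Longrightarrow> mo u \<in> smor (ob p) (ob q)"
    and L: "\<And>n j. 1 \<le> n \<Longrightarrow> j \<le> n \<Longrightarrow>
      lifts D F X \<rho> (psh_prod Z (pull ob mo \<Delta>[n])) (pp Z S (pull ob mo \<Delta>[n]) (\<lambda>p. cells \<Lambda>[n,j] (ob p)))"
  shows "lifts D F X \<rho> (psh_prod Z (pull ob mo (psh_prod \<Delta>[k] \<Delta>[1])))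
    (pp Z S (pull ob mo (psh_prod \<Delta>[k] \<Delta>[1])) (\<lambda>p. {(y, s). y \<in> nonsurj (ob p) k \<or> s = vertex 0 (ob p)}))"
    (is "lifts D F X \<rho> ?P ?S")
proof (rule liftsI)
  fix u v assume u: "nat_trans D (?P\<lparr>cells := ?S\<rparr>) F u" and v: "nat_trans D ?P X v"
    and uv: "\<And>p z. z \<in> ?S p \<Longrightarrow> \<rho> p (u p z) = v p z"
  define A where "A = (\<lambda>i p. {(z, (y, s)). z \<in> cells Z p \<and> y \<in> smor (ob p) k \<and>
      s \<in> smor (ob p) 1 \<and> (z \<in> S p \<or> prism_stage k i y s)})"
  have A_mem: "(z, (y, s)) \<in> A i p \<longleftrightarrow> z \<in> cells Z p \<and> y \<in> smor (ob p) k \<and>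
      s \<in> smor (ob p) 1 \<and> (z \<in> S p \<or> prism_stage k i y s)" for z y s i p
    by (simp add: A_def)
  have A_top: "A (Suc k) p = ?S p" for p
  proof -
    have "prism_stage k (Suc k) y s \<longleftrightarrow> y \<in> nonsurj (ob p) k \<or> s = vertex 0 (ob p)"
      if y: "y \<in> smor (ob p) k" and s: "s \<in> smor (ob p) 1" for y s
    proof (cases "set y = {..k}")
      case True
      have len: "length s = Suc (ob p)" using s by (simp add: smor_iff)
      have "(\<forall>j<length s. s ! j = 1 \<longrightarrow> Suc k \<le> y ! j) \<longleftrightarrow> (\<forall>j\<le>ob p. s ! j \<noteq> 1)"
        using smor_nth(1)[OF y] by (fastforce simp: len less_Suc_eq_le)
      also have "\<dots> \<longleftrightarrow> (\<forall>j\<le>ob p. s ! j = 0)" using smor_nth(1)[OF s] by force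
      also have "\<dots> \<longleftrightarrow> s = vertex 0 (ob p)"
        by (auto simp: list_eq_iff_nth_eq vertex_def len less_Suc_eq_le simp del: replicate_Suc)
      finally show ?thesis using True y by (simp add: prism_stage_def nonsurj_def)
    qed (use y in \<open>simp add: prism_stage_def nonsurj_def\<close>)
    then show ?thesis by (auto simp: A_def pp_def)
  qed
  have A_act: "act ?P p q a x \<in> A i p" if a: "a \<in> arr D p q" and x: "x \<in> A i q" for p q a x i
  proof -
    obtain z y s where zys: "x = (z, (y, s))" by (cases x) auto
    show ?thesis
      using x prism_stage_cmp[OF _ _ mo[OF a], of y k s i] scmp_smor[OF mo[OF a]]
        pshD(1)[OF Z a, of z] subpresheafD(2)[OF S a, of z]
      by (auto simp: zys A_mem)
  qed
  have "\<exists>w. nat_trans D (?P\<lparr>cells := A i\<rparr>) F w \<and> (\<forall>p. \<forall>x\<in>?S p. w p x = u p x) \<and>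
      (\<forall>p. \<forall>x\<in>A i p. \<rho> p (w p x) = v p x)" if "i \<le> Suc k" for i
    using that
  proof (induction i rule: inc_induct)
    case base
    have "A (Suc k) = ?S" using A_top by (rule ext)
    then show ?case using u uv by (intro exI[of _ u]) simp
  next
    case (step i)
    then obtain w where w: "nat_trans D (?P\<lparr>cells := A (Suc i)\<rparr>) F w"
      and wu: "\<And>p x. x \<in> ?S p \<Longrightarrow> w p x = u p x"
      and wv: "\<And>p x. x \<in> A (Suc i) p \<Longrightarrow> \<rho> p (w p x) = v p x" by blast
    have ik: "i \<le> k" using step by simp
    let ?N = "pull ob mo \<Delta>[Suc k]"
    let ?T = "\<lambda>p. cells \<Lambda>[Suc k,i] (ob p)"
    \<comment> \<open>The characteristic map of the new simplex, with \<open>Z\<close> as a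
      parameter.\<close>
    define sig where "sig = (\<lambda>(z::'c, c). (z, (prism_fst i c, prism_snd i c)))"
    have sig_A: "sig (z, c) \<in> A (Suc i) p \<longleftrightarrow> (z, c) \<in> pp Z S ?N ?T p" if "z \<in> cells Z p" "c \<in> smor (ob p) (Suc k)" for z c p
      using that prism_arr[OF that(2) ik] prism_horn[OF that(2) ik] by (simp add: sig_def A_mem)
    have sig_P: "sig x \<in> cells ?P p" if "x \<in> cells (psh_prod Z ?N) p" for x p
      using that prism_arr[OF _ ik] by (auto simp: sig_def)
    have sig_act: "sig (act (psh_prod Z ?N) p q a x) = act ?P p q a (sig x)"
      if "a \<in> arr D p q" "x \<in> cells (psh_prod Z ?N) q" for p q a x
      using that prism_cmp[OF _ mo[OF that(1)]] by (auto simp: sig_def)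
    have T: "subpresheaf D ?N ?T"
      using subpresheafD[OF sub_horn] mo unfolding subpresheaf_def by fastforce
    have u0: "nat_trans D ((psh_prod Z ?N)\<lparr>cells := pp Z S ?N ?T\<rparr>) F (\<lambda>p x. w p (sig x))"
    proof (rule natI)
      fix p x assume "x \<in> cells ((psh_prod Z ?N)\<lparr>cells := pp Z S ?N ?T\<rparr>) p"
      then show "w p (sig x) \<in> cells F p"
        using sig_A natD(1)[OF w, of "sig x" p] by (cases x) auto
    next
      fix p q a x assume a: "a \<in> arr D p q" and x: "x \<in> cells ((psh_prod Z ?N)\<lparr>cells := pp Z S ?N ?T\<rparr>) q"
      then have "sig x \<in> A (Suc i) q" using sig_A by (cases x) auto
      moreover have "x \<in> cells (psh_prod Z ?N) q" using x by (cases x) auto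
      ultimately show "w p (sig (act ((psh_prod Z ?N)\<lparr>cells := pp Z S ?N ?T\<rparr>) p q a x)) = act F p q a (w q (sig x))"
        using natD(2)[OF w a, of "sig x"] sig_act[OF a] by simp
    qed
    have v0: "nat_trans D (psh_prod Z ?N) X (\<lambda>p x. v p (sig x))"
      using natD[OF v] sig_P sig_act by (intro natI) simp_all
    have uv0: "\<forall>p. \<forall>x\<in>pp Z S ?N ?T p. \<rho> p (w p (sig x)) = v p (sig x)"
    proof (intro allI ballI wv)
      fix p x assume "x \<in> pp Z S ?N ?T p"
      then show "sig x \<in> A (Suc i) p" using sig_A by (cases x) auto
    qed
    have L': "lifts D F X \<rho> (psh_prod Z ?N) (pp Z S ?N ?T)"
      using L[of "Suc k" i] ik by simp
    obtain W where W: "nat_trans D (psh_prod Z ?N) F W"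
      "\<And>p x. x \<in> pp Z S ?N ?T p \<Longrightarrow> W p x = w p (sig x)"
      "\<And>p x. x \<in> cells (psh_prod Z ?N) p \<Longrightarrow> \<rho> p (W p x) = v p (sig x)"
      by (rule liftsE[OF L' u0 v0 uv0]) (rule that)
    \<comment> \<open>On new cells the filler is pulled back along the inverse of
      \<open>sig\<close>. By \<open>prism_horn\<close> the overlap is exactly the horn, where
      \<open>W\<close> was prescribed to agree with \<open>w\<close>.\<close>
    define w' where "w' = (\<lambda>p (z, (y, s)). if (z, (y, s)) \<in> A (Suc i) p then w p (z, (y, s))
        else W p (z, map2 (+) y s))"
    have w'w: "w' p x = w p x" if "x \<in> A (Suc i) p" for p x
      using that by (cases x) (auto simp: w'_def)
    have w'W: "w' p (sig x) = W p x" if x: "x \<in> cells (psh_prod Z ?N) p" for p x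
    proof -
      obtain z c where zc: "x = (z, c)" by (cases x)
      show ?thesis
      proof (cases "sig x \<in> A (Suc i) p")
        case True
        then show ?thesis using W(2)[of x p] sig_A x zc w'w[OF True] by simp
      next
        case False
        then show ?thesis by (simp add: zc sig_def w'_def prism_add)
      qed
    qed
    have cases_A: "x \<in> A (Suc i) p \<or> (\<exists>x'\<in>cells (psh_prod Z ?N) p. x = sig x')" if x: "x \<in> A i p" for p x
    proof (rule disj_imp[THEN iffD2, OF impI])
      assume nx: "x \<notin> A (Suc i) p"
      obtain z y s where zys: "x = (z, (y, s))" by (cases x) auto
      have st: "y \<in> smor (ob p) k" "s \<in> smor (ob p) 1"
        "prism_stage k i y s" "\<not> prism_stage k (Suc i) y s" "z \<in> cells Z p"
        using x nx by (auto simp: zys A_mem)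
      show "\<exists>x'\<in>cells (psh_prod Z ?N) p. x = sig x'"
        using prism_decompose[OF st(1-4)] st(5)
        by (intro bexI[of _ "(z, map2 (+) y s)"]) (auto simp: zys sig_def)
    qed
    have A_mono: "A (Suc i) p \<subseteq> A i p" for p by (auto simp: A_def prism_stage_def)
    have S_A: "?S p \<subseteq> A (Suc i) p" for p
      unfolding A_top[symmetric] using ik by (auto simp: A_def prism_stage_def)
    have "nat_trans D (?P\<lparr>cells := A i\<rparr>) F w'"
    proof (rule natI)
      fix p x assume "x \<in> cells (?P\<lparr>cells := A i\<rparr>) p"
      then have "x \<in> A i p" by simp
      then consider "x \<in> A (Suc i) p" | x' where "x' \<in> cells (psh_prod Z ?N) p" "x = sig x'"
        using cases_A by blast
      then show "w' p x \<in> cells F p"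
        using natD(1)[OF w, of x p] natD(1)[OF W(1)] by cases (simp_all add: w'w w'W)
    next
      fix p q a x assume a: "a \<in> arr D p q" and "x \<in> cells (?P\<lparr>cells := A i\<rparr>) q"
      then have "x \<in> A i q" by simp
      then consider "x \<in> A (Suc i) q" | x' where "x' \<in> cells (psh_prod Z ?N) q" "x = sig x'"
        using cases_A by blast
      then have "w' p (act ?P p q a x) = act F p q a (w' q x)"
      proof cases
        case 1
        then show ?thesis using natD(2)[OF w a, of x] w'w A_act[OF a 1] by simp
      next
        case 2
        have act_in: "act (psh_prod Z ?N) p q a x' \<in> cells (psh_prod Z ?N) p"
          using 2(1) pshD(1)[OF Z a] scmp_smor[OF mo[OF a]] by auto
        then show ?thesis using natD(2)[OF W(1) a 2(1)] w'W[OF act_in] w'W[OF 2(1)] 2(2) sig_act[OF a 2(1)]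
          by simp
      qed
      then show "w' p (act (?P\<lparr>cells := A i\<rparr>) p q a x) = act F p q a (w' q x)" by simp
    qed
    moreover have "w' p x = u p x" if "x \<in> ?S p" for p x
    proof -
      have "x \<in> A (Suc i) p" using that S_A by blast
      then show ?thesis using w'w wu[OF that] by simp
    qed
    moreover have "\<rho> p (w' p x) = v p x" if "x \<in> A i p" for p x
    proof -
      from cases_A[OF that] consider "x \<in> A (Suc i) p" | x' where "x' \<in> cells (psh_prod Z ?N) p" "x = sig x'"
        by blast
      then show ?thesis using wv[of x p] W(3)[of _ p] w'w[of x p] w'W by cases simp_all
    qed
    ultimately show ?case by (intro exI[of _ w']) blast
  qed
  from this[of 0] obtain w where w: "nat_trans D (?P\<lparr>cells := A 0\<rparr>) F w"
    "\<forall>p. \<forall>x\<in>?S p. w p x = u p x" "\<forall>p. \<forall>x\<in>A 0 p. \<rho> p (w p x) = v p x" by auto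
  have "A 0 = cells ?P" by (auto simp: A_def prism_stage_def fun_eq_iff)
  then show "\<exists>w. nat_trans D ?P F w \<and> (\<forall>p. \<forall>z\<in>?S p. w p z = u p z) \<and> (\<forall>p. \<forall>z\<in>cells ?P p. \<rho> p (w p z) = v p z)"
    using w by (intro exI[of _ w]) (simp add: nat_trans_def)
qed

section \<open>Kan fibrations that are weak homotopy equivalences\<close>

text \<open>The homotopy lifting property relative to \<open>K\<close>. Attaching the cells of
  \<open>L\<close> outside \<open>K\<close> reduces it to prisms, and those to horns.\<close>

lemma kan_lifts_cylinder:
  assumes p: "kan_fibration A B p" and L: "sset L" and K: "subsset L K"
  shows "slifts A B p (psh_prod L \<Delta>[1]) (pp L K \<Delta>[1] (\<lambda>m. {vertex 0 m}))"
proof (rule simplex.lifts_cellwise[OF L sset_simplex _ K sub_vertex])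
  show "sset A" using p by (simp add: kan_fibration_iff)
  fix d
  \<comment> \<open>The terminal simplicial set with empty subobject: \<open>lifts_prism\<close>
    then carries no parameter.\<close>
  define U :: "unit sset" where "U = \<lparr>cells = \<lambda>_. {()}, act = \<lambda>_ _ _ _. ()\<rparr>"
  have cells_U: "cells U m = {()}" for m by (simp add: U_def)
  have U: "sset U" by (simp add: presheaf_def U_def)
  have pull_id: "pull (\<lambda>x. x) (\<lambda>u. u) M = M" for M :: "'k sset" by (simp add: pull_def)
  have horn: "slifts A B p (psh_prod U (pull (\<lambda>x. x) (\<lambda>u. u) \<Delta>[n]))
      (pp U (\<lambda>_. {}) (pull (\<lambda>x. x) (\<lambda>u. u) \<Delta>[n]) (\<lambda>m. cells \<Lambda>[n,j] m))" if "1 \<le> n" "j \<le> n" for n j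
    unfolding pull_id
  proof (rule lifts_iso[where f="\<lambda>_. snd" and g="\<lambda>_ x. ((), x)"])
    show "slifts A B p \<Delta>[n] (cells \<Lambda>[n,j])" using p that by (simp add: kan_fibration_iff)
    show "subsset \<Delta>[n] (cells \<Lambda>[n,j])" by (rule sub_horn)
  qed (auto simp: nat_trans_def U_def cells_horn)
  have "slifts A B p (psh_prod U (pull (\<lambda>x. x) (\<lambda>u. u) (psh_prod \<Delta>[d] \<Delta>[1])))
     (pp U (\<lambda>_. {}) (pull (\<lambda>x. x) (\<lambda>u. u) (psh_prod \<Delta>[d] \<Delta>[1])) (\<lambda>m. {(y, s). y \<in> nonsurj m d \<or> s = vertex 0 m}))"
    by (rule lifts_prism[OF U _ _ horn]) (simp_all add: subpresheaf_def)
  then have prism: "slifts A B p (psh_prod U (psh_prod \<Delta>[d] \<Delta>[1]))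
     (pp U (\<lambda>_. {}) (psh_prod \<Delta>[d] \<Delta>[1]) (\<lambda>m. {(y, s). y \<in> nonsurj m d \<or> s = vertex 0 m}))"
    unfolding pull_id .
  have "slifts A B p (psh_prod \<Delta>[d] \<Delta>[1]) (pp \<Delta>[d] (\<lambda>m. nonsurj m d) \<Delta>[1] (\<lambda>m. {vertex 0 m}))"
  proof (rule lifts_iso[OF prism, where g="\<lambda>_. snd" and f="\<lambda>_ x. ((), x)"])
    show "subsset (psh_prod U (psh_prod \<Delta>[d] \<Delta>[1]))
     (pp U (\<lambda>_. {}) (psh_prod \<Delta>[d] \<Delta>[1]) (\<lambda>m. {(y, s). y \<in> nonsurj m d \<or> s = vertex 0 m}))"
      unfolding subpresheaf_def
      using nonsurj_cmp scmp_smor scmp_vertex by (auto simp: cells_U U_def)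
  qed (auto simp: nat_trans_def U_def)
  then show "(\<exists>r. \<exists>y\<in>cells L r. \<exists>u\<in>smor d r. r < d \<and> x = act L d r u y) \<or>
      slifts A B p (psh_prod (yoneda simplex_cat d) \<Delta>[1])
        (pp (yoneda simplex_cat d) (\<lambda>p. nonsurj p d) \<Delta>[1] (\<lambda>m. {vertex 0 m}))" for x
    by (simp add: std_simplex_def)
qed simp

text \<open>
  \<open>G\<close> is the top of a filled square with vertical sides \<open>g0\<close>, \<open>g1\<close> and constant bottom.
\<close>

lemma homotopy_quotient:
  assumes p: "kan_fibration A B p" and Y: "sset Y"
    and g0: "smap (psh_prod Y \<Delta>[1]) A g0" and g1: "smap (psh_prod Y \<Delta>[1]) A g1"
    and start: "\<And>m y. y \<in> cells Y m \<Longrightarrow> g0 m (y, vertex 0 m) = g1 m (y, vertex 0 m)"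
    and over: "\<And>m y t. y \<in> cells Y m \<Longrightarrow> t \<in> cells \<Delta>[1] m \<Longrightarrow> p m (g0 m (y, t)) = p m (g1 m (y, t))"
  obtains G where "smap (psh_prod Y \<Delta>[1]) A G"
    "\<And>m y. y \<in> cells Y m \<Longrightarrow> G m (y, vertex 0 m) = g0 m (y, vertex 1 m)"
    "\<And>m y. y \<in> cells Y m \<Longrightarrow> G m (y, vertex 1 m) = g1 m (y, vertex 1 m)"
    "\<And>m y t. y \<in> cells Y m \<Longrightarrow> t \<in> cells \<Delta>[1] m \<Longrightarrow> p m (G m (y, t)) = p m (g0 m (y, vertex 1 m))"
proof -
  let ?L = "psh_prod Y \<Delta>[1]"
  let ?K = "\<lambda>m. {(y, s). y \<in> cells Y m \<and> (s = vertex 0 m \<or> s = vertex 1 m)}"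
  let ?S = "pp ?L ?K \<Delta>[1] (\<lambda>m. {vertex 0 m})"
  have pnat: "smap A B p" using p by (simp add: kan_fibration_iff)
  have L: "sset ?L" by (rule presheaf_prod[OF Y sset_simplex])
  have K: "subsset ?L ?K"
    unfolding subpresheaf_def using pshD(1)[OF Y] by (auto simp: vertex_smor scmp_vertex)
  \<comment> \<open>Here \<open>s\<close> runs horizontally and \<open>t\<close> vertically. Inside
    \<open>?S\<close> the last branch is reached only on the bottom t = 0, where \<open>g0\<close>
    and \<open>g1\<close> agree.\<close>
  define u where "u = (\<lambda>m ((y, s), t). if s = vertex 0 m then g0 m (y, t)
      else if s = vertex 1 m then g1 m (y, t) else g0 m (y, vertex 0 m))"
  have u0: "u m ((y, s), vertex 0 m) = g0 m (y, vertex 0 m)" if "y \<in> cells Y m" for m y s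
    using start[OF that] by (simp add: u_def)
  have u1: "u m ((y, vertex 0 m), t) = g0 m (y, t)" "u m ((y, vertex 1 m), t) = g1 m (y, t)" for m y t
    by (simp_all add: u_def vertex_inj)
  have S_cases: "\<exists>y s t. x = ((y, s), t) \<and> y \<in> cells Y m \<and> s \<in> smor m 1 \<and> t \<in> smor m 1 \<and>
      (t = vertex 0 m \<or> s = vertex 0 m \<or> s = vertex 1 m)" if "x \<in> ?S m" for x m
    using that by (cases x) auto
  have "smap ((psh_prod ?L \<Delta>[1])\<lparr>cells := ?S\<rparr>) A u"
  proof (rule natI)
    fix m x assume "x \<in> cells ((psh_prod ?L \<Delta>[1])\<lparr>cells := ?S\<rparr>) m"
    then obtain y s t where x: "x = ((y, s), t)" "y \<in> cells Y m" "t \<in> smor m 1"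
      using S_cases[of x m] by auto
    then show "u m x \<in> cells A m"
      using natD(1)[OF g0, of _ m] natD(1)[OF g1, of _ m] by (auto simp: u_def vertex_smor)
  next
    fix m n a x assume a: "a \<in> smor m n" and "x \<in> cells ((psh_prod ?L \<Delta>[1])\<lparr>cells := ?S\<rparr>) n"
    then obtain y s t where x: "x = ((y, s), t)" "y \<in> cells Y n" "s \<in> smor n 1" "t \<in> smor n 1"
      "t = vertex 0 n \<or> s = vertex 0 n \<or> s = vertex 1 n"
      using S_cases[of x n] by auto
    note Ya = pshD(1)[OF Y a x(2)]
    from x(5) have "u m (act (psh_prod ?L \<Delta>[1]) m n a x) = act A m n a (u n x)"
      using natD(2)[OF g0 a, of "(y, t)"] natD(2)[OF g1 a, of "(y, t)"] x(1-4) u0[OF Ya] u0[OF x(2)]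
      by (elim disjE) (simp_all add: u1 scmp_vertex[OF a] del: One_nat_def)
    then show "u m (act ((psh_prod ?L \<Delta>[1])\<lparr>cells := ?S\<rparr>) m n a x) = act A m n a (u n x)" by simp
  qed
  \<comment> \<open>The square to be covered is independent of \<open>s\<close>, which makes the
    projection of its top edge constant.\<close>
  moreover have "smap (psh_prod ?L \<Delta>[1]) B (\<lambda>m ((y, s), t). p m (g0 m (y, t)))"
    using natD[OF nat_trans_comp[OF g0 pnat]] by (intro natI) auto
  moreover have "\<forall>m. \<forall>x\<in>?S m. p m (u m x) = (\<lambda>m ((y, s), t). p m (g0 m (y, t))) m x"
    using over u0 by (auto simp: u_def)
  ultimately obtain w where w: "smap (psh_prod ?L \<Delta>[1]) A w" "\<And>m x. x \<in> ?S m \<Longrightarrow> w m x = u m x"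
    "\<And>m x. x \<in> cells (psh_prod ?L \<Delta>[1]) m \<Longrightarrow> p m (w m x) = (\<lambda>m ((y, s), t). p m (g0 m (y, t))) m x"
    by (rule liftsE[OF kan_lifts_cylinder[OF p L K]]) (rule that)
  show thesis
  proof (rule that[of "\<lambda>m x. w m (x, vertex 1 m)"])
    show "smap (psh_prod Y \<Delta>[1]) A (\<lambda>m x. w m (x, vertex 1 m))"
    proof (rule natI)
      fix m x assume "x \<in> cells (psh_prod Y \<Delta>[1]) m"
      then show "w m (x, vertex 1 m) \<in> cells A m"
        using natD(1)[OF w(1), of "(x, vertex 1 m)" m] by (simp add: vertex_smor)
    next
      fix m n a x assume "a \<in> smor m n" "x \<in> cells (psh_prod Y \<Delta>[1]) n"
      then show "w m (act (psh_prod Y \<Delta>[1]) m n a x, vertex 1 m) = act A m n a (w n (x, vertex 1 n))"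
        using natD(2)[OF w(1), of a m n "(x, vertex 1 n)"] by (simp add: vertex_smor scmp_vertex)
    qed
    fix m y assume y: "y \<in> cells Y m"
    show "w m ((y, vertex 0 m), vertex 1 m) = g0 m (y, vertex 1 m)"
      using w(2)[of "((y, vertex 0 m), vertex 1 m)" m] y by (simp add: vertex_smor u1)
    show "w m ((y, vertex 1 m), vertex 1 m) = g1 m (y, vertex 1 m)"
      using w(2)[of "((y, vertex 1 m), vertex 1 m)" m] y by (simp add: vertex_smor u1 del: One_nat_def)
    show "p m (w m ((y, t), vertex 1 m)) = p m (g0 m (y, vertex 1 m))" if "t \<in> cells \<Delta>[1] m" for t
      using w(3)[of "((y, t), vertex 1 m)" m] y that by (simp add: vertex_smor)
  qed
qed

text \<open>
  Kan complexes are moved into the type \<open>('a + 'b) list\<close> on which weak homotopy equivalences are tested.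
\<close>

definition relabel :: "('a \<Rightarrow> 'b) \<Rightarrow> ('b \<Rightarrow> 'a) \<Rightarrow> 'a sset \<Rightarrow> 'b sset" where
  "relabel e e' A = \<lparr>cells = (\<lambda>m. e ` cells A m), act = (\<lambda>p q u y. e (act A p q u (e' y)))\<rparr>"

lemma smap_relabel:
  assumes "\<And>x. e' (e x) = x"
  shows "smap A (relabel e e' A) (\<lambda>_. e)" and "smap (relabel e e' A) A (\<lambda>_. e')"
  by (auto simp: nat_trans_def relabel_def assms)

lemma kan_complex_relabel:
  assumes A: "kan_complex A" and e: "\<And>x. e' (e x) = x"
  shows "kan_complex (relabel e e' A)"
proof -
  let ?A = "relabel e e' A"
  have sA: "sset A" using A by (simp add: kan_complex_def kan_fibration_iff)
  have "sset ?A"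
    using pshD[OF sA] by (intro pshI) (auto simp: relabel_def e)
  moreover have "smap ?A \<Delta>[0] (\<lambda>m x. vertex 0 m)"
    by (auto simp: nat_trans_def vertex_smor scmp_vertex)
  moreover have "slifts ?A \<Delta>[0] (\<lambda>m x. vertex 0 m) \<Delta>[n] (cells \<Lambda>[n,k])"
    if "1 \<le> n" "k \<le> n" for n k
  proof (rule liftsI)
    fix u v assume u: "smap (\<Delta>[n]\<lparr>cells := cells \<Lambda>[n,k]\<rparr>) ?A u" and v: "smap \<Delta>[n] \<Delta>[0] v"
      and uv: "\<And>p z. z \<in> cells \<Lambda>[n,k] p \<Longrightarrow> vertex 0 p = v p z"
    have L: "slifts A \<Delta>[0] (\<lambda>m x. vertex 0 m) \<Delta>[n] (cells \<Lambda>[n,k])"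
      using A that by (simp add: kan_complex_def kan_fibration_iff)
    obtain w where w: "smap \<Delta>[n] A w" "\<And>p z. z \<in> cells \<Lambda>[n,k] p \<Longrightarrow> w p z = e' (u p z)"
      "\<And>p z. z \<in> cells \<Delta>[n] p \<Longrightarrow> vertex 0 p = v p z"
      by (rule liftsE[OF L nat_trans_comp[OF u smap_relabel(2)[of e' e, OF e]] v]) (use uv in blast, rule that)
    have "e (e' (u p z)) = u p z" if "z \<in> cells \<Lambda>[n,k] p" for p z
      using natD(1)[OF u, of z p] that e by (auto simp: relabel_def)
    then show "\<exists>w. smap \<Delta>[n] ?A w \<and> (\<forall>p. \<forall>z\<in>cells \<Lambda>[n,k] p. w p z = u p z) \<and>
        (\<forall>p. \<forall>z\<in>cells \<Delta>[n] p. vertex 0 p = v p z)"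
      using w nat_trans_comp[OF w(1) smap_relabel(1)[of e' e, OF e]]
      by (intro exI[of _ "\<lambda>p z. e (w p z)"]) simp
  qed
  ultimately show ?thesis
    unfolding kan_complex_def kan_fibration_iff using sset_simplex by blast
qed

text \<open>Testing against a copy of \<open>A\<close> gives \<open>h\<close> with h f homotopic to
  the identity. Applying \<open>f\<close> shows that f h f is homotopic to f, and testing against a
  copy of \<open>B\<close> cancels the inner \<open>f\<close>. Singleton lists embed both cell types
  into the test type.\<close>

lemma weak_equivalence_homotopy_inverse:
  fixes A :: "'a sset" and B :: "'b sset"
  assumes A: "kan_complex A" and B: "kan_complex B" and f: "weak_homotopy_equivalence A B f"
  obtains h where "smap B A h" "shomotopic A A (\<lambda>m x. h m (f m x)) (\<lambda>m x. x)"
    "shomotopic B B (\<lambda>m y. f m (h m y)) (\<lambda>m y. y)"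
proof -
  define e1 :: "'a \<Rightarrow> ('a + 'b) list" where "e1 = (\<lambda>x. [Inl x])"
  define r1 :: "('a + 'b) list \<Rightarrow> 'a" where "r1 = (\<lambda>xs. projl (hd xs))"
  define e2 :: "'b \<Rightarrow> ('a + 'b) list" where "e2 = (\<lambda>x. [Inr x])"
  define r2 :: "('a + 'b) list \<Rightarrow> 'b" where "r2 = (\<lambda>xs. projr (hd xs))"
  have r1: "r1 (e1 x) = x" for x by (simp add: e1_def r1_def)
  have r2: "r2 (e2 x) = x" for x by (simp add: e2_def r2_def)
  note e1s = smap_relabel[of r1 e1, OF r1] and e2s = smap_relabel[of r2 e2, OF r2]
  have fs: "smap A B f" using f by (simp add: weak_homotopy_equivalence_def)
  obtain h' where h': "smap B (relabel e1 r1 A) h'"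
    "shomotopic A (relabel e1 r1 A) (\<lambda>m x. h' m (f m x)) (\<lambda>_. e1)"
    using f kan_complex_relabel[OF A, of r1 e1, OF r1] e1s(1) unfolding weak_homotopy_equivalence_def by blast
  define h where "h = (\<lambda>m y. r1 (h' m y))"
  have h: "smap B A h" unfolding h_def by (rule nat_trans_comp[OF h'(1) e1s(2)])
  from h'(2) obtain H' where H': "smap (psh_prod A \<Delta>[1]) (relabel e1 r1 A) H'"
    "\<forall>m. \<forall>x\<in>cells A m. H' m (x, vertex 0 m) = h' m (f m x) \<and> H' m (x, vertex 1 m) = e1 x"
    unfolding shomotopic_def by blast
  define H where "H = (\<lambda>m x. r1 (H' m x))"
  have H: "smap (psh_prod A \<Delta>[1]) A H" unfolding H_def by (rule nat_trans_comp[OF H'(1) e1s(2)])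
  have H01: "H m (x, vertex 0 m) = h m (f m x)" "H m (x, vertex 1 m) = x" if "x \<in> cells A m" for m x
    using H'(2) that by (simp_all add: H_def h_def r1)
  have "smap (psh_prod A \<Delta>[1]) (relabel e2 r2 B) (\<lambda>m x. e2 (f m (H m x)))"
    by (rule nat_trans_comp[OF nat_trans_comp[OF H fs] e2s(1)])
  then have "shomotopic A (relabel e2 r2 B) (\<lambda>m x. e2 (f m (h m (f m x)))) (\<lambda>m x. e2 (f m x))"
    unfolding shomotopic_def using H01 by (intro exI[of _ "\<lambda>m x. e2 (f m (H m x))"]) simp
  moreover have "smap B (relabel e2 r2 B) (\<lambda>m y. e2 (f m (h m y)))"
    by (rule nat_trans_comp[OF nat_trans_comp[OF h fs] e2s(1)])
  moreover have uniq: "shomotopic B (relabel e2 r2 B) a b"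
    if "smap B (relabel e2 r2 B) a" "smap B (relabel e2 r2 B) b"
      "shomotopic A (relabel e2 r2 B) (\<lambda>m x. a m (f m x)) (\<lambda>m x. b m (f m x))" for a b
    using f kan_complex_relabel[OF B, of r2 e2, OF r2] that unfolding weak_homotopy_equivalence_def by blast
  ultimately have "shomotopic B (relabel e2 r2 B) (\<lambda>m y. e2 (f m (h m y))) (\<lambda>_. e2)"
    using e2s(1) by blast
  then obtain N' where N': "smap (psh_prod B \<Delta>[1]) (relabel e2 r2 B) N'"
    "\<forall>m. \<forall>y\<in>cells B m. N' m (y, vertex 0 m) = e2 (f m (h m y)) \<and> N' m (y, vertex 1 m) = e2 y"
    unfolding shomotopic_def by blast
  have "shomotopic B B (\<lambda>m y. f m (h m y)) (\<lambda>m y. y)"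
    unfolding shomotopic_def using N'(2) nat_trans_comp[OF N'(1) e2s(2)]
    by (intro exI[of _ "\<lambda>m y. r2 (N' m y)"]) (simp add: r2)
  moreover have "shomotopic A A (\<lambda>m x. h m (f m x)) (\<lambda>m x. x)"
    unfolding shomotopic_def using H H01 by blast
  ultimately show thesis using that h by blast
qed

text \<open>
  Lifting the homotopy \<open>f \<circ> h0 \<sim> id\<close> turns the homotopy inverse into a strict section \<open>h\<close>.  For the
  homotopy \<open>G\<close>, the first use of \<open>homotopy_quotient\<close> replaces \<open>h0\<close> by \<open>h\<close>, the second one divides
  \<open>H2 : h \<circ> f \<sim> id\<close> by \<open>h \<circ> f \<circ> H2\<close>, which lies over the same homotopy in \<open>B\<close>, to make it vertical.
\<close>

lemma homotopy_section:
  assumes A: "kan_complex A" and B: "kan_complex B" and f: "kan_fibration A B f"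
    and w: "weak_homotopy_equivalence A B f"
  obtains h G where "smap B A h" "\<And>m y. y \<in> cells B m \<Longrightarrow> f m (h m y) = y"
    "smap (psh_prod A \<Delta>[1]) A G"
    "\<And>m x. x \<in> cells A m \<Longrightarrow> G m (x, vertex 0 m) = h m (f m x)"
    "\<And>m x. x \<in> cells A m \<Longrightarrow> G m (x, vertex 1 m) = x"
    "\<And>m x t. x \<in> cells A m \<Longrightarrow> t \<in> cells \<Delta>[1] m \<Longrightarrow> f m (G m (x, t)) = f m x"
proof -
  have fs: "smap A B f" and sA: "sset A" and sB: "sset B" using f by (simp_all add: kan_fibration_iff)
  obtain h0 H N where h0: "smap B A h0"
    and H: "smap (psh_prod A \<Delta>[1]) A H"
      "\<And>m x. x \<in> cells A m \<Longrightarrow> H m (x, vertex 0 m) = h0 m (f m x) \<and> H m (x, vertex 1 m) = x"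
    and N: "smap (psh_prod B \<Delta>[1]) B N"
      "\<And>m y. y \<in> cells B m \<Longrightarrow> N m (y, vertex 0 m) = f m (h0 m y) \<and> N m (y, vertex 1 m) = y"
    by (rule weak_equivalence_homotopy_inverse[OF A B w]) (unfold shomotopic_def, blast)
  \<comment> \<open>With nothing prescribed on the sides, cylinder lifting is plain homotopy
    lifting.\<close>
  let ?S = "pp B (\<lambda>_. {}) \<Delta>[1] (\<lambda>m. {vertex 0 m})"
  have "subsset B (\<lambda>_. {})" by (simp add: subpresheaf_def)
  note L = kan_lifts_cylinder[OF f sB this]
  have u: "smap ((psh_prod B \<Delta>[1])\<lparr>cells := ?S\<rparr>) A (\<lambda>m x. h0 m (fst x))"
    using natD[OF h0] by (intro natI) auto
  have uv: "\<forall>m. \<forall>x\<in>?S m. f m (h0 m (fst x)) = N m x" using N(2) by auto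
  obtain K where K: "smap (psh_prod B \<Delta>[1]) A K" "\<And>m x. x \<in> ?S m \<Longrightarrow> K m x = h0 m (fst x)"
    "\<And>m x. x \<in> cells (psh_prod B \<Delta>[1]) m \<Longrightarrow> f m (K m x) = N m x"
    by (rule liftsE[OF L u N(1) uv]) (rule that)
  define h where "h = (\<lambda>m y. K m (y, vertex 1 m))"
  have h: "smap B A h"
    using natD[OF K(1)] by (intro natI) (auto simp: h_def vertex_smor simp flip: scmp_vertex)
  have fh: "f m (h m y) = y" if "y \<in> cells B m" for m y
    using K(3)[of "(y, vertex 1 m)" m] N(2) that by (simp add: h_def vertex_smor)
  have g0: "smap (psh_prod A \<Delta>[1]) A (\<lambda>m (x, t). K m (f m x, t))"
    using natD[OF K(1)] natD[OF fs] by (intro natI) auto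
  have K0: "K m (y, vertex 0 m) = h0 m y" if "y \<in> cells B m" for m y
    using K(2)[of "(y, vertex 0 m)" m] that by (simp add: vertex_smor)
  obtain H2 where H2: "smap (psh_prod A \<Delta>[1]) A H2"
    "\<And>m x. x \<in> cells A m \<Longrightarrow> H2 m (x, vertex 0 m) = h m (f m x)"
    "\<And>m x. x \<in> cells A m \<Longrightarrow> H2 m (x, vertex 1 m) = x"
  \<comment> \<open>Over the point every homotopy is vertical, so only the common start
    \<open>h0\<close> after \<open>f\<close> has to be checked.\<close>
  proof (rule homotopy_quotient[OF A[unfolded kan_complex_def] sA g0 H(1)])
    show "(\<lambda>(x, t). K m (f m x, t)) (x, vertex 0 m) = H m (x, vertex 0 m)" if "x \<in> cells A m" for m x
      using K0 H(2) natD(1)[OF fs] that by simp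
  qed (use that H(2) in \<open>simp_all add: h_def\<close>)
  have g0': "smap (psh_prod A \<Delta>[1]) A (\<lambda>m x. h m (f m (H2 m x)))"
    by (rule nat_trans_comp[OF nat_trans_comp[OF H2(1) fs] h])
  note H2c = natD(1)[OF H2(1)] and fc = natD(1)[OF fs] and hc = natD(1)[OF h]
  obtain G where G: "smap (psh_prod A \<Delta>[1]) A G"
    "\<And>m x. x \<in> cells A m \<Longrightarrow> G m (x, vertex 0 m) = h m (f m (H2 m (x, vertex 1 m)))"
    "\<And>m x. x \<in> cells A m \<Longrightarrow> G m (x, vertex 1 m) = H2 m (x, vertex 1 m)"
    "\<And>m x t. x \<in> cells A m \<Longrightarrow> t \<in> cells \<Delta>[1] m \<Longrightarrow> f m (G m (x, t)) = f m (h m (f m (H2 m (x, vertex 1 m))))"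
  proof (rule homotopy_quotient[OF f sA g0' H2(1)])
    show "h m (f m (H2 m (x, vertex 0 m))) = H2 m (x, vertex 0 m)" if "x \<in> cells A m" for m x
      using that H2(2) fh fc by simp
    show "f m (h m (f m (H2 m (x, t)))) = f m (H2 m (x, t))" if "x \<in> cells A m" "t \<in> cells \<Delta>[1] m" for m x t
      using that H2c fh fc by simp
  qed (rule that)
  show thesis
    by (rule that[OF h fh G(1)]) (use G H2(3) fc fh in \<open>simp_all\<close>)
qed

text \<open>The section gives the lift \<open>h\<close> after \<open>v\<close>, which is wrong on
  \<open>S\<close>. There the vertical homotopy \<open>G\<close> leads from it to \<open>u\<close>.
  Lift the constant homotopy at \<open>v\<close> extending these data; its end is the lift
  sought.\<close>

theorem trivial_fibration_lifts:
  assumes A: "kan_complex A" and B: "kan_complex B" and f: "kan_fibration A B f"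
    and w: "weak_homotopy_equivalence A B f" and Z: "sset Z" and S: "subsset Z S"
  shows "slifts A B f Z S"
proof (rule liftsI)
  fix u v assume u: "smap (Z\<lparr>cells := S\<rparr>) A u" and v: "smap Z B v"
    and uv: "\<And>m z. z \<in> S m \<Longrightarrow> f m (u m z) = v m z"
  obtain h G where h: "smap B A h" "\<And>m y. y \<in> cells B m \<Longrightarrow> f m (h m y) = y"
    and G: "smap (psh_prod A \<Delta>[1]) A G"
    "\<And>m x. x \<in> cells A m \<Longrightarrow> G m (x, vertex 0 m) = h m (f m x)"
    "\<And>m x. x \<in> cells A m \<Longrightarrow> G m (x, vertex 1 m) = x"
    "\<And>m x t. x \<in> cells A m \<Longrightarrow> t \<in> cells \<Delta>[1] m \<Longrightarrow> f m (G m (x, t)) = f m x"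
    by (rule homotopy_section[OF A B f w]) (rule that)
  let ?S = "pp Z S \<Delta>[1] (\<lambda>m. {vertex 0 m})"
  note L = kan_lifts_cylinder[OF f Z S]
  have uc: "u m z \<in> cells A m" if "z \<in> S m" for m z using natD(1)[OF u, of z m] that by simp
  have ua: "u m (act Z m n a z) = act A m n a (u n z)" if "a \<in> smor m n" "z \<in> S n" for m n a z
    using natD(2)[OF u, of a m n z] that by simp
  \<comment> \<open>Outside \<open>S\<close> only t = 0 occurs in \<open>?S\<close>, so this branch
    needs no dependence on \<open>t\<close>.\<close>
  define u' where "u' = (\<lambda>m (z, t). if z \<in> S m then G m (u m z, t) else h m (v m z))"
  have u'0: "u' m (z, vertex 0 m) = h m (v m z)" if "z \<in> cells Z m" for m z
    using G(2) uc uv by (simp add: u'_def)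
  have "smap ((psh_prod Z \<Delta>[1])\<lparr>cells := ?S\<rparr>) A u'"
  proof (rule natI)
    fix m x assume "x \<in> cells ((psh_prod Z \<Delta>[1])\<lparr>cells := ?S\<rparr>) m"
    then show "u' m x \<in> cells A m"
      using natD(1)[OF G(1)] natD(1)[OF h(1)] natD(1)[OF v] uc
      by (cases x) (auto simp: u'_def)
  next
    fix m n a x assume a: "a \<in> smor m n" and "x \<in> cells ((psh_prod Z \<Delta>[1])\<lparr>cells := ?S\<rparr>) n"
    then obtain z t where x: "x = (z, t)" "z \<in> cells Z n" "t \<in> smor n 1" "z \<in> S n \<or> t = vertex 0 n"
      by (cases x) auto
    from x(4) have "u' m (act (psh_prod Z \<Delta>[1]) m n a x) = act A m n a (u' n x)"
    proof
      assume z: "z \<in> S n"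
      then show ?thesis
        using natD(2)[OF G(1) a, of "(u n z, t)"] uc[OF z] ua[OF a z] subpresheafD(2)[OF S a z] x
        by (simp add: u'_def)
    next
      assume t: "t = vertex 0 n"
      have "u' m (act Z m n a z, vertex 0 m) = act A m n a (u' n (z, vertex 0 n))"
        using u'0 x(2) pshD(1)[OF Z a x(2)] natD(2)[OF h(1) a natD(1)[OF v x(2)]] natD(2)[OF v a x(2)]
        by simp
      then show ?thesis by (simp add: x t scmp_vertex[OF a])
    qed
    then show "u' m (act ((psh_prod Z \<Delta>[1])\<lparr>cells := ?S\<rparr>) m n a x) = act A m n a (u' n x)" by simp
  qed
  moreover have "smap (psh_prod Z \<Delta>[1]) B (\<lambda>m x. v m (fst x))"
    using natD[OF v] by (intro natI) auto
  moreover have "\<forall>m. \<forall>x\<in>?S m. f m (u' m x) = v m (fst x)"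
    using h(2) G(4) uc uv natD(1)[OF v] by (auto simp: u'_def)
  ultimately obtain w where w: "smap (psh_prod Z \<Delta>[1]) A w" "\<And>m x. x \<in> ?S m \<Longrightarrow> w m x = u' m x"
    "\<And>m x. x \<in> cells (psh_prod Z \<Delta>[1]) m \<Longrightarrow> f m (w m x) = v m (fst x)"
    by (rule liftsE[OF L]) (rule that)
  have "smap Z A (\<lambda>m z. w m (z, vertex 1 m))"
    using natD[OF w(1)] by (intro natI) (auto simp: vertex_smor simp flip: scmp_vertex)
  moreover have "w m (z, vertex 1 m) = u m z" if "z \<in> S m" for m z
    using w(2)[of "(z, vertex 1 m)" m] that G(3) uc subpresheafD(1)[OF S that] by (simp add: vertex_smor u'_def)
  moreover have "f m (w m (z, vertex 1 m)) = v m z" if "z \<in> cells Z m" for m z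
    using w(3)[of "(z, vertex 1 m)" m] that by (simp add: vertex_smor)
  ultimately show "\<exists>w. smap Z A w \<and> (\<forall>m. \<forall>z\<in>S m. w m z = u m z) \<and> (\<forall>m. \<forall>z\<in>cells Z m. f m (w m z) = v m z)"
    by (intro exI[of _ "\<lambda>m z. w m (z, vertex 1 m)"]) blast
qed

section \<open>Exponentials and levels\<close>

lemma act_psh_exp:
  "act (psh_exp D X K) p q u \<theta> = (\<lambda>r. \<lambda>(v, z)\<in>arr D r p \<times> cells K r. \<theta> r (cmp D u v, z))"
  by (simp add: psh_exp_def)

lemma cells_psh_exp:
  "\<theta> \<in> cells (psh_exp D X K) q \<longleftrightarrow> nat_trans D (psh_prod (yoneda D q) K) X \<theta> \<and>
     (\<forall>r. \<theta> r \<in> extensional (arr D r q \<times> cells K r))"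
  by (simp add: psh_exp_def Nat_def)

lemma exp_app:
  assumes "\<theta> \<in> cells (psh_exp D X K) q"
  shows "v \<in> arr D r q \<Longrightarrow> z \<in> cells K r \<Longrightarrow> \<theta> r (v, z) \<in> cells X r"
    and "v \<in> arr D r q \<Longrightarrow> z \<in> cells K r \<Longrightarrow> w \<in> arr D t r \<Longrightarrow>
      \<theta> t (cmp D v w, act K t r w z) = act X t r w (\<theta> r (v, z))"
proof -
  have \<theta>: "nat_trans D (psh_prod (yoneda D q) K) X \<theta>" using assms by (simp add: cells_psh_exp)
  show "\<theta> r (v, z) \<in> cells X r" if "v \<in> arr D r q" "z \<in> cells K r"
    using natD(1)[OF \<theta>, of "(v, z)" r] that by simp
  show "\<theta> t (cmp D v w, act K t r w z) = act X t r w (\<theta> r (v, z))"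
    if "v \<in> arr D r q" "z \<in> cells K r" "w \<in> arr D t r"
    using natD(2)[OF \<theta> that(3), of "(v, z)"] that by simp
qed

lemma exp_eqI:
  assumes "\<theta> \<in> cells (psh_exp D X K) q" "\<theta>' \<in> cells (psh_exp D X K) q"
    and "\<And>r v z. v \<in> arr D r q \<Longrightarrow> z \<in> cells K r \<Longrightarrow> \<theta> r (v, z) = \<theta>' r (v, z)"
  shows "\<theta> = \<theta>'"
proof
  fix r
  show "\<theta> r = \<theta>' r"
    using assms by (intro extensionalityI[where A="arr D r q \<times> cells K r"]) (auto simp: cells_psh_exp)
qed

section \<open>Currying of presheaf maps\<close>

definition curry_nat ::
  "('o, 'm) small_cat \<Rightarrow> ('o, 'm, 'y) psh \<Rightarrow> ('o, 'm, 'k) psh \<Rightarrow> ('o \<Rightarrow> 'y \<times> 'k \<Rightarrow> 'a) \<Rightarrow>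
     'o \<Rightarrow> 'y \<Rightarrow> 'o \<Rightarrow> 'm \<times> 'k \<Rightarrow> 'a" where
  "curry_nat D Y K \<phi> q y = (\<lambda>r. \<lambda>(v, z)\<in>arr D r q \<times> cells K r. \<phi> r (act Y r q v y, z))"

lemma curry_nat_app [simp]:
  "v \<in> arr D r q \<Longrightarrow> z \<in> cells K r \<Longrightarrow> curry_nat D Y K \<phi> q y r (v, z) = \<phi> r (act Y r q v y, z)"
  by (simp add: curry_nat_def)

lemma presheaf_psh_exp:
  assumes D: "small_category D" and K: "presheaf D K"
  shows "presheaf D (psh_exp D X K)"
proof (rule pshI)
  note cat = catD[OF D]
  show *: "act (psh_exp D X K) p q u \<theta> \<in> cells (psh_exp D X K) p"
    if u: "u \<in> arr D p q" and \<theta>: "\<theta> \<in> cells (psh_exp D X K) q" for p q u \<theta>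
    unfolding cells_psh_exp act_psh_exp
  proof (intro conjI allI restrict_extensional natI)
    fix r x assume "x \<in> cells (psh_prod (yoneda D p) K) r"
    then show "(\<lambda>(v, z)\<in>arr D r p \<times> cells K r. \<theta> r (cmp D u v, z)) x \<in> cells X r"
      using exp_app(1)[OF \<theta>] cat(2)[OF _ u] by auto
  next
    fix r t a x assume "a \<in> arr D r t" "x \<in> cells (psh_prod (yoneda D p) K) t"
    then show "(\<lambda>(v, z)\<in>arr D r p \<times> cells K r. \<theta> r (cmp D u v, z)) (act (psh_prod (yoneda D p) K) r t a x)
      = act X r t a ((\<lambda>(v, z)\<in>arr D t p \<times> cells K t. \<theta> t (cmp D u v, z)) x)"
      using exp_app(2)[OF \<theta>] cat(2)[OF _ u] cat(5)[OF _ _ u] pshD(1)[OF K] cat(2)[of a r t] by auto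
  qed
  show "act (psh_exp D X K) p p (idn D p) \<theta> = \<theta>" if "\<theta> \<in> cells (psh_exp D X K) p" for p \<theta>
    using *[OF cat(1) that] that by (rule exp_eqI) (simp add: act_psh_exp cat(4))
  show "act (psh_exp D X K) p r (cmp D v u) \<theta> = act (psh_exp D X K) p q u (act (psh_exp D X K) q r v \<theta>)"
    if "u \<in> arr D p q" "v \<in> arr D q r" "\<theta> \<in> cells (psh_exp D X K) r" for p q r u v \<theta>
    using *[OF cat(2)[OF that(1,2)] that(3)] *[OF that(1) *[OF that(2,3)]]
    by (rule exp_eqI) (use that in \<open>simp add: act_psh_exp cat(2) cat(5)[OF _ that(1,2)]\<close>)
qed

lemma curry_nat_cells:
  assumes D: "small_category D" and Y: "presheaf D Y" and K: "presheaf D K"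
    and \<phi>: "nat_trans D (psh_prod Y K) F \<phi>" and y: "y \<in> cells Y q"
  shows "curry_nat D Y K \<phi> q y \<in> cells (psh_exp D F K) q"
  unfolding cells_psh_exp
proof (intro conjI allI natI)
  show "curry_nat D Y K \<phi> q y r \<in> extensional (arr D r q \<times> cells K r)" for r
    by (simp add: curry_nat_def)
  fix r x assume "x \<in> cells (psh_prod (yoneda D q) K) r"
  then show "curry_nat D Y K \<phi> q y r x \<in> cells F r"
    using natD(1)[OF \<phi>, of _ r] pshD(1)[OF Y _ y] by (cases x) simp
next
  fix r t a x assume a: "a \<in> arr D r t" and "x \<in> cells (psh_prod (yoneda D q) K) t"
  then obtain v z where x: "x = (v, z)" "v \<in> arr D t q" "z \<in> cells K t" by (cases x) simp
  show "curry_nat D Y K \<phi> q y r (act (psh_prod (yoneda D q) K) r t a x) = act F r t a (curry_nat D Y K \<phi> q y t x)"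
    using natD(2)[OF \<phi> a, of "(act Y t q v y, z)"] pshD(1)[OF Y x(2) y] x
      pshD(3)[OF Y a x(2) y] pshD(1)[OF K a x(3)] catD(2)[OF D a x(2)]
    by simp
qed

lemma curry_nat_nat:
  assumes D: "small_category D" and Y: "presheaf D Y" and K: "presheaf D K"
    and \<phi>: "nat_trans D (psh_prod Y K) F \<phi>"
  shows "nat_trans D Y (psh_exp D F K) (curry_nat D Y K \<phi>)"
proof (rule natI)
  note cells = curry_nat_cells[OF D Y K \<phi>]
  show "curry_nat D Y K \<phi> q y \<in> cells (psh_exp D F K) q" if "y \<in> cells Y q" for y q
    using cells[OF that] .
  fix p q u y assume u: "u \<in> arr D p q" and y: "y \<in> cells Y q"
  show "curry_nat D Y K \<phi> p (act Y p q u y) = act (psh_exp D F K) p q u (curry_nat D Y K \<phi> q y)"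
    using cells[OF pshD(1)[OF Y u y]] pshD(1)[OF presheaf_psh_exp[OF D K] u cells[OF y]]
    by (rule exp_eqI) (simp add: act_psh_exp catD(2)[OF D _ u] pshD(3)[OF Y _ u y])
qed

lemma uncurry_nat:
  assumes D: "small_category D" and K: "presheaf D K" and Y: "presheaf D Y"
    and \<psi>: "nat_trans D Y (psh_exp D F K) \<psi>"
  shows "nat_trans D (psh_prod Y K) F (\<lambda>q (y, z). \<psi> q y q (idn D q, z))"
proof (rule natI)
  note cat = catD[OF D]
  fix q x assume "x \<in> cells (psh_prod Y K) q"
  then show "(\<lambda>(y, z). \<psi> q y q (idn D q, z)) x \<in> cells F q"
    using exp_app(1)[OF natD(1)[OF \<psi>] cat(1)] by auto
next
  note cat = catD[OF D]
  fix p q u x assume u: "u \<in> arr D p q" and "x \<in> cells (psh_prod Y K) q"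
  then obtain y z where x: "x = (y, z)" "y \<in> cells Y q" "z \<in> cells K q" by (cases x) simp
  have "\<psi> p (act Y p q u y) p (idn D p, act K p q u z) = \<psi> q y p (cmp D u (idn D p), act K p q u z)"
    using natD(2)[OF \<psi> u x(2)] cat(1)[of p] pshD(1)[OF K u x(3)] by (simp add: act_psh_exp)
  also have "\<dots> = \<psi> q y p (cmp D (idn D q) u, act K p q u z)" by (simp add: cat(3,4)[OF u])
  also have "\<dots> = act F p q u (\<psi> q y q (idn D q, z))"
    by (rule exp_app(2)[OF natD(1)[OF \<psi> x(2)] cat(1) x(3) u])
  finally show "(\<lambda>(y, z). \<psi> p y p (idn D p, z)) (act (psh_prod Y K) p q u x) = act F p q u ((\<lambda>(y, z). \<psi> q y q (idn D q, z)) x)"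
    by (simp add: x)
qed

lemma presheaf_sub: "presheaf D Z \<Longrightarrow> subpresheaf D Z S \<Longrightarrow> presheaf D (Z\<lparr>cells := S\<rparr>)"
  unfolding presheaf_def subpresheaf_def by (auto simp: subset_iff)

lemma cells_pullback [simp]:
  "(x, y) \<in> cells (psh_pullback X Y f g) p \<longleftrightarrow> x \<in> cells X p \<and> y \<in> cells Y p \<and> f p x = g p y"
  and act_pullback [simp]: "act (psh_pullback X Y f g) p q u (x, y) = (act X p q u x, act Y p q u y)"
  by (simp_all add: psh_pullback_def psh_prod_def)

lemma presheaf_pullback:
  assumes "presheaf D X" "presheaf D Y" "nat_trans D X Z f" "nat_trans D Y Z g"
  shows "presheaf D (psh_pullback X Y f g)"
  using pshD[OF assms(1)] pshD[OF assms(2)] natD[OF assms(3)] natD[OF assms(4)]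
  by (intro pshI) auto

section \<open>Exponentials with a global point of the exponent\<close>

locale pointed_exponent =
  fixes D :: "('o, 'm) small_cat" and K :: "('o, 'm, 'k) psh" and e :: "'o \<Rightarrow> 'k"
  assumes D: "small_category D" and K: "presheaf D K"
    and e: "e q \<in> cells K q" and e_act: "u \<in> arr D p q \<Longrightarrow> act K p q u (e q) = e p"
begin

lemma ev_nat: "nat_trans D (psh_exp D X K) X (exp_ev D e)"
proof (rule natI)
  note cat = catD[OF D]
  show "exp_ev D e q \<theta> \<in> cells X q" if "\<theta> \<in> cells (psh_exp D X K) q" for q \<theta>
    unfolding exp_ev_def using exp_app(1)[OF that cat(1) e] .
  show "exp_ev D e p (act (psh_exp D X K) p q u \<theta>) = act X p q u (exp_ev D e q \<theta>)"
    if "u \<in> arr D p q" "\<theta> \<in> cells (psh_exp D X K) q" for p q u \<theta>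
    using exp_app(2)[OF that(2) cat(1) e that(1)] that(1)
    by (simp add: exp_ev_def act_psh_exp cat e e_act)
qed

lemma post_cells:
  assumes \<rho>: "nat_trans D F X \<rho>" and \<theta>: "\<theta> \<in> cells (psh_exp D F K) q"
  shows "exp_post D K \<rho> q \<theta> \<in> cells (psh_exp D X K) q"
  unfolding cells_psh_exp
proof (intro conjI allI natI)
  note cat = catD[OF D]
  show "exp_post D K \<rho> q \<theta> r \<in> extensional (arr D r q \<times> cells K r)" for r
    by (simp add: exp_post_def)
  fix r x assume "x \<in> cells (psh_prod (yoneda D q) K) r"
  then show "exp_post D K \<rho> q \<theta> r x \<in> cells X r"
    using natD(1)[OF \<rho> exp_app(1)[OF \<theta>]] by (cases x) (simp add: exp_post_def)
next
  note cat = catD[OF D]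
  fix r t a x assume a: "a \<in> arr D r t" and "x \<in> cells (psh_prod (yoneda D q) K) t"
  then obtain v z where x: "x = (v, z)" "v \<in> arr D t q" "z \<in> cells K t" by (cases x) simp
  show "exp_post D K \<rho> q \<theta> r (act (psh_prod (yoneda D q) K) r t a x) = act X r t a (exp_post D K \<rho> q \<theta> t x)"
    using exp_app(2)[OF \<theta> x(2,3) a] natD(2)[OF \<rho> a exp_app(1)[OF \<theta> x(2,3)]] x(2,3)
      cat(2)[OF a x(2)] pshD(1)[OF K a x(3)]
    by (simp add: exp_post_def x(1))
qed

lemma post_app [simp]:
  "v \<in> arr D r q \<Longrightarrow> z \<in> cells K r \<Longrightarrow> exp_post D K \<rho> q \<theta> r (v, z) = \<rho> r (\<theta> r (v, z))"
  by (simp add: exp_post_def)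

text \<open>Transposition: a square against the map from F^K to the pullback of X^K and F amounts to
  a square for \<rho> on Z \<times> K, prescribed on S \<times> K by \<open>u\<close> and on Z
  \<times> {e} by the second component of \<open>v\<close>.\<close>

lemma lifts_exp:
  assumes F: "presheaf D F" and X: "presheaf D X" and \<rho>: "nat_trans D F X \<rho>"
    and Z: "presheaf D Z" and S: "subpresheaf D Z S"
    and L: "lifts D F X \<rho> (psh_prod Z K) (pp Z S K (\<lambda>q. {e q}))"
  shows "lifts D (psh_exp D F K) (psh_pullback (psh_exp D X K) F (exp_ev D e) \<rho>)
    (\<lambda>q \<theta>. (exp_post D K \<rho> q \<theta>, exp_ev D e q \<theta>)) Z S"
    (is "lifts D ?P ?Q ?R Z S")
proof (rule liftsI)
  note cat = catD[OF D]
  note Z1 = pshD[OF Z]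
  fix u v assume u: "nat_trans D (Z\<lparr>cells := S\<rparr>) ?P u" and v: "nat_trans D Z ?Q v"
    and uv: "\<And>p z. z \<in> S p \<Longrightarrow> (exp_post D K \<rho> p (u p z), exp_ev D e p (u p z)) = v p z"
  have uc: "u p z \<in> cells ?P p" if "z \<in> S p" for p z using natD(1)[OF u, of z p] that by simp
  have ua: "u p (act Z p q a z) = act ?P p q a (u q z)" if "a \<in> arr D p q" "z \<in> S q" for p q a z
    using natD(2)[OF u that(1), of z] that(2) by simp
  have vc: "fst (v p z) \<in> cells (psh_exp D X K) p" "snd (v p z) \<in> cells F p"
    "exp_ev D e p (fst (v p z)) = \<rho> p (snd (v p z))" if "z \<in> cells Z p" for p z
    using natD(1)[OF v that] by (cases "v p z"; simp)+
  have va: "fst (v p (act Z p q a z)) = act (psh_exp D X K) p q a (fst (v q z))"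
    "snd (v p (act Z p q a z)) = act F p q a (snd (v q z))" if "a \<in> arr D p q" "z \<in> cells Z q" for p q a z
    using natD(2)[OF v that] by (cases "v q z"; simp)+
  \<comment> \<open>The second branch ignores \<open>k\<close> because, outside \<open>S\<close>,
    only k = e occurs. On S \<times> {e} the two prescriptions agree by \<open>uv\<close>
    (\<open>u'e\<close>).\<close>
  define u' where "u' = (\<lambda>q (z, k). if z \<in> S q then u q z q (idn D q, k) else snd (v q z))"
  have u'e: "u' q (z, e q) = snd (v q z)" for q z
    using uv[of z q] by (auto simp: u'_def exp_ev_def prod_eq_iff)
  have su: "nat_trans D (psh_prod (Z\<lparr>cells := S\<rparr>) K) F (\<lambda>q (y, z). u q y q (idn D q, z))"
    by (rule uncurry_nat[OF D K presheaf_sub[OF Z S] u])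
  have 1: "nat_trans D ((psh_prod Z K)\<lparr>cells := pp Z S K (\<lambda>q. {e q})\<rparr>) F u'"
  proof (rule natI)
    fix p x assume "x \<in> cells ((psh_prod Z K)\<lparr>cells := pp Z S K (\<lambda>q. {e q})\<rparr>) p"
    then show "u' p x \<in> cells F p"
      using exp_app(1)[OF uc cat(1)] vc(2) by (cases x) (auto simp: u'_def)
  next
    fix p q a x assume a: "a \<in> arr D p q" and "x \<in> cells ((psh_prod Z K)\<lparr>cells := pp Z S K (\<lambda>q. {e q})\<rparr>) q"
    then obtain z k where x: "x = (z, k)" "z \<in> cells Z q" "k \<in> cells K q" "z \<in> S q \<or> k = e q" by (cases x) auto
    from x(4) have "u' p (act Z p q a z, act K p q a k) = act F p q a (u' q (z, k))"
    proof
      assume z: "z \<in> S q"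
      then show ?thesis
        using natD(2)[OF su a, of "(z, k)"] x(3) subpresheafD(2)[OF S a z] by (simp add: u'_def)
    next
      assume "k = e q"
      then show ?thesis using va(2)[OF a x(2)] by (simp add: e_act[OF a] u'e)
    qed
    then show "u' p (act ((psh_prod Z K)\<lparr>cells := pp Z S K (\<lambda>q. {e q})\<rparr>) p q a x) = act F p q a (u' q x)"
      by (simp add: x(1))
  qed
  have vfst: "nat_trans D Z (psh_exp D X K) (\<lambda>p z. fst (v p z))"
    using vc va by (intro natI) auto
  have 2: "nat_trans D (psh_prod Z K) X (\<lambda>q (z, k). fst (v q z) q (idn D q, k))"
    by (rule uncurry_nat[OF D K Z vfst])
  have 3: "\<forall>p. \<forall>x\<in>pp Z S K (\<lambda>q. {e q}) p. \<rho> p (u' p x) = (\<lambda>q (z, k). fst (v q z) q (idn D q, k)) p x"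
  proof (intro allI ballI)
    fix p x assume "x \<in> pp Z S K (\<lambda>q. {e q}) p"
    then obtain z k where x: "x = (z, k)" "z \<in> cells Z p" "k \<in> cells K p" "z \<in> S p \<or> k = e p" by (cases x) auto
    from x(4) have "\<rho> p (u' p (z, k)) = fst (v p z) p (idn D p, k)"
    proof
      assume z: "z \<in> S p"
      have "fst (v p z) = exp_post D K \<rho> p (u p z)" using uv[OF z] by (metis fst_conv)
      then show ?thesis using z x(3) cat(1)[of p] by (simp add: u'_def)
    next
      assume "k = e p"
      then show ?thesis using u'e vc(3)[OF x(2)] by (simp add: exp_ev_def)
    qed
    then show "\<rho> p (u' p x) = (\<lambda>q (z, k). fst (v q z) q (idn D q, k)) p x" by (simp add: x(1))
  qed
  obtain w where w: "nat_trans D (psh_prod Z K) F w"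
    "\<And>p x. x \<in> pp Z S K (\<lambda>q. {e q}) p \<Longrightarrow> w p x = u' p x"
    "\<And>p x. x \<in> cells (psh_prod Z K) p \<Longrightarrow> \<rho> p (w p x) = (\<lambda>q (z, k). fst (v q z) q (idn D q, k)) p x"
    by (rule liftsE[OF L 1 2 3]) (rule that)
  note wcells = curry_nat_cells[OF D Z K w(1)]
  have "curry_nat D Z K w p z = u p z" if z: "z \<in> S p" for p z
    using wcells[OF subpresheafD(1)[OF S z]] uc[OF z]
  proof (rule exp_eqI)
    fix r a k assume a: "a \<in> arr D r p" and k: "k \<in> cells K r"
    have "curry_nat D Z K w p z r (a, k) = u' r (act Z r p a z, k)"
      using w(2)[of "(act Z r p a z, k)" r] a k Z1(1)[OF a subpresheafD(1)[OF S z]] subpresheafD(2)[OF S a z] by simp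
    also have "\<dots> = act ?P r p a (u p z) r (idn D r, k)"
      using subpresheafD(2)[OF S a z] ua[OF a z] by (simp add: u'_def)
    also have "\<dots> = u p z r (a, k)" using k cat(1)[of r] cat(3)[OF a] by (simp add: act_psh_exp)
    finally show "curry_nat D Z K w p z r (a, k) = u p z r (a, k)" .
  qed
  moreover have "?R p (curry_nat D Z K w p z) = v p z" if z: "z \<in> cells Z p" for p z
  proof (rule prod_eqI)
    have "exp_post D K \<rho> p (curry_nat D Z K w p z) = fst (v p z)"
      using post_cells[OF \<rho> wcells[OF z]] vc(1)[OF z]
    proof (rule exp_eqI)
      fix r a k assume a: "a \<in> arr D r p" and k: "k \<in> cells K r"
      have "exp_post D K \<rho> p (curry_nat D Z K w p z) r (a, k) = fst (v r (act Z r p a z)) r (idn D r, k)"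
        using w(3)[of "(act Z r p a z, k)" r] a k Z1(1)[OF a z] by simp
      also have "\<dots> = fst (v p z) r (a, k)"
        using va(1)[OF a z] k cat(1)[of r] cat(3)[OF a] by (simp add: act_psh_exp)
      finally show "exp_post D K \<rho> p (curry_nat D Z K w p z) r (a, k) = fst (v p z) r (a, k)" .
    qed
    then show "fst (?R p (curry_nat D Z K w p z)) = fst (v p z)" by simp
    show "snd (?R p (curry_nat D Z K w p z)) = snd (v p z)"
      using w(2)[of "(z, e p)" p] z e[of p] cat(1)[of p] by (simp add: exp_ev_def Z1(2) u'e)
  qed
  ultimately show "\<exists>w. nat_trans D Z ?P w \<and> (\<forall>p. \<forall>z\<in>S p. w p z = u p z) \<and> (\<forall>p. \<forall>z\<in>cells Z p. ?R p (w p z) = v p z)"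
    using curry_nat_nat[OF D Z K w(1)] by blast
qed

text \<open>The same transposition read backwards. It returns lifts obtained for the arrow map to
  \<rho>, on which all cell attachments take place.\<close>

lemma lifts_exp_converse:
  assumes F: "presheaf D F" and X: "presheaf D X" and \<rho>: "nat_trans D F X \<rho>"
    and Z: "presheaf D Z" and S: "subpresheaf D Z S"
    and L: "lifts D (psh_exp D F K) (psh_pullback (psh_exp D X K) F (exp_ev D e) \<rho>)
      (\<lambda>q \<theta>. (exp_post D K \<rho> q \<theta>, exp_ev D e q \<theta>)) Z S" (is "lifts D ?P ?Q ?R Z S")
  shows "lifts D F X \<rho> (psh_prod Z K) (pp Z S K (\<lambda>q. {e q}))"
proof (rule liftsI)
  note cat = catD[OF D]
  note Z1 = pshD[OF Z]
  let ?S = "pp Z S K (\<lambda>q. {e q})"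
  fix u v assume u: "nat_trans D ((psh_prod Z K)\<lparr>cells := ?S\<rparr>) F u"
    and v: "nat_trans D (psh_prod Z K) X v"
    and uv: "\<And>p z. z \<in> ?S p \<Longrightarrow> \<rho> p (u p z) = v p z"
  let ?ZS = "Z\<lparr>cells := S\<rparr>"
  have ZS: "presheaf D ?ZS" by (rule presheaf_sub[OF Z S])
  have us: "nat_trans D (psh_prod ?ZS K) F u"
    using natD[OF u] subpresheafD(1)[OF S] by (intro natI) auto
  have 1: "nat_trans D ?ZS ?P (curry_nat D Z K u)"
    using curry_nat_nat[OF D ZS K us] by (simp add: curry_nat_def[abs_def])
  have ue: "nat_trans D Z F (\<lambda>p z. u p (z, e p))"
  proof (rule natI)
    show "u p (z, e p) \<in> cells F p" if "z \<in> cells Z p" for p z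
      using natD(1)[OF u, of "(z, e p)" p] that e by simp
    show "u p (act Z p q a z, e p) = act F p q a (u q (z, e q))" if "a \<in> arr D p q" "z \<in> cells Z q" for p q a z
      using natD(2)[OF u that(1), of "(z, e q)"] that(2) e by (simp add: e_act[OF that(1)])
  qed
  note vcells = curry_nat_cells[OF D Z K v]
  have 2: "nat_trans D Z ?Q (\<lambda>p z. (curry_nat D Z K v p z, u p (z, e p)))"
  proof (rule natI)
    show "(curry_nat D Z K v p z, u p (z, e p)) \<in> cells ?Q p" if z: "z \<in> cells Z p" for p z
      using vcells[OF z] natD(1)[OF ue z] uv[of "(z, e p)" p] z e[of p] cat(1)[of p]
      by (simp add: exp_ev_def Z1(2))
  qed (use natD(2)[OF curry_nat_nat[OF D Z K v]] natD(2)[OF ue] in simp)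
  have 3: "\<forall>p. \<forall>z\<in>S p. ?R p (curry_nat D Z K u p z) = (curry_nat D Z K v p z, u p (z, e p))"
  proof (intro allI ballI prod_eqI)
    fix p z assume z: "z \<in> S p"
    note zZ = subpresheafD(1)[OF S z]
    have "curry_nat D Z K u p z \<in> cells ?P p" using natD(1)[OF 1, of z p] z by simp
    from post_cells[OF \<rho> this] vcells[OF zZ]
    have "exp_post D K \<rho> p (curry_nat D Z K u p z) = curry_nat D Z K v p z"
    proof (rule exp_eqI)
      fix r a k assume a: "a \<in> arr D r p" and k: "k \<in> cells K r"
      show "exp_post D K \<rho> p (curry_nat D Z K u p z) r (a, k) = curry_nat D Z K v p z r (a, k)"
        using uv[of "(act Z r p a z, k)" r] a k Z1(1)[OF a zZ] subpresheafD(2)[OF S a z] by simp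
    qed
    then show "fst (?R p (curry_nat D Z K u p z)) = fst (curry_nat D Z K v p z, u p (z, e p))" by simp
    show "snd (?R p (curry_nat D Z K u p z)) = snd (curry_nat D Z K v p z, u p (z, e p))"
      using cat(1)[of p] e[of p] by (simp add: exp_ev_def Z1(2)[OF zZ])
  qed
  obtain w where w: "nat_trans D Z ?P w" "\<And>p z. z \<in> S p \<Longrightarrow> w p z = curry_nat D Z K u p z"
    "\<And>p z. z \<in> cells Z p \<Longrightarrow> ?R p (w p z) = (curry_nat D Z K v p z, u p (z, e p))"
    by (rule liftsE[where \<rho>="?R" and u="curry_nat D Z K u" and v="\<lambda>p z. (curry_nat D Z K v p z, u p (z, e p))",
        OF L 1 2 3]) (rule that)
  let ?w = "\<lambda>q (z, k). w q z q (idn D q, k)"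
  have "?w p x = u p x" if xS: "x \<in> ?S p" for p x
  proof -
    obtain z k where x: "x = (z, k)" "z \<in> cells Z p" "k \<in> cells K p" "z \<in> S p \<or> k = e p"
      using xS by (cases x) auto
    from x(4) show ?thesis
    proof
      assume "z \<in> S p"
      then show ?thesis using w(2) x cat(1)[of p] by (simp add: Z1(2))
    next
      assume "k = e p"
      then show ?thesis using w(3)[OF x(2)] x by (simp add: exp_ev_def)
    qed
  qed
  moreover have "\<rho> p (?w p x) = v p x" if xZ: "x \<in> cells (psh_prod Z K) p" for p x
  proof -
    obtain z k where x: "x = (z, k)" "z \<in> cells Z p" "k \<in> cells K p" using xZ by (cases x) auto
    have "\<rho> p (w p z p (idn D p, k)) = exp_post D K \<rho> p (w p z) p (idn D p, k)"
      using cat(1)[of p] x(3) by simp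
    also have "exp_post D K \<rho> p (w p z) = curry_nat D Z K v p z" using w(3)[OF x(2)] by simp
    finally show ?thesis using x cat(1)[of p] by (simp add: Z1(2))
  qed
  ultimately show "\<exists>w. nat_trans D (psh_prod Z K) F w \<and> (\<forall>p. \<forall>z\<in>?S p. w p z = u p z) \<and>
      (\<forall>p. \<forall>z\<in>cells (psh_prod Z K) p. \<rho> p (w p z) = v p z)"
    using uncurry_nat[OF D K Z w(1)] by (intro exI[of _ ?w]) blast
qed

end

section \<open>Bisimplicial sets\<close>

abbreviation "box n k \<equiv> psh_prod (discrete \<Delta>[n]) (constant_obj \<Delta>[k])"
abbreviation "interval \<equiv> discrete \<Delta>[1]"

lemma cells_discrete [simp]: "cells (discrete K) q = cells K (fst q)"
  and act_discrete [simp]: "act (discrete K) p q u x = act K (fst p) (fst q) (fst u) x"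
  and cells_constant_obj [simp]: "cells (constant_obj K) q = cells K (snd q)"
  and act_constant_obj [simp]: "act (constant_obj K) p q u x = act K (snd p) (snd q) (snd u) x"
  and cells_level [simp]: "cells (level X n) k = cells X (n, k)"
  and act_level [simp]: "act (level X n) k l \<beta> x = act X (n, k) (n, l) (sidn n, \<beta>) x"
  by (simp_all add: discrete_def constant_obj_def level_def)

lemma bisset_discrete: "sset K \<Longrightarrow> bisset (discrete K)"
  unfolding presheaf_def by (auto simp: bisimplex_simps)

lemma bisset_constant: "sset K \<Longrightarrow> bisset (constant_obj K)"
  unfolding presheaf_def by (auto simp: bisimplex_simps)

lemma sub_discrete:
  "subsset L K \<Longrightarrow> subbisset (discrete L) (\<lambda>q. K (fst q))"
  unfolding subpresheaf_def by (auto simp: bisimplex_simps)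

lemma sub_constant_obj:
  "subsset L K \<Longrightarrow> subbisset (constant_obj L) (\<lambda>q. K (snd q))"
  unfolding subpresheaf_def by (auto simp: bisimplex_simps)

lemma sub_empty: "subpresheaf D Z (\<lambda>_. {})"
  by (simp add: subpresheaf_def)

lemma simplex_idn [simp]: "sidn n \<in> smor n n"
  by (rule catD(1)[OF simplex_category])

lemma simplex_cmp_idn [simp]:
  "u \<in> smor p q \<Longrightarrow> scmp u (sidn p) = u"
  "u \<in> smor p q \<Longrightarrow> scmp (sidn q) u = u"
  by (rule catD(3,4)[OF simplex_category], assumption)+

lemma simplex_cmp_idn_idn [simp]:
  "scmp (sidn n) (sidn n) = sidn n"
  by (rule simplex_cmp_idn(1)[OF simplex_idn])

lemma sset_level: "bisset X \<Longrightarrow> sset (level X n)"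
proof (rule pshI)
  assume X: "bisset X"
  note X1 = pshD[OF X]
  show "act (level X n) p q u x \<in> cells (level X n) p"
    if "u \<in> smor p q" "x \<in> cells (level X n) q" for p q u x
    using X1(1)[of "(sidn n, u)" "(n, p)" "(n, q)"] that by (simp add: bisimplex_simps)
  show "act (level X n) p p (sidn p) x = x" if "x \<in> cells (level X n) p" for p x
    using X1(2)[of x "(n, p)"] that by (simp add: bisimplex_simps)
  show "act (level X n) p r (scmp v u) x = act (level X n) p q u (act (level X n) q r v x)"
    if "u \<in> smor p q" "v \<in> smor q r" "x \<in> cells (level X n) r" for p q r u v x
    using X1(3)[of "(sidn n, u)" "(n, p)" "(n, q)" "(sidn n, v)" "(n, r)" x] that
    by (simp add: bisimplex_simps)
qed

text \<open>Maps \<open>N \<rightarrow> X\<^sub>n\<close> of simplicial sets correspond to maps \<open>\<Delta>[n] \<times> N \<rightarrow> X\<close> of bisimplicial sets.\<close>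

definition level_extend ::
  "'a bisset \<Rightarrow> nat \<Rightarrow> (nat \<Rightarrow> 'k \<Rightarrow> 'a) \<Rightarrow> nat \<times> nat \<Rightarrow> nat list \<times> 'k \<Rightarrow> 'a" where
  "level_extend X n f = (\<lambda>q (x, y). act X q (n, snd q) (x, sidn (snd q)) (f (snd q) y))"

lemma level_extend_nat:
  assumes X: "bisset X" and f: "smap N (level X n) f"
  shows "bimap (psh_prod (discrete \<Delta>[n]) (constant_obj N)) X (level_extend X n f)"
proof (rule natI)
  fix q x assume "x \<in> cells (psh_prod (discrete \<Delta>[n]) (constant_obj N)) q"
  then show "level_extend X n f q x \<in> cells X q"
    using natD(1)[OF f, of _ "snd q"] pshD(1)[OF X, of "(fst x, sidn (snd q))" q "(n, snd q)"]
    by (cases x) (simp add: level_extend_def bisimplex_simps)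
next
  fix p q u x assume u: "u \<in> bimor p q" and "x \<in> cells (psh_prod (discrete \<Delta>[n]) (constant_obj N)) q"
  then obtain z y where x: "x = (z, y)" "z \<in> smor (fst q) n" "y \<in> cells N (snd q)" by (cases x) auto
  obtain a b where ab: "u = (a, b)" "a \<in> smor (fst p) (fst q)" "b \<in> smor (snd p) (snd q)"
    using u by (cases u) (auto simp: bisimplex_simps)
  have fy: "f (snd q) y \<in> cells X (n, snd q)" using natD(1)[OF f x(3)] by simp
  have za: "scmp z a \<in> smor (fst p) n" by (rule scmp_smor[OF ab(2) x(2)])
  have "level_extend X n f p (act (psh_prod (discrete \<Delta>[n]) (constant_obj N)) p q u x)
      = act X p (n, snd p) (scmp z a, sidn (snd p))
          (act X (n, snd p) (n, snd q) (sidn n, b) (f (snd q) y))"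
    using natD(2)[OF f ab(3) x(3)] by (simp add: level_extend_def x(1) ab(1))
  also have "\<dots> = act X p (n, snd q) (scmp z a, b) (f (snd q) y)"
    using pshD(3)[OF X _ _ fy, of "(scmp z a, sidn (snd p))" p "(n, snd p)" "(sidn n, b)"]
      za ab(3) by (simp add: bisimplex_simps)
  also have "\<dots> = act X p q u (level_extend X n f q x)"
    using pshD(3)[OF X u _ fy, of "(z, sidn (snd q))"] x(1,2) ab
    by (simp add: bisimplex_simps level_extend_def)
  finally show "level_extend X n f p (act (psh_prod (discrete \<Delta>[n]) (constant_obj N)) p q u x)
    = act X p q u (level_extend X n f q x)" .
qed

lemma level_restrict_nat:
  assumes \<phi>: "bimap (psh_prod (discrete \<Delta>[n]) (constant_obj N)) X \<phi>"
  shows "smap N (level X n) (\<lambda>b y. \<phi> (n, b) (sidn n, y))"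
proof (rule natI)
  show "\<phi> (n, b) (sidn n, y) \<in> cells (level X n) b" if "y \<in> cells N b" for b y
    using natD(1)[OF \<phi>, of "(sidn n, y)" "(n, b)"] that by simp
  show "\<phi> (n, b) (sidn n, act N b b' u y) = act (level X n) b b' u (\<phi> (n, b') (sidn n, y))"
    if "u \<in> smor b b'" "y \<in> cells N b'" for b b' u y
    using natD(2)[OF \<phi>, of "(sidn n, u)" "(n, b)" "(n, b')" "(sidn n, y)"] that
    by (simp add: bisimplex_simps)
qed

lemma nat_trans_restrict_cong:
  assumes "\<And>p. cells Z p = cells Z' p" "\<And>p q u x. u \<in> arr D p q \<Longrightarrow> x \<in> cells Z q \<Longrightarrow> act Z p q u x = act Z' p q u x"
  shows "nat_trans D Z X f \<longleftrightarrow> nat_trans D Z' X f"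
  using assms unfolding nat_trans_def by simp

text \<open>Transposition along the correspondence realised by \<open>level_extend\<close> and
  evaluation at the identity of [n]. The empty subobject in the first factor leaves \<Delta>[n]
  times the inclusion of \<open>M\<close> into \<open>N\<close>.\<close>

lemma lifts_level:
  assumes G: "bisset G" and H: "bisset H" and p: "bimap G H p" and N: "sset N" and M: "subsset N M"
  shows "bilifts G H p (psh_prod (discrete \<Delta>[n]) (constant_obj N))
      (pp (discrete \<Delta>[n]) (\<lambda>_. {}) (constant_obj N) (\<lambda>q. M (snd q)))
    \<longleftrightarrow> slifts (level G n) (level H n) (\<lambda>k. p (n, k)) N M"
    (is "lifts _ G H p ?Z ?S \<longleftrightarrow> _")
proof -
  let ?I = "sidn"
  have S: "bimap (?Z\<lparr>cells := ?S\<rparr>) G u \<longleftrightarrow> bimap (psh_prod (discrete \<Delta>[n]) (constant_obj (N\<lparr>cells := M\<rparr>))) G u" for u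
    using subpresheafD(1)[OF M] by (intro nat_trans_restrict_cong) auto
  have S_mem: "x \<in> ?S q \<longleftrightarrow> fst x \<in> smor (fst q) n \<and> snd x \<in> M (snd q)" for x q
    using subpresheafD(1)[OF M] by (cases x) auto
  \<comment> \<open>Naturality: a map out of the product is determined by its values at the identity
    of [n].\<close>
  have recover: "act X q (n, snd q) (x, ?I (snd q)) (\<phi> (n, snd q) (?I n, y)) = \<phi> q (x, y)"
    if "bimap (psh_prod (discrete \<Delta>[n]) (constant_obj N')) X \<phi>" "x \<in> smor (fst q) n" "y \<in> cells N' (snd q)"
      "act N' (snd q) (snd q) (?I (snd q)) y = y" for X :: "'x bisset" and \<phi> q x y N'
    using natD(2)[OF that(1), of "(x, ?I (snd q))" q "(n, snd q)" "(?I n, y)"] that(2-)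
    by (simp add: bisimplex_simps)
  have act_id: "act X (n, k) (n, k) (?I n, ?I k) x = x" if "bisset X" "x \<in> cells X (n, k)" for X :: "'x bisset" and k x
    using pshD(2)[OF that] by (simp add: bisimplex_simps)
  show ?thesis
  proof
    assume L: "bilifts G H p ?Z ?S"
    show "slifts (level G n) (level H n) (\<lambda>k. p (n, k)) N M"
    proof (rule liftsI)
      fix u v assume u: "smap (N\<lparr>cells := M\<rparr>) (level G n) u" and v: "smap N (level H n) v"
        and uv: "\<And>k z. z \<in> M k \<Longrightarrow> p (n, k) (u k z) = v k z"
      have uc: "u k z \<in> cells G (n, k)" if "z \<in> M k" for k z using natD(1)[OF u, of z k] that by simp
      have vc: "v k z \<in> cells H (n, k)" if "z \<in> cells N k" for k z using natD(1)[OF v, of z k] that by simp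
      have 1: "bimap (?Z\<lparr>cells := ?S\<rparr>) G (level_extend G n u)"
        unfolding S by (rule level_extend_nat[OF G u])
      have 2: "bimap ?Z H (level_extend H n v)" by (rule level_extend_nat[OF H v])
      have 3: "\<forall>q. \<forall>x\<in>?S q. p q (level_extend G n u q x) = level_extend H n v q x"
        using natD(2)[OF p _ uc] uv subpresheafD(1)[OF M] by (auto simp: level_extend_def bisimplex_simps)
      obtain w where w: "bimap ?Z G w" "\<And>q x. x \<in> ?S q \<Longrightarrow> w q x = level_extend G n u q x"
        "\<And>q x. x \<in> cells ?Z q \<Longrightarrow> p q (w q x) = level_extend H n v q x"
        by (rule liftsE[OF L 1 2 3]) (rule that)
      have "w (n, k) (?I n, z) = u k z" if "z \<in> M k" for k z
        using w(2)[of "(?I n, z)" "(n, k)"] that subpresheafD(1)[OF M that] act_id[OF G uc[OF that]]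
        by (simp add: level_extend_def)
      moreover have "p (n, k) (w (n, k) (?I n, z)) = v k z" if "z \<in> cells N k" for k z
        using w(3)[of "(?I n, z)" "(n, k)"] that act_id[OF H vc[OF that]]
        by (simp add: level_extend_def)
      ultimately show "\<exists>w. smap N (level G n) w \<and> (\<forall>k. \<forall>z\<in>M k. w k z = u k z) \<and> (\<forall>k. \<forall>z\<in>cells N k. p (n, k) (w k z) = v k z)"
        using level_restrict_nat[OF w(1)] by (intro exI[of _ "\<lambda>b y. w (n, b) (?I n, y)"]) blast
    qed
  next
    assume L: "slifts (level G n) (level H n) (\<lambda>k. p (n, k)) N M"
    show "bilifts G H p ?Z ?S"
    proof (rule liftsI)
      fix u v assume u: "bimap (?Z\<lparr>cells := ?S\<rparr>) G u" and v: "bimap ?Z H v"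
        and uv: "\<And>q z. z \<in> ?S q \<Longrightarrow> p q (u q z) = v q z"
      have u': "bimap (psh_prod (discrete \<Delta>[n]) (constant_obj (N\<lparr>cells := M\<rparr>))) G u" using u unfolding S .
      have 3: "\<forall>k. \<forall>z\<in>M k. p (n, k) (u (n, k) (?I n, z)) = v (n, k) (?I n, z)"
        using uv by (simp add: S_mem)
      obtain w where w: "smap N (level G n) w" "\<And>k z. z \<in> M k \<Longrightarrow> w k z = u (n, k) (?I n, z)"
        "\<And>k z. z \<in> cells N k \<Longrightarrow> p (n, k) (w k z) = v (n, k) (?I n, z)"
        by (rule liftsE[OF L level_restrict_nat[OF u'] level_restrict_nat[OF v] 3]) (rule that)
      have wc: "w k z \<in> cells G (n, k)" if "z \<in> cells N k" for k z using natD(1)[OF w(1) that] by simp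
      have "level_extend G n w q x = u q x" if "x \<in> ?S q" for q x
      proof -
        have x: "fst x \<in> smor (fst q) n" "snd x \<in> M (snd q)" using that by (simp_all add: S_mem)
        have "level_extend G n w q x = act G q (n, snd q) (fst x, ?I (snd q)) (u (n, snd q) (?I n, snd x))"
          using w(2)[OF x(2)] by (cases x) (simp add: level_extend_def)
        also have "\<dots> = u q x"
          using recover[OF u' x(1)] x(2) pshD(2)[OF N subpresheafD(1)[OF M x(2)]] by simp
        finally show ?thesis .
      qed
      moreover have "p q (level_extend G n w q x) = v q x" if "x \<in> cells ?Z q" for q x
      proof -
        have x: "fst x \<in> smor (fst q) n" "snd x \<in> cells N (snd q)" using that by auto
        have "p q (level_extend G n w q x) = act H q (n, snd q) (fst x, ?I (snd q)) (v (n, snd q) (?I n, snd x))"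
          using natD(2)[OF p _ wc[OF x(2)], of "(fst x, ?I (snd q))" q] x(1) w(3)[OF x(2)]
          by (cases x) (simp add: level_extend_def bisimplex_simps)
        also have "\<dots> = v q x"
          using recover[OF v x] pshD(2)[OF N x(2)] by simp
        finally show ?thesis .
      qed
      ultimately show "\<exists>w. bimap ?Z G w \<and> (\<forall>q. \<forall>z\<in>?S q. w q z = u q z) \<and> (\<forall>q. \<forall>z\<in>cells ?Z q. p q (w q z) = v q z)"
        using level_extend_nat[OF G w(1)] by blast
    qed
  qed
qed

text \<open>A simplex of the matching object is a map out of \<partial>\<Delta>[n], so a horn
  filling problem for the relative matching map is a lifting problem on the box. Its prescribed part
  joins \<partial>\<Delta>[n] \<times> \<Delta>[k] to \<Delta>[n] \<times> \<Lambda>[k,j].\<close>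

lemma reedy_box_lifts:
  assumes p: "reedy_fibration E B p" and k: "1 \<le> k" "j \<le> k"
  shows "bilifts E B p (box n k)
    (pp (discrete \<Delta>[n]) (\<lambda>q. nonsurj (fst q) n) (constant_obj \<Delta>[k]) (\<lambda>q. cells \<Lambda>[k,j] (snd q)))"
    (is "lifts _ E B p ?Z ?S")
proof (rule liftsI)
  let ?I = "sidn"
  have E: "bisset E" and B: "bisset B" and pn: "bimap E B p"
    and kan: "kan_fibration (level E n)
        (psh_pullback (level B n) (matching E n) (to_matching B n) (matching_map p n))
        (\<lambda>k x. (p (n, k) x, to_matching E n k x))" (is "kan_fibration _ ?Q ?R")
    using p by (simp_all add: reedy_fibration_def)
  fix u v assume u: "bimap (?Z\<lparr>cells := ?S\<rparr>) E u" and v: "bimap ?Z B v"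
    and uv: "\<And>q z. z \<in> ?S q \<Longrightarrow> p q (u q z) = v q z"
  have horn: "\<beta> \<in> smor m k" if "\<beta> \<in> cells \<Lambda>[k,j] m" for \<beta> m using that by (simp add: cells_horn)
  have ns: "z \<in> smor a n" if "z \<in> nonsurj a n" for z a using that by (simp add: nonsurj_def)
  have uc: "u q (x, y) \<in> cells E q" if "x \<in> smor (fst q) n" "y \<in> smor (snd q) k"
    "x \<in> nonsurj (fst q) n \<or> y \<in> cells \<Lambda>[k,j] (snd q)" for q x y
    using natD(1)[OF u, of "(x, y)" q] that by simp
  have ua: "act E q' q a (u q (x, y)) = u q' (scmp x (fst a), scmp y (snd a))"
    if "x \<in> smor (fst q) n" "y \<in> smor (snd q) k"
    "x \<in> nonsurj (fst q) n \<or> y \<in> cells \<Lambda>[k,j] (snd q)" "a \<in> bimor q' q" for q q' x y a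
    using natD(2)[OF u that(4), of "(x, y)"] that(1-3) by simp
  have vc: "v q (x, y) \<in> cells B q" if "x \<in> smor (fst q) n" "y \<in> smor (snd q) k" for q x y
    using natD(1)[OF v, of "(x, y)" q] that by simp
  have va: "act B q' q a (v q (x, y)) = v q' (scmp x (fst a), scmp y (snd a))"
    if "x \<in> smor (fst q) n" "y \<in> smor (snd q) k" "a \<in> bimor q' q" for q q' x y a
    using natD(2)[OF v that(3), of "(x, y)"] that(1,2) by simp
  \<comment> \<open>The part of \<open>u\<close> on \<partial>\<Delta>[n] \<times> \<Delta>[k],
    regarded as a map into the matching object. The restriction is forced by the extensionality
    built into \<open>Nat\<close>.\<close>
  define m0 where "m0 = (\<lambda>m \<beta> a. \<lambda>z\<in>nonsurj a n. u (a, m) (z, \<beta>))"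
  have m0: "m0 m \<beta> \<in> cells (matching E n) m" if \<beta>: "\<beta> \<in> smor m k" for m \<beta>
  proof -
    have "nat_trans simplex_cat \<partial>\<Delta>[n] (row E m) (m0 m \<beta>)"
    proof (rule natI)
      show "m0 m \<beta> a z \<in> cells (row E m) a" if "z \<in> cells \<partial>\<Delta>[n] a" for a z
        using uc[of z "(a, m)" \<beta>] that \<beta> ns[of z a] by (simp add: m0_def row_def)
      show "m0 m \<beta> a (act \<partial>\<Delta>[n] a b c z) = act (row E m) a b c (m0 m \<beta> b z)"
        if "c \<in> smor a b" "z \<in> cells \<partial>\<Delta>[n] b" for a b c z
        using ua[of z "(b, m)" \<beta> "(c, ?I m)" "(a, m)"] that \<beta> ns[of z b] nonsurj_cmp[OF that(1), of z n]
        by (simp add: m0_def row_def bisimplex_simps)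
    qed
    moreover have "m0 m \<beta> a \<in> extensional (cells \<partial>\<Delta>[n] a)" for a by (simp add: m0_def)
    ultimately show ?thesis by (simp add: matching_def Nat_def)
  qed
  have 1: "smap (\<Delta>[k]\<lparr>cells := cells \<Lambda>[k,j]\<rparr>) (level E n) (\<lambda>m \<beta>. u (n, m) (?I n, \<beta>))"
  proof (rule natI)
    show "u (n, m) (?I n, \<beta>) \<in> cells (level E n) m" if "\<beta> \<in> cells (\<Delta>[k]\<lparr>cells := cells \<Lambda>[k,j]\<rparr>) m" for m \<beta>
      using uc[of "?I n" "(n, m)" \<beta>] that horn by simp
    show "u (n, m) (?I n, act (\<Delta>[k]\<lparr>cells := cells \<Lambda>[k,j]\<rparr>) m m' a \<beta>) = act (level E n) m m' a (u (n, m') (?I n, \<beta>))"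
      if "a \<in> smor m m'" "\<beta> \<in> cells (\<Delta>[k]\<lparr>cells := cells \<Lambda>[k,j]\<rparr>) m'" for m m' a \<beta>
      using ua[of "?I n" "(n, m')" \<beta> "(?I n, a)" "(n, m)"] that horn by (simp add: bisimplex_simps)
  qed
  have 2: "smap \<Delta>[k] ?Q (\<lambda>m \<beta>. (v (n, m) (?I n, \<beta>), m0 m \<beta>))"
  proof (rule natI)
    fix m \<beta> assume \<beta>: "\<beta> \<in> cells \<Delta>[k] m"
    have "to_matching B n m (v (n, m) (?I n, \<beta>)) = matching_map p n m (m0 m \<beta>)"
    proof (rule ext)
      fix a
      have "act B (a, m) (n, m) (z, ?I m) (v (n, m) (?I n, \<beta>)) = p (a, m) (u (a, m) (z, \<beta>))" if z: "z \<in> nonsurj a n" for z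
        using va[of "?I n" "(n, m)" \<beta> "(z, ?I m)" "(a, m)"] uv[of "(z, \<beta>)" "(a, m)"] \<beta> z ns[OF z]
        by (simp add: bisimplex_simps)
      then show "to_matching B n m (v (n, m) (?I n, \<beta>)) a = matching_map p n m (m0 m \<beta>) a"
        unfolding to_matching_def matching_map_def by (intro restrict_ext) (simp add: m0_def)
    qed
    then show "(v (n, m) (?I n, \<beta>), m0 m \<beta>) \<in> cells ?Q m"
      using vc[of "?I n" "(n, m)" \<beta>] m0 \<beta> by simp
  next
    fix m m' a \<beta> assume a: "a \<in> smor m m'" and \<beta>: "\<beta> \<in> cells \<Delta>[k] m'"
    have "m0 m (scmp \<beta> a) = act (matching E n) m m' a (m0 m' \<beta>)"
    proof (rule ext)
      fix b
      show "m0 m (scmp \<beta> a) b = act (matching E n) m m' a (m0 m' \<beta>) b"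
        unfolding matching_def m0_def psh.simps cells_boundary
        using ua[of _ "(b, m')" \<beta> "(?I b, a)" "(b, m)"] a \<beta> ns by (intro restrict_ext) (simp add: bisimplex_simps)
    qed
    then show "(v (n, m) (?I n, act \<Delta>[k] m m' a \<beta>), m0 m (act \<Delta>[k] m m' a \<beta>))
        = act ?Q m m' a (v (n, m') (?I n, \<beta>), m0 m' \<beta>)"
      using va[of "?I n" "(n, m')" \<beta> "(?I n, a)" "(n, m)"] a \<beta> by (simp add: bisimplex_simps)
  qed
  have 3: "\<forall>m. \<forall>\<beta>\<in>cells \<Lambda>[k,j] m. ?R m (u (n, m) (?I n, \<beta>)) = (v (n, m) (?I n, \<beta>), m0 m \<beta>)"
  proof (intro allI ballI)
    fix m \<beta> assume \<beta>: "\<beta> \<in> cells \<Lambda>[k,j] m"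
    have "to_matching E n m (u (n, m) (?I n, \<beta>)) = m0 m \<beta>"
    proof (rule ext)
      fix a
      show "to_matching E n m (u (n, m) (?I n, \<beta>)) a = m0 m \<beta> a"
        unfolding to_matching_def m0_def cells_boundary
        using ua[of "?I n" "(n, m)" \<beta> "(_, ?I m)" "(a, m)"] \<beta> horn[OF \<beta>] ns
        by (intro restrict_ext) (simp add: bisimplex_simps)
    qed
    then show "?R m (u (n, m) (?I n, \<beta>)) = (v (n, m) (?I n, \<beta>), m0 m \<beta>)"
      using uv[of "(?I n, \<beta>)" "(n, m)"] \<beta> horn[OF \<beta>] by simp
  qed
  have L: "slifts (level E n) ?Q ?R \<Delta>[k] (cells \<Lambda>[k,j])"
    using kan k by (simp add: kan_fibration_iff)
  obtain w where w: "smap \<Delta>[k] (level E n) w" "\<And>m \<beta>. \<beta> \<in> cells \<Lambda>[k,j] m \<Longrightarrow> w m \<beta> = u (n, m) (?I n, \<beta>)"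
    "\<And>m \<beta>. \<beta> \<in> cells \<Delta>[k] m \<Longrightarrow> ?R m (w m \<beta>) = (v (n, m) (?I n, \<beta>), m0 m \<beta>)"
    by (rule liftsE[where \<rho>="?R" and u="\<lambda>m \<beta>. u (n, m) (?I n, \<beta>)" and v="\<lambda>m \<beta>. (v (n, m) (?I n, \<beta>), m0 m \<beta>)",
        OF L 1 2 3]) (rule that)
  have wc: "w m \<beta> \<in> cells E (n, m)" if "\<beta> \<in> smor m k" for m \<beta>
    using natD(1)[OF w(1), of \<beta> m] that by simp
  have w_u: "level_extend E n w q x = u q x" if xS: "x \<in> ?S q" for q x
  proof -
    obtain z y where x: "x = (z, y)" "z \<in> smor (fst q) n" "y \<in> smor (snd q) k"
      "z \<in> nonsurj (fst q) n \<or> y \<in> cells \<Lambda>[k,j] (snd q)" using xS by (cases x) auto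
    have "act E q (n, snd q) (z, ?I (snd q)) (w (snd q) y) = u q (z, y)" if z: "z \<in> nonsurj (fst q) n"
    proof -
      have "to_matching E n (snd q) (w (snd q) y) (fst q) z = m0 (snd q) y (fst q) z"
        using w(3)[of y "snd q"] x(3) by simp
      then show ?thesis using z by (simp add: to_matching_def m0_def)
    qed
    moreover have "act E q (n, snd q) (z, ?I (snd q)) (w (snd q) y) = u q (z, y)" if y: "y \<in> cells \<Lambda>[k,j] (snd q)"
      using w(2)[OF y] ua[of "?I n" "(n, snd q)" y "(z, ?I (snd q))" q] x y by (simp add: bisimplex_simps)
    ultimately show ?thesis using x by (auto simp: level_extend_def)
  qed
  have w_v: "p q (level_extend E n w q x) = v q x" if xZ: "x \<in> cells ?Z q" for q x
  proof -
    obtain z y where x: "x = (z, y)" "z \<in> smor (fst q) n" "y \<in> smor (snd q) k"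
      using xZ by (cases x) auto
    have "p q (level_extend E n w q x) = act B q (n, snd q) (z, ?I (snd q)) (p (n, snd q) (w (snd q) y))"
      using natD(2)[OF pn _ wc[OF x(3)], of "(z, ?I (snd q))" q] x(1,2)
      by (simp add: level_extend_def bisimplex_simps)
    also have "\<dots> = v q x"
      using w(3)[of y "snd q"] x va[of "?I n" "(n, snd q)" y "(z, ?I (snd q))" q] by (simp add: bisimplex_simps)
    finally show ?thesis .
  qed
  show "\<exists>w. bimap ?Z E w \<and> (\<forall>q. \<forall>x\<in>?S q. w q x = u q x) \<and> (\<forall>q. \<forall>x\<in>cells ?Z q. p q (w q x) = v q x)"
    using level_extend_nat[OF E w(1)] w_u w_v by blast
qed

lemma yoneda_bisimplex:
  "yoneda bisimplex_cat (n, k) = box n k"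
  by (simp add: yoneda_def psh_prod_def discrete_def constant_obj_def std_simplex_def fun_eq_iff
      bimor_iff[unfolded mem_Times_iff[symmetric]] bisimplex_cat_def)

lemma smor_0: "e \<in> smor m 0 \<longleftrightarrow> e = vertex 0 m"
proof
  assume "e \<in> smor m 0"
  then show "e = vertex 0 m" unfolding smor_iff vertex_def
    by (metis atMost_0 replicate_length_same singletonD subsetD)
qed (simp add: vertex_smor)

lemma nonsurj_0: "nonsurj m 0 = {}"
  by (auto simp: nonsurj_def smor_0 vertex_def)

text \<open>Passing from boundary inclusions to arbitrary inclusions in the discrete direction, by
  attaching the cells of \<open>L\<close>.\<close>

lemma fibration_box_lifts:
  assumes p: "reedy_fibration E B p" and k: "1 \<le> k" "j \<le> k"
    and L: "sset L" and K: "subsset L K"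
  shows "bilifts E B p (psh_prod (discrete L) (constant_obj \<Delta>[k]))
    (pp (discrete L) (\<lambda>q. K (fst q)) (constant_obj \<Delta>[k]) (\<lambda>q. cells \<Lambda>[k,j] (snd q)))"
proof (rule bisimplex.lifts_cellwise[OF bisset_discrete[OF L] bisset_constant[OF sset_simplex] _
      sub_discrete[OF K] sub_constant_obj[OF sub_horn]])
  show "bisset E" using p by (simp add: reedy_fibration_def)
  fix d x assume x: "x \<in> cells (discrete L) d" "x \<notin> K (fst d)"
  obtain n m where d: "d = (n, m)" by (cases d)
  show "(\<exists>r. \<exists>y\<in>cells (discrete L) r. \<exists>u\<in>bimor d r.
        fst r + snd r < fst d + snd d \<and> x = act (discrete L) d r u y) \<or>
    bilifts E B p (psh_prod (yoneda bisimplex_cat d) (constant_obj \<Delta>[k]))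
     (pp (yoneda bisimplex_cat d) (\<lambda>q. bd2 q d) (constant_obj \<Delta>[k]) (\<lambda>q. cells \<Lambda>[k,j] (snd q)))"
  proof (cases m)
    \<comment> \<open>A cell of positive second degree is degenerate in a discrete object: it is
      restricted from degree (n, 0).\<close>
    case (Suc m')
    then show ?thesis
      using x pshD(2)[OF L, of x n]
      by (intro disjI1 exI[of _ "(n, 0)"] bexI[of _ x] bexI[of _ "(sidn n, vertex 0 m)"])
         (auto simp: d bisimplex_simps vertex_smor)
  next
    case 0
    \<comment> \<open>Nothing maps non-surjectively to [0], so the boundary of the (n, 0)-bisimplex
      is \<partial>\<Delta>[n] times a point.\<close>
    have "bilifts E B p (psh_prod (yoneda bisimplex_cat d) (constant_obj \<Delta>[k]))
     (pp (yoneda bisimplex_cat d) (\<lambda>q. bd2 q d) (constant_obj \<Delta>[k]) (\<lambda>q. cells \<Lambda>[k,j] (snd q)))"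
    proof (rule lifts_iso[OF reedy_box_lifts[OF p k, of n],
          where f="\<lambda>_ ((x, e), y). (x, y)" and g="\<lambda>q (x, y). ((x, vertex 0 (snd q)), y)"])
      show "subbisset (box n k)
         (pp (discrete \<Delta>[n]) (\<lambda>q. nonsurj (fst q) n) (constant_obj \<Delta>[k]) (\<lambda>q. cells \<Lambda>[k,j] (snd q)))"
        by (intro subpresheaf_pp bisset_discrete bisset_constant sset_simplex sub_constant_obj
            sub_horn sub_discrete[OF sub_boundary])
    qed (auto simp: nat_trans_def d 0 bisimplex_simps smor_0 bd2_def nonsurj_0 vertex_smor scmp_vertex)
    then show ?thesis ..
  qed
qed

text \<open>Associativity and symmetry of the pushout-product. The interval, being discrete, is
  absorbed into the discrete factor, which puts the problem into the form of
  \<open>fibration_box_lifts\<close>.\<close>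

lemma lifts_shuffle:
  assumes L: "sset L" and N: "sset N" and M: "sset M"
    and K: "subsset L K" and H: "subsset N H" and T: "subsset M T"
    and lift: "bilifts E B p (psh_prod (discrete (psh_prod L M)) (constant_obj N))
      (pp (discrete (psh_prod L M)) (\<lambda>q. pp L K M T (fst q)) (constant_obj N) (\<lambda>q. H (snd q)))"
  shows "bilifts E B p (psh_prod (psh_prod (discrete L) (constant_obj N)) (discrete M))
      (pp (psh_prod (discrete L) (constant_obj N)) (pp (discrete L) (\<lambda>q. K (fst q)) (constant_obj N) (\<lambda>q. H (snd q)))
        (discrete M) (\<lambda>q. T (fst q)))"
proof (rule lifts_iso[OF lift, where f="\<lambda>_ ((x, y), t). ((x, t), y)" and g="\<lambda>_ ((x, t), y). ((x, y), t)"])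
  show "subbisset (psh_prod (discrete (psh_prod L M)) (constant_obj N))
     (pp (discrete (psh_prod L M)) (\<lambda>q. pp L K M T (fst q)) (constant_obj N) (\<lambda>q. H (snd q)))"
    by (intro subpresheaf_pp bisset_discrete bisset_constant presheaf_prod L M N
        sub_discrete sub_constant_obj H K T)
qed (auto simp: nat_trans_def)

section \<open>Arrows and coslices\<close>

interpretation arrows: pointed_exponent bisimplex_cat "interval" "\<lambda>q. vertex 0 (fst q)"
proof
  show "small_category bisimplex_cat" by (rule bisimplex_category)
  show "bisset interval" by (rule bisset_discrete[OF sset_simplex])
qed (auto simp: vertex_smor scmp_vertex bisimplex_simps)

lemma bisset_Arrows: "bisset (Arrows X)"
  unfolding Arrows_def by (rule presheaf_psh_exp[OF arrows.D arrows.K])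

lemma src_nat: "bimap (Arrows X) X src"
  unfolding Arrows_def src_def by (rule arrows.ev_nat)

lemma cells_point [simp]: "x \<in> cells point q \<longleftrightarrow> x = vertex 0 (fst q)"
  by (simp add: point_def smor_0)

lemma act_point [simp]: "act point p q u x = scmp x (fst u)"
  by (simp add: point_def)

lemma bisset_point: "bisset point"
  unfolding point_def by (rule bisset_discrete[OF sset_simplex])

lemma to_point_nat: "bimap X point (\<lambda>q x. vertex 0 (fst q))"
  by (rule natI) (auto simp: scmp_vertex bisimplex_simps)

text \<open>The case of \<open>lifts_exp\<close> over the point. The space of arrows of the point is
  trivial, so the only remaining constraint on an extended family of arrows is its source
  \<open>g\<close>.\<close>

lemma arrow_extension:
  assumes X: "bisset X" and Z: "bisset Z" and S: "subbisset Z S"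
    and L: "bilifts X point (\<lambda>q x. vertex 0 (fst q)) (psh_prod Z interval)
      (pp Z S interval (\<lambda>q. {vertex 0 (fst q)}))"
    and u: "bimap (Z\<lparr>cells := S\<rparr>) (Arrows X) u" and g: "bimap Z X g"
    and ug: "\<And>q z. z \<in> S q \<Longrightarrow> src q (u q z) = g q z"
  obtains w where "bimap Z (Arrows X) w" "\<And>q z. z \<in> S q \<Longrightarrow> w q z = u q z"
    "\<And>q z. z \<in> cells Z q \<Longrightarrow> src q (w q z) = g q z"
proof -
  let ?K = "interval"
  let ?t = "\<lambda>q x. vertex 0 (fst q)"
  \<comment> \<open>The only map from \<open>Z\<close> to the arrows of the point; it serves as the
    first component of the bottom map.\<close>
  define \<kappa> where "\<kappa> = curry_nat bisimplex_cat Z ?K (?t :: (_, nat list) bitrans)"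
  have \<kappa>: "bimap Z (Arrows point) \<kappa>"
    unfolding \<kappa>_def Arrows_def by (rule curry_nat_nat[OF arrows.D Z arrows.K to_point_nat])
  have uc: "u q z \<in> cells (Arrows X) q" if "z \<in> S q" for q z using natD(1)[OF u, of z q] that by simp
  have post: "exp_post bisimplex_cat ?K ?t q \<theta> \<in> cells (Arrows point) q" if "\<theta> \<in> cells (Arrows X) q" for q \<theta>
    unfolding Arrows_def by (rule arrows.post_cells[OF to_point_nat that[unfolded Arrows_def]])
  have post_\<kappa>: "exp_post bisimplex_cat ?K ?t q \<theta> = \<kappa> q z"
    if \<theta>: "\<theta> \<in> cells (Arrows X) q" and z: "z \<in> cells Z q" for q \<theta> z
    using post[OF \<theta>] natD(1)[OF \<kappa> z] unfolding Arrows_def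
    by (rule exp_eqI) (simp add: \<kappa>_def exp_post_def)
  let ?Q = "psh_pullback (psh_exp bisimplex_cat point ?K) X src ?t"
  let ?R = "\<lambda>q \<theta>. (exp_post bisimplex_cat ?K ?t q \<theta>, src q \<theta>)"
  have L': "bilifts (Arrows X) ?Q ?R Z S"
    using arrows.lifts_exp[OF X bisset_point to_point_nat Z S L] unfolding Arrows_def src_def .
  have 2: "bimap Z ?Q (\<lambda>q z. (\<kappa> q z, g q z))"
  proof (rule natI)
    show "(\<kappa> q z, g q z) \<in> cells ?Q q" if "z \<in> cells Z q" for q z
      using natD(1)[OF \<kappa> that] natD(1)[OF g that] natD(1)[OF src_nat, of "\<kappa> q z" point q]
      by (simp add: Arrows_def)
  qed (use natD(2)[OF \<kappa>] natD(2)[OF g] in \<open>simp add: Arrows_def\<close>)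
  have 3: "\<forall>q. \<forall>z\<in>S q. ?R q (u q z) = (\<kappa> q z, g q z)"
    using post_\<kappa>[OF uc subpresheafD(1)[OF S]] ug by simp
  obtain w where w: "bimap Z (Arrows X) w" "\<And>q z. z \<in> S q \<Longrightarrow> w q z = u q z"
    "\<And>q z. z \<in> cells Z q \<Longrightarrow> ?R q (w q z) = (\<kappa> q z, g q z)"
    by (rule liftsE[where \<rho>="?R" and u=u and v="\<lambda>q z. (\<kappa> q z, g q z)", OF L' u 2 3]) (rule that)
  show thesis using that[OF w(1,2)] w(3) by simp
qed

text \<open>A map into the coslice is a family of arrows whose source is constantly
  \<open>c\<close>, so \<open>arrow_extension\<close> applies with constant
  \<open>g\<close>.\<close>

lemma coslice_lifts:
  assumes C: "bisset C" and c: "bimap point C c" and Z: "bisset Z" and S: "subbisset Z S"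
    and L: "bilifts C point (\<lambda>q x. vertex 0 (fst q)) (psh_prod Z interval)
      (pp Z S interval (\<lambda>q. {vertex 0 (fst q)}))"
  shows "bilifts (coslice C c) point (\<lambda>q x. vertex 0 (fst q)) Z S"
proof (rule liftsI)
  fix u v assume u: "bimap (Z\<lparr>cells := S\<rparr>) (coslice C c) u" and v: "bimap Z point v"
  have uc: "fst (u q z) = vertex 0 (fst q)" "snd (u q z) \<in> cells (Arrows C) q" "src q (snd (u q z)) = c q (vertex 0 (fst q))"
    if "z \<in> S q" for q z
    using natD(1)[OF u, of z q] that unfolding coslice_def by (cases "u q z"; simp)+
  have snd_u: "bimap (Z\<lparr>cells := S\<rparr>) (Arrows C) (\<lambda>q z. snd (u q z))"
  proof (rule natI)
    show "snd (u q z) \<in> cells (Arrows C) q" if "z \<in> cells (Z\<lparr>cells := S\<rparr>) q" for q z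
      using uc(2) that by simp
    show "snd (u p (act (Z\<lparr>cells := S\<rparr>) p q a z)) = act (Arrows C) p q a (snd (u q z))"
      if "a \<in> bimor p q" "z \<in> cells (Z\<lparr>cells := S\<rparr>) q" for p q a z
      using natD(2)[OF u that] unfolding coslice_def by (cases "u q z") simp
  qed
  have g: "bimap Z C (\<lambda>q z. c q (vertex 0 (fst q)))"
    by (rule nat_trans_comp[OF to_point_nat c])
  obtain w where w: "bimap Z (Arrows C) w" "\<And>q z. z \<in> S q \<Longrightarrow> w q z = snd (u q z)"
    "\<And>q z. z \<in> cells Z q \<Longrightarrow> src q (w q z) = c q (vertex 0 (fst q))"
    by (rule arrow_extension[OF C Z S L snd_u g uc(3)]) (assumption, rule that)
  have "bimap Z (coslice C c) (\<lambda>q z. (vertex 0 (fst q), w q z))"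
    unfolding coslice_def using natD[OF w(1)] w(3)
    by (intro natI) (auto simp: scmp_vertex bisimplex_simps)
  moreover have "(vertex 0 (fst q), w q z) = u q z" if "z \<in> S q" for q z
    using uc(1)[OF that] w(2)[OF that] by (simp add: prod_eq_iff)
  moreover have "vertex 0 (fst q) = v q z" if "z \<in> cells Z q" for q z
    using natD(1)[OF v that] by simp
  ultimately show "\<exists>w. bimap Z (coslice C c) w \<and> (\<forall>q. \<forall>z\<in>S q. w q z = u q z) \<and>
      (\<forall>q. \<forall>z\<in>cells Z q. vertex 0 (fst q) = v q z)"
    by (intro exI[of _ "\<lambda>q z. (vertex 0 (fst q), w q z)"]) blast
qed

lemma coslice_box_lifts:
  assumes C: "simplicial_space C" and c: "bimap point C c" and k: "1 \<le> k" "j \<le> k"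
    and L: "sset L" and K: "subsset L K"
  shows "bilifts (coslice C c) point (\<lambda>q x. vertex 0 (fst q)) (psh_prod (discrete L) (constant_obj \<Delta>[k]))
    (pp (discrete L) (\<lambda>q. K (fst q)) (constant_obj \<Delta>[k]) (\<lambda>q. cells \<Lambda>[k,j] (snd q)))"
proof (rule coslice_lifts[OF _ c])
  have C': "reedy_fibration C point (\<lambda>q x. vertex 0 (fst q))" using C by (simp add: simplicial_space_def)
  then show "bisset C" by (simp add: reedy_fibration_def)
  note \<Delta> = sset_simplex and v = sub_vertex[of 0 1]
  show "bilifts C point (\<lambda>q x. vertex 0 (fst q))
     (psh_prod (psh_prod (discrete L) (constant_obj \<Delta>[k])) interval)
     (pp (psh_prod (discrete L) (constant_obj \<Delta>[k]))
       (pp (discrete L) (\<lambda>q. K (fst q)) (constant_obj \<Delta>[k]) (\<lambda>q. cells \<Lambda>[k,j] (snd q)))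
       interval (\<lambda>q. {vertex 0 (fst q)}))"
    by (rule lifts_shuffle[OF L \<Delta> \<Delta> K sub_horn v
          fibration_box_lifts[OF C' k presheaf_prod[OF L \<Delta>] subpresheaf_pp[OF L \<Delta> K v]]]) simp_all
qed (intro presheaf_prod bisset_discrete bisset_constant L sset_simplex
    subpresheaf_pp sub_discrete[OF K] sub_constant_obj[OF sub_horn])+

section \<open>Levels of the arrow map of a covariant family\<close>

lemma kan_complex_level:
  assumes G: "bisset G"
    and L: "\<And>k j. 1 \<le> k \<Longrightarrow> j \<le> k \<Longrightarrow> bilifts G point (\<lambda>q x. vertex 0 (fst q))
      (box n k)
      (pp (discrete \<Delta>[n]) (\<lambda>_. {}) (constant_obj \<Delta>[k]) (\<lambda>q. cells \<Lambda>[k,j] (snd q)))"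
  shows "kan_complex (level G n)"
  unfolding kan_complex_def kan_fibration_iff
proof (intro conjI allI impI)
  show "sset (level G n)" by (rule sset_level[OF G])
  show "sset \<Delta>[0]" by (rule sset_simplex)
  show "smap (level G n) \<Delta>[0] (\<lambda>m x. vertex 0 m)"
    by (rule natI) (auto simp: vertex_smor scmp_vertex)
  fix k j :: nat assume kj: "1 \<le> k \<and> j \<le> k"
  \<comment> \<open>Level n of the point has the cell \<open>vertex 0 n\<close> in every degree,
    while \<open>kan_complex\<close> speaks of \<Delta>[0], with \<open>vertex 0 m\<close> in degree
    m. Both are terminal, so only the bottom map has to be replaced.\<close>
  have L': "slifts (level G n) (level point n) (\<lambda>m x. vertex 0 n) \<Delta>[k] (cells \<Lambda>[k,j])"
    using lifts_level[OF G bisset_point to_point_nat sset_simplex sub_horn, of n k j] L[of k j] kj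
    by simp
  show "slifts (level G n) \<Delta>[0] (\<lambda>m x. vertex 0 m) \<Delta>[k] (cells \<Lambda>[k,j])"
  proof (rule liftsI)
    fix u v assume u: "smap (\<Delta>[k]\<lparr>cells := cells \<Lambda>[k,j]\<rparr>) (level G n) u" and v: "smap \<Delta>[k] \<Delta>[0] v"
    have t: "smap \<Delta>[k] (level point n) (\<lambda>m x. vertex 0 n)"
      by (rule natI) (simp_all add: scmp_vertex[OF simplex_idn])
    obtain w where w: "smap \<Delta>[k] (level G n) w" "\<And>m z. z \<in> cells \<Lambda>[k,j] m \<Longrightarrow> w m z = u m z"
      by (rule liftsE[OF L' u t]) (simp, rule that)
    moreover have "vertex 0 m = v m z" if "z \<in> cells \<Delta>[k] m" for m z
      using natD(1)[OF v that] by (simp add: smor_0)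
    ultimately show "\<exists>w. smap \<Delta>[k] (level G n) w \<and> (\<forall>m. \<forall>z\<in>cells \<Lambda>[k,j] m. w m z = u m z) \<and>
        (\<forall>m. \<forall>z\<in>cells \<Delta>[k] m. vertex 0 m = v m z)" by blast
  qed
qed

lemma kan_complex_total:
  assumes p: "kan_fibration A B p" and B: "kan_complex B"
  shows "kan_complex A"
proof -
  have "slifts A \<Delta>[0] (\<lambda>m x. vertex 0 m) \<Delta>[n] (cells \<Lambda>[n,k])" if "1 \<le> n" "k \<le> n" for n k
    using lifts_comp[of simplex_cat A B p "\<Delta>[n]" "cells \<Lambda>[n,k]" "\<Delta>[0]" "\<lambda>m x. vertex 0 m"] p B that
    by (simp add: kan_complex_def kan_fibration_iff)
  moreover have "smap A \<Delta>[0] (\<lambda>m x. vertex 0 m)"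
    by (rule natI) (auto simp: vertex_smor scmp_vertex)
  ultimately show ?thesis using p sset_simplex by (simp add: kan_complex_def kan_fibration_iff)
qed

text \<open>This is the transpose of the statement that each level of the arrow map is a trivial
  fibration. That level is a Kan fibration because \<rho> is a fibration, its base is Kan because
  coslice and family are fibrant, and it is a weak equivalence by covariance.\<close>

lemma covariant_coslice_lifts:
  assumes C: "simplicial_space C" and c: "bimap point C c" and cov: "covariant F (coslice C c) \<rho>"
  shows "bilifts F (coslice C c) \<rho>
    (psh_prod (box n k) interval)
    (pp (box n k)
       (pp (discrete \<Delta>[n]) (\<lambda>_. {}) (constant_obj \<Delta>[k]) (\<lambda>q. nonsurj (snd q) k))
       interval (\<lambda>q. {vertex 0 (fst q)}))"
proof -
  define X where "X = coslice C c"
  have reedy: "reedy_fibration F X \<rho>" and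
    eq: "equivalence (Arrows F) (psh_pullback (Arrows X) F src \<rho>) (\<lambda>q \<theta>. (arrow_map \<rho> q \<theta>, src q \<theta>))"
    using cov by (simp_all add: covariant_def X_def)
  then have F: "bisset F" and X: "bisset X" and \<rho>: "bimap F X \<rho>" by (simp_all add: reedy_fibration_def)
  let ?Q = "psh_pullback (Arrows X) F src \<rho>"
  let ?R = "\<lambda>q \<theta>. (arrow_map \<rho> q \<theta>, src q \<theta>)"
  let ?Z = "\<lambda>k. box n k"
  let ?S = "\<lambda>M k. pp (discrete \<Delta>[n]) (\<lambda>_. {}) (constant_obj \<Delta>[k]) (\<lambda>q. M (snd q))"
  let ?v = "\<lambda>m. {vertex 0 m}"
  note \<Delta> = sset_simplex and v = sub_vertex[of 0 1]
  note \<Delta>n1 = presheaf_prod[OF \<Delta>[of n] \<Delta>[of 1]]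
  have K: "subsset (psh_prod \<Delta>[n] \<Delta>[1]) (pp \<Delta>[n] (\<lambda>_. {}) \<Delta>[1] ?v)"
    by (intro subpresheaf_pp \<Delta> sub_empty v) simp
  have Z: "bisset (?Z k)" for k :: nat by (intro presheaf_prod bisset_discrete bisset_constant \<Delta>)
  have S: "subbisset (?Z k) (?S M k)" if "subsset \<Delta>[k] M" for M and k :: nat
    by (intro subpresheaf_pp bisset_discrete bisset_constant \<Delta> sub_empty sub_constant_obj that)
  have Q: "bisset ?Q" by (rule presheaf_pullback[OF bisset_Arrows F src_nat \<rho>])
  have R: "bimap (Arrows F) ?Q ?R" using eq by (simp add: equivalence_def)
  have AB: "kan_fibration (level (Arrows F) n) (level ?Q n) (\<lambda>k. ?R (n, k))"
    unfolding kan_fibration_iff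
  proof (intro conjI allI impI)
    show "smap (level (Arrows F) n) (level ?Q n) (\<lambda>k. ?R (n, k))"
      using eq by (simp add: equivalence_def weak_homotopy_equivalence_def)
    fix k j :: nat assume kj: "1 \<le> k \<and> j \<le> k"
    have "bilifts F X \<rho> (psh_prod (?Z k) interval)
       (pp (?Z k) (?S (cells \<Lambda>[k,j]) k) interval (\<lambda>q. {vertex 0 (fst q)}))"
      by (rule lifts_shuffle[OF \<Delta> \<Delta> \<Delta> sub_empty sub_horn v
            fibration_box_lifts[OF reedy _ _ \<Delta>n1 K]]) (use kj in simp_all)
    from arrows.lifts_exp[OF F X \<rho> Z S[OF sub_horn] this]
    have "bilifts (Arrows F) ?Q ?R (?Z k) (?S (cells \<Lambda>[k,j]) k)"
      unfolding Arrows_def src_def arrow_map_def .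
    then show "slifts (level (Arrows F) n) (level ?Q n) (\<lambda>k. ?R (n, k)) \<Delta>[k] (cells \<Lambda>[k,j])"
      using lifts_level[OF bisset_Arrows Q R \<Delta> sub_horn] by blast
  qed (intro sset_level bisset_Arrows Q)+
  \<comment> \<open>A cell of \<open>?Q\<close> is an arrow of the coslice together with a lift of
    its source. Fill the horn in \<open>F\<close> first, then extend the arrows with the image of
    this filler as source.\<close>
  have B: "kan_complex (level ?Q n)"
  proof (rule kan_complex_level[OF Q], rule liftsI)
    fix k j :: nat and u v assume kj: "1 \<le> k" "j \<le> k"
      and u: "bimap ((?Z k)\<lparr>cells := ?S (cells \<Lambda>[k,j]) k\<rparr>) ?Q u" and v0: "bimap (?Z k) point v"
    let ?Sk = "?S (cells \<Lambda>[k,j]) k"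
    have uc: "fst (u q z) \<in> cells (Arrows X) q" "snd (u q z) \<in> cells F q" "src q (fst (u q z)) = \<rho> q (snd (u q z))"
      if "z \<in> ?Sk q" for q z
      using natD(1)[OF u, of z q] that by (cases "u q z"; simp)+
    have ua: "fst (u p (act (?Z k) p q a z)) = act (Arrows X) p q a (fst (u q z))"
      "snd (u p (act (?Z k) p q a z)) = act F p q a (snd (u q z))"
      if "a \<in> bimor p q" "z \<in> ?Sk q" for p q a z
      using natD(2)[OF u that(1), of z] that(2) by (cases "u q z"; simp)+
    have fst_u: "bimap ((?Z k)\<lparr>cells := ?Sk\<rparr>) (Arrows X) (\<lambda>q z. fst (u q z))"
      using uc ua by (intro natI) simp_all
    have snd_u: "bimap ((?Z k)\<lparr>cells := ?Sk\<rparr>) F (\<lambda>q z. snd (u q z))"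
      using uc ua by (intro natI) simp_all
    have LX: "bilifts X point (\<lambda>q x. vertex 0 (fst q)) (?Z k) ?Sk"
      unfolding X_def by (rule coslice_box_lifts[OF C c kj \<Delta> sub_empty])
    have LF: "bilifts F point (\<lambda>q x. vertex 0 (fst q)) (?Z k) ?Sk"
      using lifts_comp[OF fibration_box_lifts[OF reedy kj \<Delta> sub_empty] LX \<rho>] .
    obtain f where f: "bimap (?Z k) F f" "\<And>q z. z \<in> ?Sk q \<Longrightarrow> f q z = snd (u q z)"
      by (rule liftsE[OF LF snd_u to_point_nat]) (simp, rule that)
    have LX1: "bilifts X point (\<lambda>q x. vertex 0 (fst q)) (psh_prod (?Z k) interval)
        (pp (?Z k) ?Sk interval (\<lambda>q. {vertex 0 (fst q)}))"
      unfolding X_def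
      by (rule lifts_shuffle[OF \<Delta> \<Delta> \<Delta> sub_empty sub_horn v
            coslice_box_lifts[OF C c kj \<Delta>n1 K]]) simp
    have src_u: "src q (fst (u q z)) = \<rho> q (f q z)" if "z \<in> ?Sk q" for q z using uc(3)[OF that] f(2)[OF that] by simp
    obtain w where w: "bimap (?Z k) (Arrows X) w" "\<And>q z. z \<in> ?Sk q \<Longrightarrow> w q z = fst (u q z)"
      "\<And>q z. z \<in> cells (?Z k) q \<Longrightarrow> src q (w q z) = \<rho> q (f q z)"
      by (rule arrow_extension[OF X Z S[OF sub_horn] LX1 fst_u nat_trans_comp[OF f(1) \<rho>] src_u])
        (assumption, rule that)
    have "bimap (?Z k) ?Q (\<lambda>q z. (w q z, f q z))"
      using natD[OF w(1)] natD[OF f(1)] w(3) by (intro natI) simp_all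
    moreover have "(w q z, f q z) = u q z" if "z \<in> ?Sk q" for q z
      using w(2)[OF that] f(2)[OF that] by simp
    moreover have "vertex 0 (fst q) = v q z" if "z \<in> cells (?Z k) q" for q z
      using natD(1)[OF v0 that] by simp
    ultimately show "\<exists>w. bimap (?Z k) ?Q w \<and> (\<forall>q. \<forall>z\<in>?Sk q. w q z = u q z) \<and>
        (\<forall>q. \<forall>z\<in>cells (?Z k) q. vertex 0 (fst q) = v q z)"
      by (intro exI[of _ "\<lambda>q z. (w q z, f q z)"]) blast
  qed
  have "weak_homotopy_equivalence (level (Arrows F) n) (level ?Q n) (\<lambda>k. ?R (n, k))"
    using eq by (simp add: equivalence_def)
  from trivial_fibration_lifts[OF kan_complex_total[OF AB B] B AB this \<Delta> sub_boundary]
  have "bilifts (Arrows F) ?Q ?R (?Z k) (?S (\<lambda>m. nonsurj m k) k)"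
    using lifts_level[OF bisset_Arrows Q R \<Delta> sub_boundary] by blast
  then have "bilifts F X \<rho> (psh_prod (?Z k) interval)
      (pp (?Z k) (?S (\<lambda>m. nonsurj m k) k) interval (\<lambda>q. {vertex 0 (fst q)}))"
    unfolding Arrows_def src_def arrow_map_def
    by (rule arrows.lifts_exp_converse[OF F X \<rho> Z S[OF sub_boundary]])
  then show ?thesis by (simp add: X_def)
qed

section \<open>Lifting against the source inclusion\<close>

lemma nonsurj_small: "r < n \<Longrightarrow> m \<in> smor r n \<Longrightarrow> m \<in> nonsurj r n"
  using card_length[of m] by (auto simp: nonsurj_def smor_iff)

lemma constant_obj_eq_pull: "constant_obj M = pull snd snd M"
  by (simp add: constant_obj_def pull_def)

text \<open>
  The inductive step of the characterisation of Reedy trivial fibrations.  A lift \<open>l\<close> that ignores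
  the boundary of \<open>\<Delta>[n]\<close> is moved to one that respects it along a homotopy \<open>h\<close>, which exists
  over the boundary by induction and extends to \<open>\<Delta>[n]\<close> because \<open>\<rho>\<close> is a fibration.
\<close>

lemma source_lifts:
  assumes reedy: "reedy_fibration F X \<rho>"
    and triv: "\<And>n k. bilifts F X \<rho>
      (psh_prod (box n k) interval)
      (pp (box n k)
         (pp (discrete \<Delta>[n]) (\<lambda>_. {}) (constant_obj \<Delta>[k]) (\<lambda>q. nonsurj (snd q) k))
         interval (\<lambda>q. {vertex 0 (fst q)}))"
  shows "bilifts F X \<rho> (psh_prod (yoneda bisimplex_cat (n, k)) interval)
    (pp (yoneda bisimplex_cat (n, k)) (\<lambda>q. bd2 q (n, k)) interval (\<lambda>q. {vertex 0 (fst q)}))"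
proof (induction n arbitrary: k rule: less_induct)
  case (less n)
  let ?I = "interval" and ?v = "\<lambda>q. {vertex 0 (fst q)}"
  let ?B = "box n k"
  let ?S = "pp ?B (\<lambda>q. bd2 q (n, k)) ?I ?v"
  note \<Delta> = sset_simplex
  have F: "bisset F" using reedy by (simp add: reedy_fibration_def)
  have I: "bisset ?I" and v0: "subbisset ?I ?v"
    using bisset_discrete[OF \<Delta>] sub_discrete[OF sub_vertex[of 0 1]] by simp_all
  have S_mem: "((x, y), t) \<in> ?S q \<longleftrightarrow> x \<in> smor (fst q) n \<and> y \<in> smor (snd q) k \<and>
      t \<in> smor (fst q) 1 \<and> (x \<in> nonsurj (fst q) n \<or> y \<in> nonsurj (snd q) k \<or> t = vertex 0 (fst q))" for x y t q
    by (auto simp: bd2_def bimor_iff)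
  show ?case
    unfolding yoneda_bisimplex
  proof (rule liftsI)
    fix u v assume u: "bimap ((psh_prod ?B ?I)\<lparr>cells := ?S\<rparr>) F u" and v: "bimap (psh_prod ?B ?I) X v"
      and uv: "\<And>q z. z \<in> ?S q \<Longrightarrow> \<rho> q (u q z) = v q z"
    have uc: "u q x \<in> cells F q" if "x \<in> ?S q" for q x using natD(1)[OF u, of x q] that by simp
    have ua: "u p ((scmp x (fst a), scmp y (snd a)), scmp t (fst a)) = act F p q a (u q ((x, y), t))"
      if "a \<in> bimor p q" "((x, y), t) \<in> ?S q" for p q a x y t
      using natD(2)[OF u that(1), of "((x, y), t)"] that(2) by simp
    \<comment> \<open>\<open>?S\<close> without the constraint on \<partial>\<Delta>[n]: exactly
      what the levelwise lifts can handle.\<close>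
    let ?S1 = "pp ?B (pp (discrete \<Delta>[n]) (\<lambda>_. {}) (constant_obj \<Delta>[k]) (\<lambda>q. nonsurj (snd q) k)) ?I ?v"
    have S1: "x \<in> ?S q" if "x \<in> ?S1 q" for x q
      using that by (cases x) (auto simp: bd2_def bimor_iff)
    have 1: "bimap ((psh_prod ?B ?I)\<lparr>cells := ?S1\<rparr>) F u"
      using natD[OF u] S1 by (intro natI) simp_all
    have 2: "\<forall>q. \<forall>z\<in>?S1 q. \<rho> q (u q z) = v q z" using uv S1 by blast
    obtain l where l: "bimap (psh_prod ?B ?I) F l" "\<And>q z. z \<in> ?S1 q \<Longrightarrow> l q z = u q z"
      "\<And>q z. z \<in> cells (psh_prod ?B ?I) q \<Longrightarrow> \<rho> q (l q z) = v q z"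
      by (rule liftsE[OF triv 1 v 2]) (rule that)
    have lc: "l q ((x, y), t) \<in> cells F q" "\<rho> q (l q ((x, y), t)) = v q ((x, y), t)"
      if "x \<in> smor (fst q) n" "y \<in> smor (snd q) k" "t \<in> smor (fst q) 1" for q x y t
      using natD(1)[OF l(1), of "((x, y), t)" q] l(3)[of "((x, y), t)" q] that by simp_all
    have la: "l p ((scmp x (fst a), scmp y (snd a)), scmp t (fst a)) = act F p q a (l q ((x, y), t))"
      if "a \<in> bimor p q" "x \<in> smor (fst q) n" "y \<in> smor (snd q) k" "t \<in> smor (fst q) 1"
      for p q a x y t
      using natD(2)[OF l(1) that(1), of "((x, y), t)"] that(2-) by simp
    have lu: "l q ((x, y), t) = u q ((x, y), t)"
      if "x \<in> smor (fst q) n" "y \<in> smor (snd q) k" "t \<in> smor (fst q) 1"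
        "y \<in> nonsurj (snd q) k \<or> t = vertex 0 (fst q)" for q x y t
      using l(2)[of "((x, y), t)" q] that by simp
    have va: "v p ((scmp x (fst a), scmp y (snd a)), scmp t (fst a)) = act X p q a (v q ((x, y), t))"
      if "a \<in> bimor p q" "x \<in> smor (fst q) n" "y \<in> smor (snd q) k" "t \<in> smor (fst q) 1"
      for p q a x y t
      using natD(2)[OF v that(1), of "((x, y), t)"] that(2-) by simp
    have vc: "v q ((x, y), t) \<in> cells X q"
      if "x \<in> smor (fst q) n" "y \<in> smor (snd q) k" "t \<in> smor (fst q) 1" for q x y t
      using natD(1)[OF v, of "((x, y), t)" q] that by simp
    note cmp_arr = scmp_smor
    let ?Zb = "psh_prod (discrete \<partial>\<Delta>[n]) (constant_obj (psh_prod \<Delta>[k] \<Delta>[1]))"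
    \<comment> \<open>Over \<partial>\<Delta>[n], the parameter \<open>s\<close> runs in the value
      direction from \<open>l\<close> at 0 to \<open>u\<close> at 1. On \<partial>\<Delta>[k] and at
      t = 0 these two agree, and the homotopy is kept constant.\<close>
    define Sb where "Sb = (\<lambda>q. {(x, (y, s)). x \<in> nonsurj (fst q) n \<and> y \<in> smor (snd q) k \<and>
      s \<in> smor (snd q) 1 \<and> (y \<in> nonsurj (snd q) k \<or> s = vertex 0 (snd q) \<or> s = vertex 1 (snd q))})"
    have "cells \<partial>\<Delta>[n] = (\<lambda>m. nonsurj m n)" by (rule ext) (rule cells_boundary)
    then have bdry: "sset \<partial>\<Delta>[n]"
      using presheaf_sub[OF \<Delta> sub_boundary[of n]] simplex_restrict(2)[of n] by metis
    have ns: "x \<in> smor m n'" if "x \<in> nonsurj m n'" for x m n' using that by (simp add: nonsurj_def)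
    have Zb: "bisset ?Zb" by (intro presheaf_prod bisset_discrete bisset_constant bdry \<Delta>)
    have Sb: "subbisset ?Zb Sb"
      unfolding subpresheaf_def Sb_def
      using nonsurj_cmp scmp_smor by (auto simp: bimor_iff scmp_vertex vertex_smor)
    have Lb: "bilifts F X \<rho> (psh_prod ?Zb ?I) (pp ?Zb Sb ?I ?v)"
    proof (rule bisimplex.lifts_cellwise[OF Zb I F Sb v0])
      fix d x assume "x \<in> cells ?Zb d"
      then obtain z y s where x: "x = (z, (y, s))" "z \<in> nonsurj (fst d) n" "y \<in> smor (snd d) k"
        "s \<in> smor (snd d) 1" by (cases x) auto
      show "(\<exists>r. \<exists>y\<in>cells ?Zb r. \<exists>u\<in>bimor d r. fst r + snd r < fst d + snd d \<and> x = act ?Zb d r u y) \<or>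
        bilifts F X \<rho> (psh_prod (yoneda bisimplex_cat d) ?I) (pp (yoneda bisimplex_cat d) (\<lambda>q. bd2 q d) ?I ?v)"
      \<comment> \<open>The induction hypothesis covers all bisimplices of first degree below
        \<open>n\<close>. A cell of \<partial>\<Delta>[n] of degree at least \<open>n\<close>
        factors through lower degree.\<close>
      proof (cases "fst d < n")
        case True
        then show ?thesis using less.IH[of "fst d" "snd d"] by simp
      next
        case False
        obtain r m e where f: "m \<in> smor r n" "e \<in> smor (fst d) r" "r < n" "z = scmp m e"
          using nonsurj_factor[OF x(2)] by blast
        have "m \<in> nonsurj r n" by (rule nonsurj_small[OF f(3,1)])
        then show ?thesis
          using x f False by (intro disjI1 exI[of _ "(r, snd d)"] bexI[of _ "(m, (y, s))"]
              bexI[of _ "(e, sidn (snd d))"]) (auto simp: bimor_iff)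
      qed
    qed
    define ub where "ub = (\<lambda>q ((x, (y, s)), t). if s = vertex 1 (snd q) then u q ((x, y), t) else l q ((x, y), t))"
    define vb where "vb = (\<lambda>q ((x, (y, s::nat list)), t). v q ((x, y), t))"
    have Sb_cases: "\<exists>x y s t. z = ((x, (y, s)), t) \<and> x \<in> nonsurj (fst q) n \<and> x \<in> smor (fst q) n \<and>
        y \<in> smor (snd q) k \<and> s \<in> smor (snd q) 1 \<and> t \<in> smor (fst q) 1 \<and>
        (y \<in> nonsurj (snd q) k \<or> s = vertex 0 (snd q) \<or> s = vertex 1 (snd q) \<or> t = vertex 0 (fst q))"
      if "z \<in> pp ?Zb Sb ?I ?v q" for z q
      using that ns by (cases z) (auto simp: Sb_def)
    have ub_l: "ub q ((x, (y, s)), t) = l q ((x, y), t)"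
      if "x \<in> smor (fst q) n" "y \<in> smor (snd q) k" "t \<in> smor (fst q) 1"
        "y \<in> nonsurj (snd q) k \<or> s = vertex 0 (snd q) \<or> t = vertex 0 (fst q)" for x y s t q
      using lu[of x q y t] that by (auto simp: ub_def vertex_inj)
    have ub_u: "ub q ((x, (y, vertex 1 (snd q))), t) = u q ((x, y), t)" for x y t q by (simp add: ub_def)
    have b1: "bimap ((psh_prod ?Zb ?I)\<lparr>cells := pp ?Zb Sb ?I ?v\<rparr>) F ub"
    proof (rule natI)
      fix q z assume "z \<in> cells ((psh_prod ?Zb ?I)\<lparr>cells := pp ?Zb Sb ?I ?v\<rparr>) q"
      then obtain x y s t where z: "z = ((x, (y, s)), t)" "x \<in> nonsurj (fst q) n" "x \<in> smor (fst q) n"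
        "y \<in> smor (snd q) k" "t \<in> smor (fst q) 1"
        using Sb_cases[of z q] by auto
      have "((x, y), t) \<in> ?S q" unfolding S_mem using z by blast
      then show "ub q z \<in> cells F q" using z uc lc(1) by (auto simp: ub_def)
    next
      fix p q a z assume a: "a \<in> bimor p q" and "z \<in> cells ((psh_prod ?Zb ?I)\<lparr>cells := pp ?Zb Sb ?I ?v\<rparr>) q"
      then have "z \<in> pp ?Zb Sb ?I ?v q" by simp
      then obtain x y s t where z: "z = ((x, (y, s)), t)" "x \<in> nonsurj (fst q) n" "x \<in> smor (fst q) n"
        "y \<in> smor (snd q) k" "t \<in> smor (fst q) 1"
        and d: "y \<in> nonsurj (snd q) k \<or> s = vertex 0 (snd q) \<or> s = vertex 1 (snd q) \<or> t = vertex 0 (fst q)"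
        using Sb_cases[of z q] by blast
      have a12: "fst a \<in> smor (fst p) (fst q)" "snd a \<in> smor (snd p) (snd q)"
        using a by (simp_all add: bimor_iff)
      have "ub p ((scmp x (fst a), (scmp y (snd a), scmp s (snd a))), scmp t (fst a))
        = act F p q a (ub q ((x, (y, s)), t))"
      proof (cases "s = vertex 1 (snd q)")
        case True
        have "((x, y), t) \<in> ?S q" unfolding S_mem using z by blast
        then show ?thesis
          unfolding True scmp_vertex[OF a12(2)] ub_u by (rule ua[OF a])
      next
        case False
        then have d': "y \<in> nonsurj (snd q) k \<or> s = vertex 0 (snd q) \<or> t = vertex 0 (fst q)" using d by blast
        then have "scmp y (snd a) \<in> nonsurj (snd p) k \<or> scmp s (snd a) = vertex 0 (snd p) \<or>
            scmp t (fst a) = vertex 0 (fst p)"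
          using nonsurj_cmp[OF a12(2)] scmp_vertex[OF a12(1)] scmp_vertex[OF a12(2)] by blast
        then show ?thesis
          using ub_l[OF cmp_arr[OF a12(1) z(3)] cmp_arr[OF a12(2) z(4)] cmp_arr[OF a12(1) z(5)]]
            ub_l[OF z(3-5) d'] la[OF a z(3-5)] by simp
      qed
      then show "ub p (act ((psh_prod ?Zb ?I)\<lparr>cells := pp ?Zb Sb ?I ?v\<rparr>) p q a z) = act F p q a (ub q z)"
        by (simp add: z(1))
    qed
    have b2: "bimap (psh_prod ?Zb ?I) X vb"
      using ns vc va by (intro natI) (auto simp: vb_def)
    have b3: "\<forall>q. \<forall>z\<in>pp ?Zb Sb ?I ?v q. \<rho> q (ub q z) = vb q z"
    proof (intro allI ballI)
      fix q z assume "z \<in> pp ?Zb Sb ?I ?v q"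
      then obtain x y s t where z: "z = ((x, (y, s)), t)" "x \<in> nonsurj (fst q) n" "x \<in> smor (fst q) n"
        "y \<in> smor (snd q) k" "t \<in> smor (fst q) 1"
        using Sb_cases[of z q] by blast
      have "((x, y), t) \<in> ?S q" unfolding S_mem using z by blast
      then show "\<rho> q (ub q z) = vb q z" using uv lc(2)[OF z(3-5)] by (simp add: ub_def vb_def z(1))
    qed
    obtain h where h: "bimap (psh_prod ?Zb ?I) F h" "\<And>q z. z \<in> pp ?Zb Sb ?I ?v q \<Longrightarrow> h q z = ub q z"
      "\<And>q z. z \<in> cells (psh_prod ?Zb ?I) q \<Longrightarrow> \<rho> q (h q z) = vb q z"
      by (rule liftsE[OF Lb b1 b2 b3]) (rule that)
    have hl: "h q ((x, (y, s)), t) = l q ((x, y), t)"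
      if "x \<in> nonsurj (fst q) n" "y \<in> smor (snd q) k" "s \<in> smor (snd q) 1" "t \<in> smor (fst q) 1"
        "y \<in> nonsurj (snd q) k \<or> s = vertex 0 (snd q) \<or> t = vertex 0 (fst q)" for x y s t q
    proof -
      have "h q ((x, (y, s)), t) = ub q ((x, (y, s)), t)"
        by (rule h(2)) (use that in \<open>auto simp: Sb_def\<close>)
      then show ?thesis using ub_l[OF ns[OF that(1)] that(2,4,5)] by simp
    qed
    have hu: "h q ((x, (y, vertex 1 (snd q))), t) = u q ((x, y), t)"
      if "x \<in> nonsurj (fst q) n" "y \<in> smor (snd q) k" "t \<in> smor (fst q) 1" for x y t q
    proof -
      have "h q ((x, (y, vertex 1 (snd q))), t) = ub q ((x, (y, vertex 1 (snd q))), t)"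
        by (rule h(2)) (use that in \<open>auto simp: Sb_def vertex_smor\<close>)
      then show ?thesis unfolding ub_u .
    qed
    have hc: "h q ((x, (y, s)), t) \<in> cells F q" "\<rho> q (h q ((x, (y, s)), t)) = v q ((x, y), t)"
      if "x \<in> nonsurj (fst q) n" "y \<in> smor (snd q) k" "s \<in> smor (snd q) 1" "t \<in> smor (fst q) 1" for x y s t q
      using natD(1)[OF h(1), of "((x, (y, s)), t)" q] h(3)[of "((x, (y, s)), t)" q] that by (simp_all add: vb_def)
    have ha: "h p ((scmp x (fst a), (scmp y (snd a), scmp s (snd a))), scmp t (fst a))
        = act F p q a (h q ((x, (y, s)), t))"
      if "a \<in> bimor p q" "x \<in> nonsurj (fst q) n" "y \<in> smor (snd q) k" "s \<in> smor (snd q) 1" "t \<in> smor (fst q) 1" for p q a x y s t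
      using natD(2)[OF h(1) that(1), of "((x, (y, s)), t)"] that(2-) by simp
    let ?L = "psh_prod \<Delta>[n] \<Delta>[1]"
    let ?K = "pp \<Delta>[n] (\<lambda>m. nonsurj m n) \<Delta>[1] (\<lambda>m. {vertex 0 m})"
    let ?Z3 = "psh_prod (discrete ?L) (constant_obj (psh_prod \<Delta>[k] \<Delta>[1]))"
    let ?S3 = "pp (discrete ?L) (\<lambda>q. ?K (fst q)) (constant_obj (psh_prod \<Delta>[k] \<Delta>[1]))
        (\<lambda>q. {(y, s). y \<in> nonsurj (snd q) k \<or> s = vertex 0 (snd q)})"
    have L: "sset ?L" by (intro presheaf_prod \<Delta>)
    have K: "subsset ?L ?K"
      by (intro subpresheaf_pp \<Delta> sub_boundary sub_vertex) simp
    \<comment> \<open>Since \<open>s\<close> lies in the value direction, this homotopy extension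
      follows from the fibration property through prisms.\<close>
    have L3: "bilifts F X \<rho> ?Z3 ?S3"
      unfolding constant_obj_eq_pull
    proof (rule lifts_prism[OF bisset_discrete[OF L] sub_discrete[OF K]])
      show "snd u \<in> smor (snd p) (snd q)" if "u \<in> bimor p q" for p q u
        using that by (simp add: bimor_iff)
      show "bilifts F X \<rho> (psh_prod (discrete ?L) (pull snd snd \<Delta>[m]))
         (pp (discrete ?L) (\<lambda>q. ?K (fst q)) (pull snd snd \<Delta>[m]) (\<lambda>p. cells \<Lambda>[m,j] (snd p)))"
        if "1 \<le> m" "j \<le> m" for m j
        using fibration_box_lifts[OF reedy that L K] unfolding constant_obj_eq_pull .
    qed
    \<comment> \<open>The homotopy starts at \<open>l\<close>, follows \<open>h\<close> over
      \<partial>\<Delta>[n], and is constant on \<partial>\<Delta>[k] and at t = 0. By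
      \<open>hl\<close> these prescriptions agree on overlaps.\<close>
    define u3 where "u3 = (\<lambda>q ((x, t), (y, s)). if x \<in> nonsurj (fst q) n then h q ((x, (y, s)), t) else l q ((x, y), t))"
    define v3 where "v3 = (\<lambda>q ((x, t), (y, s::nat list)). v q ((x, y), t))"
    have S3_cases: "\<exists>x y s t. z = ((x, t), (y, s)) \<and> x \<in> smor (fst q) n \<and> t \<in> smor (fst q) 1 \<and>
        y \<in> smor (snd q) k \<and> s \<in> smor (snd q) 1 \<and>
        (x \<in> nonsurj (fst q) n \<or> (y \<in> nonsurj (snd q) k \<or> s = vertex 0 (snd q) \<or> t = vertex 0 (fst q)))"
      if "z \<in> ?S3 q" for z q
      using that by (cases z) auto
    have u3_l: "u3 q ((x, t), (y, s)) = l q ((x, y), t)"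
      if "y \<in> smor (snd q) k" "s \<in> smor (snd q) 1" "t \<in> smor (fst q) 1"
        "y \<in> nonsurj (snd q) k \<or> s = vertex 0 (snd q) \<or> t = vertex 0 (fst q)" for x y s t q
      using hl[OF _ that] by (simp add: u3_def)
    have c1: "bimap (?Z3\<lparr>cells := ?S3\<rparr>) F u3"
    proof (rule natI)
      fix q z assume "z \<in> cells (?Z3\<lparr>cells := ?S3\<rparr>) q"
      then have "z \<in> ?S3 q" by simp
      then obtain x y s t where z: "z = ((x, t), (y, s))" "x \<in> smor (fst q) n" "t \<in> smor (fst q) 1"
        "y \<in> smor (snd q) k" "s \<in> smor (snd q) 1"
        using S3_cases[of z q] by blast
      then show "u3 q z \<in> cells F q" using lc(1)[OF z(2,4,3)] hc(1)[OF _ z(4,5,3)] by (simp add: u3_def)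
    next
      fix p q a z assume a: "a \<in> bimor p q" and "z \<in> cells (?Z3\<lparr>cells := ?S3\<rparr>) q"
      then have "z \<in> ?S3 q" by simp
      then obtain x y s t where z: "z = ((x, t), (y, s))" "x \<in> smor (fst q) n" "t \<in> smor (fst q) 1"
        "y \<in> smor (snd q) k" "s \<in> smor (snd q) 1"
        and d: "x \<in> nonsurj (fst q) n \<or> (y \<in> nonsurj (snd q) k \<or> s = vertex 0 (snd q) \<or> t = vertex 0 (fst q))"
        using S3_cases[of z q] by blast
      have a12: "fst a \<in> smor (fst p) (fst q)" "snd a \<in> smor (snd p) (snd q)"
        using a by (simp_all add: bimor_iff)
      from d have "u3 p ((scmp x (fst a), scmp t (fst a)), (scmp y (snd a), scmp s (snd a)))
        = act F p q a (u3 q ((x, t), (y, s)))"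
      proof
        assume x: "x \<in> nonsurj (fst q) n"
        then show ?thesis using ha[OF a x z(4,5,3)] nonsurj_cmp[OF a12(1) x] by (simp add: u3_def)
      next
        assume d': "y \<in> nonsurj (snd q) k \<or> s = vertex 0 (snd q) \<or> t = vertex 0 (fst q)"
        then have "scmp y (snd a) \<in> nonsurj (snd p) k \<or> scmp s (snd a) = vertex 0 (snd p) \<or>
            scmp t (fst a) = vertex 0 (fst p)"
          using nonsurj_cmp[OF a12(2)] scmp_vertex[OF a12(1)] scmp_vertex[OF a12(2)] by blast
        then show ?thesis
          using u3_l[OF cmp_arr[OF a12(2) z(4)] cmp_arr[OF a12(2) z(5)] cmp_arr[OF a12(1) z(3)]]
            u3_l[OF z(4,5,3) d'] la[OF a z(2,4,3)] by simp
      qed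
      then show "u3 p (act (?Z3\<lparr>cells := ?S3\<rparr>) p q a z) = act F p q a (u3 q z)" by (simp add: z(1))
    qed
    have c2: "bimap ?Z3 X v3"
      using vc va by (intro natI) (auto simp: v3_def)
    have c3: "\<forall>q. \<forall>z\<in>?S3 q. \<rho> q (u3 q z) = v3 q z"
    proof (intro allI ballI)
      fix q z assume "z \<in> ?S3 q"
      then obtain x y s t where z: "z = ((x, t), (y, s))" "x \<in> smor (fst q) n" "t \<in> smor (fst q) 1"
        "y \<in> smor (snd q) k" "s \<in> smor (snd q) 1"
        using S3_cases[of z q] by blast
      then show "\<rho> q (u3 q z) = v3 q z" using lc(2)[OF z(2,4,3)] hc(2)[OF _ z(4,5,3)] by (simp add: u3_def v3_def)
    qed
    obtain g where g: "bimap ?Z3 F g" "\<And>q z. z \<in> ?S3 q \<Longrightarrow> g q z = u3 q z"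
      "\<And>q z. z \<in> cells ?Z3 q \<Longrightarrow> \<rho> q (g q z) = v3 q z"
      by (rule liftsE[OF L3 c1 c2 c3]) (rule that)
    \<comment> \<open>The end s = 1: over \<partial>\<Delta>[n] it is the end \<open>u\<close> of
      \<open>h\<close>. It still lies over \<open>v\<close>, since \<open>v3\<close> does not depend
      on \<open>s\<close>.\<close>
    define w where "w = (\<lambda>q ((x, y), t). g q ((x, t), (y, vertex 1 (snd q))))"
    have "bimap (psh_prod ?B ?I) F w"
    proof (rule natI)
      fix q z assume "z \<in> cells (psh_prod ?B ?I) q"
      then show "w q z \<in> cells F q" using natD(1)[OF g(1), of _ q] by (auto simp: w_def vertex_smor)
    next
      fix p q a z assume a: "a \<in> bimor p q" and "z \<in> cells (psh_prod ?B ?I) q"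
      then obtain x y t where z: "z = ((x, y), t)" "x \<in> smor (fst q) n" "y \<in> smor (snd q) k"
        "t \<in> smor (fst q) 1" by (cases z) auto
      have "snd a \<in> smor (snd p) (snd q)" using a by (simp add: bimor_iff)
      then show "w p (act (psh_prod ?B ?I) p q a z) = act F p q a (w q z)"
        using natD(2)[OF g(1) a, of "((x, t), (y, vertex 1 (snd q)))"] z by (simp add: w_def vertex_smor scmp_vertex)
    qed
    moreover have "w q z = u q z" if zS: "z \<in> ?S q" for q z
    proof -
      obtain x y t where z: "z = ((x, y), t)" by (cases z) auto
      have m: "x \<in> smor (fst q) n" "y \<in> smor (snd q) k" "t \<in> smor (fst q) 1"
        "x \<in> nonsurj (fst q) n \<or> y \<in> nonsurj (snd q) k \<or> t = vertex 0 (fst q)"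
        using zS[unfolded z S_mem] by blast+
      have "w q z = u3 q ((x, t), (y, vertex 1 (snd q)))"
        unfolding w_def z prod.case using m by (intro g(2)) (auto simp: vertex_smor)
      also have "\<dots> = u q z"
      proof (cases "x \<in> nonsurj (fst q) n")
        case True
        then show ?thesis using hu[OF True m(2,3)] by (simp add: u3_def z)
      next
        case False
        then show ?thesis using lu[OF m(1-3)] m(4) by (simp add: u3_def z)
      qed
      finally show ?thesis .
    qed
    moreover have "\<rho> q (w q z) = v q z" if zZ: "z \<in> cells (psh_prod ?B ?I) q" for q z
    proof -
      obtain x y t where z: "z = ((x, y), t)" "x \<in> smor (fst q) n" "y \<in> smor (snd q) k"
        "t \<in> smor (fst q) 1" using zZ by (cases z) auto
      then show ?thesis using g(3)[of "((x, t), (y, vertex 1 (snd q)))" q] by (simp add: w_def v3_def vertex_smor)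
    qed
    ultimately show "\<exists>w. bimap (psh_prod ?B ?I) F w \<and> (\<forall>q. \<forall>z\<in>?S q. w q z = u q z) \<and>
        (\<forall>q. \<forall>z\<in>cells (psh_prod ?B ?I) q. \<rho> q (w q z) = v q z)"
      by (intro exI[of _ w]) blast
  qed
qed

section \<open>Contracting the coslice\<close>

lemma map2_min_smor:
  assumes "s \<in> smor m n" "t \<in> smor m n"
  shows "map2 min s t \<in> smor m n"
proof (rule smorI)
  have len: "length s = Suc m" "length t = Suc m" using assms by (simp_all add: smor_iff)
  then show "length (map2 min s t) = Suc m" by simp
  show "map2 min s t ! i \<le> n" if "i \<le> m" for i
    using smor_nth(1)[OF assms(1) that] that len by (simp add: min.coboundedI1)
  show "map2 min s t ! i \<le> map2 min s t ! j" if "i \<le> j" "j \<le> m" for i j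
    using smor_nth(2)[OF assms(1) that] smor_nth(2)[OF assms(2) that] that len
    by (auto simp: min_le_iff_disj)
qed

lemma scmp_map2_min:
  assumes "s \<in> smor m n" "t \<in> smor m n" "u \<in> smor k m"
  shows "scmp (map2 min s t) u = map2 min (scmp s u) (scmp t u)"
  using assms smor_nth(1)[OF assms(3)]
  by (intro nth_equalityI) (auto simp: scmp_eq smor_iff less_Suc_eq_le)

lemma map2_min_vertex:
  assumes "s \<in> smor m 1"
  shows "map2 min s (vertex 0 m) = vertex 0 m" "map2 min (vertex 0 m) s = vertex 0 m" "map2 min s (vertex 1 m) = s"
  using assms smor_nth(1)[OF assms]
  by (auto intro!: nth_equalityI simp: vertex_def smor_iff less_Suc_eq_le min_def simp del: replicate_Suc)

lemma id_arrow_nat: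
  assumes X: "bisset X"
  shows "bimap X (Arrows X) (id_arrow X)"
proof -
  have "id_arrow X = curry_nat bisimplex_cat X interval (\<lambda>q (x, t). x)"
    by (simp add: id_arrow_def exp_const_def curry_nat_def fun_eq_iff)
  moreover have "bimap (psh_prod X interval) X (\<lambda>q (x, t). x)"
    by (rule natI) auto
  ultimately show ?thesis
    unfolding Arrows_def using curry_nat_nat[OF arrows.D X arrows.K] by metis
qed

text \<open>A cell of the exponential at \<open>q\<close> has values at every \<open>v\<close> from
  \<open>r\<close> to \<open>q\<close>, so \<tau> must be restricted along \<open>v\<close> before
  the minimum with \<sigma> is taken.\<close>

definition contraction :: "((nat list \<times> 'a cube) \<times> nat list, nat list \<times> 'a cube) bitrans" where
  "contraction q = (\<lambda>((e, f), \<tau>). (e, \<lambda>r. \<lambda>(v, \<sigma>)\<in>bimor r q \<times> cells interval r.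
     f r (v, map2 min \<sigma> (scmp \<tau> (fst v)))))"

lemma contraction_arrow:
  assumes f: "f \<in> cells (Arrows C) q" and \<tau>: "\<tau> \<in> smor (fst q) 1"
  shows "snd (contraction q ((e, f), \<tau>)) \<in> cells (Arrows C) q"
  unfolding Arrows_def cells_psh_exp
proof (intro conjI allI natI)
  note app = exp_app[OF f[unfolded Arrows_def]]
  have \<tau>v: "scmp \<tau> (fst v) \<in> smor (fst r) 1" if "v \<in> bimor r q" for v r
    using that \<tau> scmp_smor by (auto simp: bimor_iff)
  show "snd (contraction q ((e, f), \<tau>)) r \<in> extensional (bimor r q \<times> cells interval r)" for r
    by (simp add: contraction_def)
  show "snd (contraction q ((e, f), \<tau>)) r x \<in> cells C r"
    if "x \<in> cells (psh_prod (yoneda bisimplex_cat q) interval) r" for r x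
    using that app(1) map2_min_smor[OF _ \<tau>v] by (cases x) (simp add: contraction_def)
  fix r t a x assume a: "a \<in> bimor r t" and "x \<in> cells (psh_prod (yoneda bisimplex_cat q) interval) t"
  then obtain v \<sigma> where x: "x = (v, \<sigma>)" "v \<in> bimor t q" "\<sigma> \<in> smor (fst t) 1"
    by (cases x) simp
  have a1: "fst a \<in> smor (fst r) (fst t)" using a by (simp add: bimor_iff)
  have va: "cmp bisimplex_cat v a \<in> bimor r q"
    by (rule catD(2)[OF bisimplex_category a x(2)])
  have \<tau>va: "scmp \<tau> (fst (cmp bisimplex_cat v a)) = scmp (scmp \<tau> (fst v)) (fst a)"
    using catD(5)[OF simplex_category a1 _ \<tau>] x(2) by (simp add: cmp_bisimplex_cat bimor_iff)
  show "snd (contraction q ((e, f), \<tau>)) r (act (psh_prod (yoneda bisimplex_cat q) interval) r t a x)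
      = act C r t a (snd (contraction q ((e, f), \<tau>)) t x)"
    using app(2)[OF x(2) _ a, of "map2 min \<sigma> (scmp \<tau> (fst v))"] map2_min_smor[OF x(3) \<tau>v[OF x(2)]]
      x va scmp_smor[OF a1 x(3)] scmp_map2_min[OF x(3) \<tau>v[OF x(2)] a1]
    by (simp add: contraction_def \<tau>va)
qed

lemma contraction_nat: "bimap (psh_prod (coslice C c) interval) (coslice C c) contraction"
proof (rule natI)
  fix q x assume "x \<in> cells (psh_prod (coslice C c) interval) q"
  then obtain e f \<tau> where x: "x = ((e, f), \<tau>)" "e = vertex 0 (fst q)" "f \<in> cells (Arrows C) q" "c q e = src q f"
    "\<tau> \<in> smor (fst q) 1"
    unfolding coslice_def by (cases x) auto
  \<comment> \<open>The source is evaluated at \<sigma> = 0, where the minimum with \<tau> is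
    0.\<close>
  have "src q (snd (contraction q x)) = src q f"
    using catD(1)[OF bisimplex_category, of q] map2_min_vertex(2)[OF x(5)] x(5)
    by (simp add: src_def exp_ev_def contraction_def x(1) vertex_smor idn_bisimplex_cat)
  moreover have "fst (contraction q x) = e" by (simp add: contraction_def x(1))
  moreover have "snd (contraction q x) \<in> cells (Arrows C) q"
    using contraction_arrow[OF x(3,5)] by (simp add: x(1))
  ultimately show "contraction q x \<in> cells (coslice C c) q"
    unfolding coslice_def using x(2,4) by (cases "contraction q x") simp
next
  fix p q a x assume a: "a \<in> bimor p q" and "x \<in> cells (psh_prod (coslice C c) interval) q"
  then obtain e f \<tau> where x: "x = ((e, f), \<tau>)" "e = vertex 0 (fst q)" "f \<in> cells (Arrows C) q" "\<tau> \<in> smor (fst q) 1"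
    unfolding coslice_def by (cases x) auto
  have a1: "fst a \<in> smor (fst p) (fst q)" using a by (simp add: bimor_iff)
  have fa: "act (Arrows C) p q a f \<in> cells (Arrows C) p" by (rule pshD(1)[OF bisset_Arrows a x(3)])
  have \<tau>a: "scmp \<tau> (fst a) \<in> smor (fst p) 1" by (rule scmp_smor[OF a1 x(4)])
  have "snd (contraction p ((scmp e (fst a), act (Arrows C) p q a f), scmp \<tau> (fst a)))
     = act (Arrows C) p q a (snd (contraction q ((e, f), \<tau>)))"
    using contraction_arrow[OF fa \<tau>a] pshD(1)[OF bisset_Arrows a contraction_arrow[OF x(3,4)]]
    unfolding Arrows_def
  proof (rule exp_eqI)
    fix r v \<sigma> assume v: "v \<in> bimor r p" and \<sigma>: "\<sigma> \<in> cells interval r"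
    have v1: "fst v \<in> smor (fst r) (fst p)" using v by (simp add: bimor_iff)
    have av: "cmp bisimplex_cat a v \<in> bimor r q"
      by (rule catD(2)[OF bisimplex_category v a])
    have eq: "scmp \<tau> (fst (cmp bisimplex_cat a v)) = scmp (scmp \<tau> (fst a)) (fst v)"
      using catD(5)[OF simplex_category v1 a1 x(4)] by (simp add: cmp_bisimplex_cat)
    have "map2 min \<sigma> (scmp (scmp \<tau> (fst a)) (fst v)) \<in> smor (fst r) 1"
      using map2_min_smor[OF _ scmp_smor[OF v1 \<tau>a]] \<sigma> by simp
    then show "snd (contraction p ((scmp e (fst a), act (psh_exp bisimplex_cat C interval) p q a f), scmp \<tau> (fst a))) r (v, \<sigma>)
      = act (psh_exp bisimplex_cat C interval) p q a (snd (contraction q ((e, f), \<tau>))) r (v, \<sigma>)"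
      using v \<sigma> av by (simp add: contraction_def act_psh_exp eq)
  qed
  then show "contraction p (act (psh_prod (coslice C c) interval) p q a x) = act (coslice C c) p q a (contraction q x)"
    by (simp add: x(1) coslice_def contraction_def)
qed

text \<open>With \<tau> = 0 the arrow is evaluated at 0 only, and naturality turns these values into
  restrictions of its source \<open>c\<close>.\<close>

lemma contraction_source:
  assumes C: "bisset C" and c: "bimap point C c" and x: "x \<in> cells (coslice C c) q"
  shows "contraction q (x, vertex 0 (fst q)) = coslice_id C c q (vertex 0 (fst q))"
proof -
  obtain e f where ef: "x = (e, f)" "e = vertex 0 (fst q)" "f \<in> cells (Arrows C) q" "c q e = src q f"
    using x unfolding coslice_def by (cases x) auto
  have ce: "c q e \<in> cells C q" using natD(1)[OF c, of e q] ef(2) by simp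
  have "snd (contraction q ((e, f), vertex 0 (fst q))) = id_arrow C q (c q e)"
    using contraction_arrow[OF ef(3), of "vertex 0 (fst q)" e] natD(1)[OF id_arrow_nat[OF C] ce]
    unfolding Arrows_def
  proof (rule exp_eqI)
    show "vertex 0 (fst q) \<in> smor (fst q) 1" by (simp add: vertex_smor)
    fix r v \<sigma> assume v: "v \<in> bimor r q" and \<sigma>: "\<sigma> \<in> cells interval r"
    have v1: "fst v \<in> smor (fst r) (fst q)" using v by (simp add: bimor_iff)
    have "f r (v, vertex 0 (fst r)) = act C r q v (f q (idn bisimplex_cat q, vertex 0 (fst q)))"
      using exp_app(2)[OF ef(3)[unfolded Arrows_def] catD(1)[OF bisimplex_category] _ v, of "vertex 0 (fst q)"]
        catD(4)[OF bisimplex_category v] scmp_vertex[OF v1]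
      by (simp add: vertex_smor)
    also have "f q (idn bisimplex_cat q, vertex 0 (fst q)) = c q e" using ef(4) by (simp add: src_def exp_ev_def)
    finally have f_src: "f r (v, vertex 0 (fst r)) = act C r q v (c q e)" .
    have "map2 min \<sigma> (vertex 0 (fst r)) = vertex 0 (fst r)" using map2_min_vertex(1)[of \<sigma> "fst r"] \<sigma> by simp
    then show "snd (contraction q ((e, f), vertex 0 (fst q))) r (v, \<sigma>) = id_arrow C q (c q e) r (v, \<sigma>)"
      using v \<sigma> f_src scmp_vertex[OF v1] by (simp add: contraction_def id_arrow_def exp_const_def)
  qed
  then show ?thesis by (simp add: coslice_id_def ef(1,2) contraction_def)
qed

lemma contraction_target:
  assumes x: "x \<in> cells (coslice C c) q"
  shows "contraction q (x, vertex 1 (fst q)) = x"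
proof -
  obtain e f where ef: "x = (e, f)" "f \<in> cells (Arrows C) q"
    using x unfolding coslice_def by (cases x) auto
  have "snd (contraction q ((e, f), vertex 1 (fst q))) = f"
    using contraction_arrow[OF ef(2), of "vertex 1 (fst q)" e] ef(2)
    unfolding Arrows_def
  proof (rule exp_eqI)
    show "vertex 1 (fst q) \<in> smor (fst q) 1" by (simp add: vertex_smor)
    fix r v \<sigma> assume v: "v \<in> bimor r q" and \<sigma>: "\<sigma> \<in> cells interval r"
    have "fst v \<in> smor (fst r) (fst q)" using v by (simp add: bimor_iff)
    from scmp_vertex[OF this, of 1] map2_min_vertex(3)[of \<sigma> "fst r"]
    show "snd (contraction q ((e, f), vertex 1 (fst q))) r (v, \<sigma>) = f r (v, \<sigma>)"
      using v \<sigma> by (simp add: contraction_def)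
  qed
  then show ?thesis by (simp add: ef(1) contraction_def)
qed

text \<open>A constant arrow is unchanged by any reparametrisation.\<close>

lemma contraction_coslice_id:
  assumes C: "bisset C" and c: "bimap point C c" and \<tau>: "\<tau> \<in> smor (fst q) 1"
  shows "contraction q (coslice_id C c q (vertex 0 (fst q)), \<tau>) = coslice_id C c q (vertex 0 (fst q))"
proof -
  let ?e = "vertex 0 (fst q)"
  have ce: "c q ?e \<in> cells C q" using natD(1)[OF c, of ?e q] by simp
  note idc = natD(1)[OF id_arrow_nat[OF C] ce]
  have "snd (contraction q ((?e, id_arrow C q (c q ?e)), \<tau>)) = id_arrow C q (c q ?e)"
    using contraction_arrow[OF idc \<tau>] idc unfolding Arrows_def
  proof (rule exp_eqI)
    fix r v \<sigma> assume v: "v \<in> bimor r q" and \<sigma>: "\<sigma> \<in> cells interval r"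
    have "scmp \<tau> (fst v) \<in> smor (fst r) 1"
      using v \<tau> scmp_smor by (auto simp: bimor_iff)
    then show "snd (contraction q ((?e, id_arrow C q (c q ?e)), \<tau>)) r (v, \<sigma>) = id_arrow C q (c q ?e) r (v, \<sigma>)"
      using v \<sigma> map2_min_smor[of \<sigma> "fst r" 1] by (simp add: contraction_def id_arrow_def exp_const_def)
  qed
  then show ?thesis by (simp add: coslice_id_def contraction_def)
qed

lemma coslice_id_nat:
  assumes C: "bisset C" and c: "bimap point C c"
  shows "bimap point (coslice C c) (coslice_id C c)"
proof -
  have 1: "bimap point (Arrows C) (\<lambda>q t. id_arrow C q (c q t))" by (rule nat_trans_comp[OF c id_arrow_nat[OF C]])
  have "src q (id_arrow C q y) = y" if "y \<in> cells C q" for q y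
    using pshD(2)[OF C that] catD(1)[OF bisimplex_category, of q]
    by (simp add: src_def exp_ev_def id_arrow_def exp_const_def vertex_smor)
  then show ?thesis
    unfolding coslice_def coslice_id_def[abs_def] using natD[OF 1] natD[OF c]
    by (intro natI) (auto simp: scmp_vertex bisimplex_simps)
qed

theorem proposition6p7:
  fixes C :: "'a bisset" and F :: "'b bisset"
    and c :: "(nat list, 'a) bitrans"
    and \<rho> :: "('b, nat list \<times> 'a cube) bitrans"
    and d :: "(nat list, 'b) bitrans"
  assumes "category C"
    and "bimap point C c"
    and "covariant F (coslice C c) \<rho>"
    and "bimap point F d"
    and "\<forall>q. \<forall>t\<in>cells point q. \<rho> q (d q t) = coslice_id C c q t"
  shows "\<exists>s. bimap (coslice C c) F s \<and>
      (\<forall>q. \<forall>x\<in>cells (coslice C c) q. \<rho> q (s q x) = x) \<and>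
      (\<forall>q. \<forall>t\<in>cells point q. s q (coslice_id C c q t) = d q t)"
proof -
  let ?X = "coslice C c" and ?I = "interval" and ?v = "\<lambda>q. {vertex 0 (fst q)}"
  define S where "S = (\<lambda>q. {coslice_id C c q (vertex 0 (fst q))})"
  have sC: "simplicial_space C" using assms(1) by (simp add: category_def precategory_def)
  then have C: "bisset C" by (simp add: simplicial_space_def reedy_fibration_def)
  have reedy: "reedy_fibration F ?X \<rho>" using assms(3) by (simp add: covariant_def)
  then have F: "bisset F" and X: "bisset ?X" by (simp_all add: reedy_fibration_def)
  note idn = coslice_id_nat[OF C assms(2)]
  have idc: "coslice_id C c q (vertex 0 (fst q)) \<in> cells ?X q" for q
    using natD(1)[OF idn, of "vertex 0 (fst q)" q] by simp
  have S: "subbisset ?X S"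
    unfolding subpresheaf_def S_def using idc natD(2)[OF idn]
    by (auto simp flip: natD(2)[OF idn] simp: scmp_vertex bimor_iff)
  have I: "bisset ?I" and v0: "subbisset ?I ?v"
    using bisset_discrete[OF sset_simplex] sub_discrete[OF sub_vertex[of 0 1]] by simp_all
  \<comment> \<open>Lifts are available for every bisimplex, so the second alternative of
    \<open>lifts_cellwise\<close> applies to all cells.\<close>
  have L: "bilifts F ?X \<rho> (psh_prod ?X ?I) (pp ?X S ?I ?v)"
  proof (rule bisimplex.lifts_cellwise[OF X I F S v0], rule disjI2)
    fix q
    show "bilifts F ?X \<rho> (psh_prod (yoneda bisimplex_cat q) ?I)
        (pp (yoneda bisimplex_cat q) (\<lambda>p. bd2 p q) ?I ?v)"
      using source_lifts[OF reedy covariant_coslice_lifts[OF sC assms(2,3)], of "fst q" "snd q"] by simp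
  qed
  have const: "bimap (Z :: (_, _, 'z) psh) F (\<lambda>q z. d q (vertex 0 (fst q)))" for Z
    by (rule nat_trans_comp[OF to_point_nat assms(4)])
  \<comment> \<open>On the prescribed part, the start of the homotopy and the cylinder over the
    identity arrow, the contraction is constant at \<open>coslice_id\<close>; so the constant map at
    \<open>d\<close> covers it.\<close>
  have compat: "\<forall>q. \<forall>z\<in>pp ?X S ?I ?v q. \<rho> q (d q (vertex 0 (fst q))) = contraction q z"
    using assms(5) contraction_source[OF C assms(2)] contraction_coslice_id[OF C assms(2)]
    by (auto simp: S_def)
  obtain w where w: "bimap (psh_prod ?X ?I) F w" "\<And>q z. z \<in> pp ?X S ?I ?v q \<Longrightarrow> w q z = d q (vertex 0 (fst q))"
    "\<And>q z. z \<in> cells (psh_prod ?X ?I) q \<Longrightarrow> \<rho> q (w q z) = contraction q z"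
    by (rule liftsE[OF L const contraction_nat compat]) (rule that)
  let ?s = "\<lambda>q x. w q (x, vertex 1 (fst q))"
  have "bimap ?X F ?s"
  proof (rule natI)
    show "?s q x \<in> cells F q" if "x \<in> cells ?X q" for q x
      using natD(1)[OF w(1), of "(x, vertex 1 (fst q))" q] that by (simp add: vertex_smor)
    show "?s p (act ?X p q a x) = act F p q a (?s q x)" if "a \<in> bimor p q" "x \<in> cells ?X q" for p q a x
    proof -
      have "fst a \<in> smor (fst p) (fst q)" using that(1) by (simp add: bimor_iff)
      then show ?thesis
        using natD(2)[OF w(1) that(1), of "(x, vertex 1 (fst q))"] that(2) by (simp add: vertex_smor scmp_vertex)
    qed
  qed
  moreover have "\<rho> q (?s q x) = x" if "x \<in> cells ?X q" for q x
    using w(3)[of "(x, vertex 1 (fst q))" q] contraction_target[OF that] that by (simp add: vertex_smor)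
  \<comment> \<open>The lift was prescribed on the whole cylinder over the identity arrow, including
    its end.\<close>
  moreover have "?s q (coslice_id C c q t) = d q t" if "t \<in> cells point q" for q t
    using w(2)[of "(coslice_id C c q (vertex 0 (fst q)), vertex 1 (fst q))" q] that idc[of q]
    by (simp add: S_def vertex_smor)
  ultimately show ?thesis by (intro exI[of _ ?s]) blast
qed

end
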